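(* Let $G$ be a group, $k$ a field, $R$ a finite dimensional $G$-graded $k$-algebra, and let $\sigma\in G$. Then $R$ is a $\sigma$-graded Frobenius algebra if and only if it is a $\sigma$-graded Frobenius ring.
   Context: A $G$-graded $k$-algebra is a $k$-algebra with identity $R=\bigoplus_{g\in G}R_g$ (subspaces) with $R_gR_h\subset R_{gh}$. $R-gr$ is the category of graded left $R$-modules $M=\bigoplus_gM_g$ ($R_gM_h\subset M_{gh}$) with degree-preserving $R$-linear maps; the shift $M(\sigma)$ is $M$ with grading $M(\sigma)_g=M_{g\sigma}$. Graded Frobenius algebra: for $R$ finite dimensional, $R^*=\mathrm{Hom}_k(R,k)$ is a graded left $R$-module via $(af)(b)=f(ba)$ with $(R^* )_g=\{f\in R^*: f(R_h)=0\text{ for any }h\neq g^{-1}\}$. $R$ is a $\sigma$-graded Frobenius algebra if $R(\sigma)\simeq R^*$ in $R-gr$. Graded Frobenius ring: a $G$-graded ring $R$ is graded Artinian if it satisfies DCC on graded left and on graded right ideals, and graded quasi-Frobenius if it satisfies ACC on graded left ideals and is injective in $R-gr$; in the latter case the sum of the minimal graded left ideals equals the sum of the minimal graded right ideals and is denoted $\mathrm{soc}^{\rm gr}(R)$. $J^{\rm gr}(R)$ is the intersection of all maximal graded left ideals. A graded Artinian ring $R$ is a $\sigma$-graded Frobenius ring if it is graded quasi-Frobenius and $\mathrm{soc}^{\rm gr}(R)(\sigma)\simeq R/J^{\rm gr}(R)$ in $R-gr$. *)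

theory Defs
  imports "HOL-Algebra.AbelCoset" "Jordan_Normal_Form.Missing_VectorSpace"
begin

text \<open>
  Modules are left modules over a ring that need not be commutative, so the library locale
  \<^locale>\<open>module\<close> (which extends \<^locale>\<open>cring\<close>) does not apply.  As in the library, a module is
  a record of type \<^typ>\<open>('r, 'm) module\<close> whose fields \<^const>\<open>monoid.mult\<close> and \<^const>\<open>one\<close> are ignored.
\<close>

locale left_module = R: ring R + M: abelian_group M
  for R :: "('r, 'a) ring_scheme" and M :: "('r, 'm, 'b) module_scheme" (structure) +
  assumes smult_closed:
      "\<lbrakk>a \<in> carrier R; x \<in> carrier M\<rbrakk> \<Longrightarrow> a \<odot> x \<in> carrier M"
    and smult_l_distr:
      "\<lbrakk>a \<in> carrier R; b \<in> carrier R; x \<in> carrier M\<rbrakk> \<Longrightarrow> (a \<oplus>\<^bsub>R\<^esub> b) \<odot> x = a \<odot> x \<oplus> b \<odot> x"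
    and smult_r_distr:
      "\<lbrakk>a \<in> carrier R; x \<in> carrier M; y \<in> carrier M\<rbrakk> \<Longrightarrow> a \<odot> (x \<oplus> y) = a \<odot> x \<oplus> a \<odot> y"
    and smult_assoc1:
      "\<lbrakk>a \<in> carrier R; b \<in> carrier R; x \<in> carrier M\<rbrakk> \<Longrightarrow> (a \<otimes>\<^bsub>R\<^esub> b) \<odot> x = a \<odot> (b \<odot> x)"
    and smult_one:
      "x \<in> carrier M \<Longrightarrow> \<one>\<^bsub>R\<^esub> \<odot> x = x"

definition regular_module :: "('r, 'a) ring_scheme \<Rightarrow> ('r, 'r) module" where
  "regular_module R =
     \<lparr>carrier = carrier R, monoid.mult = monoid.mult R, one = one R, zero = zero R, add = add R,
      smult = monoid.mult R\<rparr>"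

text \<open>Only the additive structure of \<open>M\<close> is used.\<close>

definition internal_direct_sum ::
    "('m, 'b) ring_scheme \<Rightarrow> 'i set \<Rightarrow> ('i \<Rightarrow> 'm set) \<Rightarrow> bool" where
  "internal_direct_sum M I A \<longleftrightarrow>
     (\<forall>i\<in>I. additive_subgroup (A i) M) \<and>
     (\<forall>x\<in>carrier M. \<exists>!f. f \<in> (\<Pi>\<^sub>E i\<in>I. A i) \<and> finite {i\<in>I. f i \<noteq> \<zero>\<^bsub>M\<^esub>} \<and>
        x = (\<Oplus>\<^bsub>M\<^esub> i\<in>{i\<in>I. f i \<noteq> \<zero>\<^bsub>M\<^esub>}. f i))"


section \<open>Graded rings, algebras and modules\<close>

text \<open>A grading is given by its family of homogeneous components, indexed by \<^term>\<open>carrier G\<close>.\<close>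

locale graded_ring = G: group G + R: ring R
  for G :: "('g, 'c) monoid_scheme" and R :: "('r, 'a) ring_scheme" and \<R> :: "'g \<Rightarrow> 'r set" +
  assumes direct_sum: "internal_direct_sum R (carrier G) \<R>"
    and mult_comp:
      "\<lbrakk>g \<in> carrier G; h \<in> carrier G; x \<in> \<R> g; y \<in> \<R> h\<rbrakk> \<Longrightarrow> x \<otimes>\<^bsub>R\<^esub> y \<in> \<R> (g \<otimes>\<^bsub>G\<^esub> h)"

locale graded_algebra = graded_ring G R \<R> + K: vectorspace K R
  for G :: "('g, 'c) monoid_scheme" and K :: "('k, 'd) ring_scheme"
    and R :: "('k, 'r, 'a) module_scheme" and \<R> :: "'g \<Rightarrow> 'r set" +
  assumes comp_subspace: "g \<in> carrier G \<Longrightarrow> subspace K (\<R> g) R"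
    and smult_mult_left:
      "\<lbrakk>c \<in> carrier K; x \<in> carrier R; y \<in> carrier R\<rbrakk> \<Longrightarrow>
         (c \<odot>\<^bsub>R\<^esub> x) \<otimes>\<^bsub>R\<^esub> y = c \<odot>\<^bsub>R\<^esub> (x \<otimes>\<^bsub>R\<^esub> y)"
    and smult_mult_right:
      "\<lbrakk>c \<in> carrier K; x \<in> carrier R; y \<in> carrier R\<rbrakk> \<Longrightarrow>
         x \<otimes>\<^bsub>R\<^esub> (c \<odot>\<^bsub>R\<^esub> y) = c \<odot>\<^bsub>R\<^esub> (x \<otimes>\<^bsub>R\<^esub> y)"

locale graded_module = graded_ring G R \<R> + left_module R M
  for G :: "('g, 'c) monoid_scheme" and R :: "('r, 'a) ring_scheme" and \<R> :: "'g \<Rightarrow> 'r set"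
    and M :: "('r, 'm, 'b) module_scheme" and \<M> :: "'g \<Rightarrow> 'm set" +
  assumes module_direct_sum: "internal_direct_sum M (carrier G) \<M>"
    and smult_comp:
      "\<lbrakk>g \<in> carrier G; h \<in> carrier G; a \<in> \<R> g; x \<in> \<M> h\<rbrakk> \<Longrightarrow> a \<odot>\<^bsub>M\<^esub> x \<in> \<M> (g \<otimes>\<^bsub>G\<^esub> h)"

text \<open>The shift \<open>M(\<sigma>)\<close> has the same underlying module, so only the grading is shifted.\<close>

definition gr_shift :: "('g, 'c) monoid_scheme \<Rightarrow> 'g \<Rightarrow> ('g \<Rightarrow> 'm set) \<Rightarrow> 'g \<Rightarrow> 'm set" where
  "gr_shift G \<sigma> \<M> = (\<lambda>g. \<M> (g \<otimes>\<^bsub>G\<^esub> \<sigma>))"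

definition gr_hom ::
    "('g, 'c) monoid_scheme \<Rightarrow> ('r, 'a) ring_scheme \<Rightarrow>
     ('r, 'm, 'b) module_scheme \<Rightarrow> ('g \<Rightarrow> 'm set) \<Rightarrow>
     ('r, 'n, 'd) module_scheme \<Rightarrow> ('g \<Rightarrow> 'n set) \<Rightarrow> ('m \<Rightarrow> 'n) set" where
  "gr_hom G R M \<M> N \<N> = {f \<in> module_hom R M N. \<forall>g\<in>carrier G. f ` \<M> g \<subseteq> \<N> g}"

text \<open>A bijective morphism of \<open>R-gr\<close> has its inverse in \<open>R-gr\<close>.\<close>

definition gr_isomorphic ::
    "('g, 'c) monoid_scheme \<Rightarrow> ('r, 'a) ring_scheme \<Rightarrow>
     ('r, 'm, 'b) module_scheme \<Rightarrow> ('g \<Rightarrow> 'm set) \<Rightarrow>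
     ('r, 'n, 'd) module_scheme \<Rightarrow> ('g \<Rightarrow> 'n set) \<Rightarrow> bool" where
  "gr_isomorphic G R M \<M> N \<N> \<longleftrightarrow>
     (\<exists>f \<in> gr_hom G R M \<M> N \<N>. bij_betw f (carrier M) (carrier N))"


section \<open>Graded Frobenius algebras\<close>

text \<open>Functionals are represented as extensional functions on \<^term>\<open>carrier R\<close>.\<close>

definition dual_module ::
    "('k, 'd) ring_scheme \<Rightarrow> ('k, 'r, 'a) module_scheme \<Rightarrow> ('r, 'r \<Rightarrow> 'k) module" where
  "dual_module K R =
     \<lparr>carrier = module_hom K R (regular_module K) \<inter> extensional (carrier R),
      monoid.mult = undefined, one = undefined,
      zero = (\<lambda>b\<in>carrier R. \<zero>\<^bsub>K\<^esub>),
      add = (\<lambda>f f'. \<lambda>b\<in>carrier R. f b \<oplus>\<^bsub>K\<^esub> f' b),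
      smult = (\<lambda>a f. \<lambda>b\<in>carrier R. f (b \<otimes>\<^bsub>R\<^esub> a))\<rparr>"

definition dual_grading ::
    "('g, 'c) monoid_scheme \<Rightarrow> ('k, 'd) ring_scheme \<Rightarrow> ('k, 'r, 'a) module_scheme \<Rightarrow>
     ('g \<Rightarrow> 'r set) \<Rightarrow> 'g \<Rightarrow> ('r \<Rightarrow> 'k) set" where
  "dual_grading G K R \<R> g =
     {f \<in> carrier (dual_module K R).
        \<forall>h\<in>carrier G. h \<noteq> inv\<^bsub>G\<^esub> g \<longrightarrow> (\<forall>x\<in>\<R> h. f x = \<zero>\<^bsub>K\<^esub>)}"

definition graded_frobenius_algebra ::
    "('g, 'c) monoid_scheme \<Rightarrow> ('k, 'd) ring_scheme \<Rightarrow> ('k, 'r, 'a) module_scheme \<Rightarrow>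
     ('g \<Rightarrow> 'r set) \<Rightarrow> 'g \<Rightarrow> bool" where
  "graded_frobenius_algebra G K R \<R> \<sigma> \<longleftrightarrow>
     gr_isomorphic G R (regular_module R) (gr_shift G \<sigma> \<R>)
       (dual_module K R) (dual_grading G K R \<R>)"


section \<open>Graded one-sided ideals\<close>

definition graded_left_ideal ::
    "('g, 'c) monoid_scheme \<Rightarrow> ('r, 'a) ring_scheme \<Rightarrow> ('g \<Rightarrow> 'r set) \<Rightarrow> 'r set \<Rightarrow> bool" where
  "graded_left_ideal G R \<R> I \<longleftrightarrow>
     additive_subgroup I R \<and>
     (\<forall>a\<in>carrier R. \<forall>x\<in>I. a \<otimes>\<^bsub>R\<^esub> x \<in> I) \<and>
     internal_direct_sum (R\<lparr>carrier := I\<rparr>) (carrier G) (\<lambda>g. I \<inter> \<R> g)"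

definition graded_right_ideal ::
    "('g, 'c) monoid_scheme \<Rightarrow> ('r, 'a) ring_scheme \<Rightarrow> ('g \<Rightarrow> 'r set) \<Rightarrow> 'r set \<Rightarrow> bool" where
  "graded_right_ideal G R \<R> I \<longleftrightarrow>
     additive_subgroup I R \<and>
     (\<forall>a\<in>carrier R. \<forall>x\<in>I. x \<otimes>\<^bsub>R\<^esub> a \<in> I) \<and>
     internal_direct_sum (R\<lparr>carrier := I\<rparr>) (carrier G) (\<lambda>g. I \<inter> \<R> g)"

definition minimal_graded_left_ideal ::
    "('g, 'c) monoid_scheme \<Rightarrow> ('r, 'a) ring_scheme \<Rightarrow> ('g \<Rightarrow> 'r set) \<Rightarrow> 'r set \<Rightarrow> bool" where
  "minimal_graded_left_ideal G R \<R> I \<longleftrightarrow>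
     minimal I (\<lambda>J. graded_left_ideal G R \<R> J \<and> J \<noteq> {\<zero>\<^bsub>R\<^esub>})"

definition maximal_graded_left_ideal ::
    "('g, 'c) monoid_scheme \<Rightarrow> ('r, 'a) ring_scheme \<Rightarrow> ('g \<Rightarrow> 'r set) \<Rightarrow> 'r set \<Rightarrow> bool" where
  "maximal_graded_left_ideal G R \<R> I \<longleftrightarrow>
     maximal I (\<lambda>J. graded_left_ideal G R \<R> J \<and> J \<noteq> carrier R)"

text \<open>Finite sums of elements taken from minimal graded left ideals.\<close>

definition gr_soc ::
    "('g, 'c) monoid_scheme \<Rightarrow> ('r, 'a) ring_scheme \<Rightarrow> ('g \<Rightarrow> 'r set) \<Rightarrow> 'r set" where
  "gr_soc G R \<R> =
     {\<Oplus>\<^bsub>R\<^esub> I\<in>F. x I | F x. finite F \<and> (\<forall>I\<in>F. minimal_graded_left_ideal G R \<R> I \<and> x I \<in> I)}"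

text \<open>The intersection with \<^term>\<open>carrier R\<close> only matters for the zero ring.\<close>

definition gr_jacobson ::
    "('g, 'c) monoid_scheme \<Rightarrow> ('r, 'a) ring_scheme \<Rightarrow> ('g \<Rightarrow> 'r set) \<Rightarrow> 'r set" where
  "gr_jacobson G R \<R> = carrier R \<inter> \<Inter>{I. maximal_graded_left_ideal G R \<R> I}"

definition quotient_module ::
    "('r, 'a) ring_scheme \<Rightarrow> ('r, 'm, 'b) module_scheme \<Rightarrow> 'm set \<Rightarrow> ('r, 'm set) module" where
  "quotient_module R M N =
     \<lparr>carrier = a_rcosets\<^bsub>M\<^esub> N, monoid.mult = undefined, one = undefined,
      zero = N, add = set_add M,
      smult = (\<lambda>a X. \<Union>x\<in>X. N +>\<^bsub>M\<^esub> (a \<odot>\<^bsub>M\<^esub> x))\<rparr>"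

definition quotient_grading ::
    "('m, 'b) ring_scheme \<Rightarrow> 'm set \<Rightarrow> ('g \<Rightarrow> 'm set) \<Rightarrow> 'g \<Rightarrow> 'm set set" where
  "quotient_grading M N \<M> g = (\<lambda>x. N +>\<^bsub>M\<^esub> x) ` \<M> g"


section \<open>Graded Frobenius rings\<close>

definition dcc :: "('a set \<Rightarrow> bool) \<Rightarrow> bool" where
  "dcc P \<longleftrightarrow> (\<forall>I :: nat \<Rightarrow> 'a set.
     (\<forall>n. P (I n) \<and> I (Suc n) \<subseteq> I n) \<longrightarrow> (\<exists>N. \<forall>n\<ge>N. I n = I N))"

definition acc :: "('a set \<Rightarrow> bool) \<Rightarrow> bool" where
  "acc P \<longleftrightarrow> (\<forall>I :: nat \<Rightarrow> 'a set.
     (\<forall>n. P (I n) \<and> I n \<subseteq> I (Suc n)) \<longrightarrow> (\<exists>N. \<forall>n\<ge>N. I n = I N))"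

text \<open>
  Injectivity quantifies over all objects of \<open>R-gr\<close>.  HOL has no quantification over types inside a
  formula, so the objects range over the graded modules whose elements live in a given type \<open>'m\<close>,
  which plays the role of the universe and has to contain a copy of \<open>R\<close>.  Using \<open>'r + 'u\<close> for \<open>'m\<close>
  with a free type variable \<open>'u\<close> gives an arbitrarily large universe of this kind.  The monomorphisms of \<open>R-gr\<close> are the injective morphisms.
\<close>

definition gr_injective ::
    "'m itself \<Rightarrow> ('g, 'c) monoid_scheme \<Rightarrow> ('r, 'a) ring_scheme \<Rightarrow> ('g \<Rightarrow> 'r set) \<Rightarrow>
     ('r, 'e, 'b) module_scheme \<Rightarrow> ('g \<Rightarrow> 'e set) \<Rightarrow> bool" where
  "gr_injective (_ :: 'm itself) G R \<R> E \<E> \<longleftrightarrow>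
     (\<forall>(M :: ('r, 'm) module) \<M> (N :: ('r, 'm) module) \<N> i f.
        graded_module G R \<R> M \<M> \<and> graded_module G R \<R> N \<N> \<and>
        i \<in> gr_hom G R M \<M> N \<N> \<and> inj_on i (carrier M) \<and>
        f \<in> gr_hom G R M \<M> E \<E> \<longrightarrow>
        (\<exists>h \<in> gr_hom G R N \<N> E \<E>. \<forall>x\<in>carrier M. h (i x) = f x))"

definition graded_artinian ::
    "('g, 'c) monoid_scheme \<Rightarrow> ('r, 'a) ring_scheme \<Rightarrow> ('g \<Rightarrow> 'r set) \<Rightarrow> bool" where
  "graded_artinian G R \<R> \<longleftrightarrow> dcc (graded_left_ideal G R \<R>) \<and> dcc (graded_right_ideal G R \<R>)"

definition graded_quasi_frobenius ::
    "'m itself \<Rightarrow> ('g, 'c) monoid_scheme \<Rightarrow> ('r, 'a) ring_scheme \<Rightarrow> ('g \<Rightarrow> 'r set) \<Rightarrow> bool" where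
  "graded_quasi_frobenius U G R \<R> \<longleftrightarrow>
     acc (graded_left_ideal G R \<R>) \<and> gr_injective U G R \<R> (regular_module R) \<R>"

definition graded_frobenius_ring ::
    "'m itself \<Rightarrow> ('g, 'c) monoid_scheme \<Rightarrow> ('r, 'a) ring_scheme \<Rightarrow> ('g \<Rightarrow> 'r set) \<Rightarrow> 'g \<Rightarrow> bool" where
  "graded_frobenius_ring U G R \<R> \<sigma> \<longleftrightarrow>
     graded_artinian G R \<R> \<and> graded_quasi_frobenius U G R \<R> \<and>
     gr_isomorphic G R
       ((regular_module R)\<lparr>carrier := gr_soc G R \<R>\<rparr>)
       (gr_shift G \<sigma> (\<lambda>g. gr_soc G R \<R> \<inter> \<R> g))
       (quotient_module R (regular_module R) (gr_jacobson G R \<R>))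
       (quotient_grading (regular_module R) (gr_jacobson G R \<R>) \<R>)"

end

theory Submission
  imports Defs
begin

text \<open>
  Call a functional \<open>\<rho>\<close> on \<open>R\<close> homogeneous of degree \<open>\<sigma>\<close> if it vanishes on \<open>R\<^sub>h\<close> for \<open>h \<noteq> \<sigma>\<close>, and
  nondegenerate if \<open>\<rho>(Rr) = 0\<close> implies \<open>r = 0\<close>.  Both sides of the equivalence amount to the
  existence of a nondegenerate functional of degree \<open>\<sigma>\<close>.  For algebras it is the image of \<open>1\<close> under
  \<open>R(\<sigma>) \<cong> R\<^sup>*\<close>.

  For rings, the key is a functional \<open>\<tau>\<close> of degree \<open>1\<close> that kills \<open>J = J\<^sup>g\<^sup>r(R)\<close> and induces a
  nondegenerate form on the graded semisimple algebra \<open>R/J\<close>: decompose \<open>1 = \<Sum> e\<^sub>m\<close> modulo \<open>J\<close> into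
  orthogonal idempotents of degree \<open>1\<close> with \<open>Re\<^sub>m\<close> simple modulo \<open>J\<close>, and put
  \<open>\<tau>(b) = \<Sum> \<nu>\<^sub>m(e\<^sub>m b e\<^sub>m)\<close> with \<open>\<nu>\<^sub>m(e\<^sub>m) = 1\<close>.
  If \<open>\<rho>\<close> is nondegenerate, then \<open>\<tau> = \<rho>(_ x)\<close> for some \<open>x\<close> of degree \<open>\<sigma>\<close>, and \<open>s \<mapsto> sx\<close> induces
  \<open>R/J \<cong> soc(R)(\<sigma>)\<close>; surjectivity is a dimension count, as \<open>soc(R)\<close> is the right annihilator of \<open>J\<close>.
  Conversely an isomorphism \<open>\<theta> : soc(R)(\<sigma>) \<cong> R/J\<close> yields \<open>\<tau> \<circ> \<theta>\<close> on the socle, and every extension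
  of it to a functional of degree \<open>\<sigma>\<close> is nondegenerate because the socle is essential.

  Graded injectivity of \<open>R\<close> follows from \<open>\<rho>\<close>: a graded map \<open>f\<close> into \<open>R\<close> is determined by the functional
  \<open>\<rho> \<circ> f\<close>, and functionals extend.
\<close>

text \<open>A functional has to be built with a prescribed degree, not only with prescribed values.
  Both extensions therefore prescribe it on two subspaces at once: given values on a graded
  subspace, and zero on all elements whose component in degree \<open>\<sigma>\<close> vanishes. The
  two prescriptions agree where they meet because the domain is graded and the given functional
  already ignores the other degrees. Likewise, an element representing a functional of known degree
  is homogeneous by uniqueness: its component in the right degree represents the same functional.

  Objects of \<open>R-gr\<close> have unbounded dimension over \<open>K\<close>, so extension rests
  on Zorn's lemma. The finite dimension of \<open>R\<close> is spent on the chain conditions, on the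
  existence of minimal graded left ideals, on the finiteness of the family behind the
  \<open>e m\<close>, and on one rank-nullity argument that serves both \<open>\<rho>\<close> and,
  modulo \<open>J\<close>, the form of \<open>\<tau>\<close>.\<close>

abbreviation functional ::
    "('k, 'd) ring_scheme \<Rightarrow> ('k, 'v, 'a) module_scheme \<Rightarrow> ('v \<Rightarrow> 'k) \<Rightarrow> bool" where
  "functional K V f \<equiv> f \<in> module_hom K V (regular_module K)"

lemma regular_module_simps [simp]:
  "carrier (regular_module R) = carrier R"
  "monoid.mult (regular_module R) = monoid.mult R"
  "one (regular_module R) = one R"
  "zero (regular_module R) = zero R"
  "add (regular_module R) = add R"
  "smult (regular_module R) = monoid.mult R"
  by (simp_all add: regular_module_def)

section \<open>Linear functionals and subspaces of a vector space\<close>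

context vectorspace
begin

lemma functionalI:
  assumes "\<And>x. x \<in> carrier V \<Longrightarrow> f x \<in> carrier K"
    and "\<And>x y. x \<in> carrier V \<Longrightarrow> y \<in> carrier V \<Longrightarrow> f (x \<oplus>\<^bsub>V\<^esub> y) = f x \<oplus>\<^bsub>K\<^esub> f y"
    and "\<And>c x. c \<in> carrier K \<Longrightarrow> x \<in> carrier V \<Longrightarrow> f (c \<odot>\<^bsub>V\<^esub> x) = c \<otimes>\<^bsub>K\<^esub> f x"
  shows "functional K V f"
  using assms by (auto simp: module_hom_def)

context
  fixes f assumes f: "functional K V f"
begin

lemma functional_closed: "x \<in> carrier V \<Longrightarrow> f x \<in> carrier K"
  using f by (auto simp: module_hom_def)

lemma functional_add: "x \<in> carrier V \<Longrightarrow> y \<in> carrier V \<Longrightarrow> f (x \<oplus>\<^bsub>V\<^esub> y) = f x \<oplus>\<^bsub>K\<^esub> f y"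
  using f by (auto simp: module_hom_def)

lemma functional_smult:
  "c \<in> carrier K \<Longrightarrow> x \<in> carrier V \<Longrightarrow> f (c \<odot>\<^bsub>V\<^esub> x) = c \<otimes>\<^bsub>K\<^esub> f x"
  using f by (auto simp: module_hom_def)

lemma functional_zero: "f \<zero>\<^bsub>V\<^esub> = \<zero>\<^bsub>K\<^esub>"
  using functional_smult[of "\<zero>\<^bsub>K\<^esub>" "\<zero>\<^bsub>V\<^esub>"] functional_closed[of "\<zero>\<^bsub>V\<^esub>"] by (simp add: lmult_0)

lemma functional_neg: "x \<in> carrier V \<Longrightarrow> f (\<ominus>\<^bsub>V\<^esub> x) = \<ominus>\<^bsub>K\<^esub> f x"
proof -
  assume x: "x \<in> carrier V"
  have "f (\<ominus>\<^bsub>V\<^esub> x) \<oplus>\<^bsub>K\<^esub> f x = \<zero>\<^bsub>K\<^esub>"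
    using x functional_add[of "\<ominus>\<^bsub>V\<^esub> x" x] functional_zero by (simp add: M.l_neg)
  then show ?thesis
    using x functional_closed R.minus_equality by simp
qed

lemma functional_minus:
  "x \<in> carrier V \<Longrightarrow> y \<in> carrier V \<Longrightarrow> f (x \<ominus>\<^bsub>V\<^esub> y) = f x \<ominus>\<^bsub>K\<^esub> f y"
  by (simp add: a_minus_def functional_add functional_neg)

end

lemma subspaceI:
  assumes "W \<subseteq> carrier V" "\<zero>\<^bsub>V\<^esub> \<in> W"
    and "\<And>x y. x \<in> W \<Longrightarrow> y \<in> W \<Longrightarrow> x \<oplus>\<^bsub>V\<^esub> y \<in> W"
    and "\<And>c x. c \<in> carrier K \<Longrightarrow> x \<in> W \<Longrightarrow> c \<odot>\<^bsub>V\<^esub> x \<in> W"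
  shows "subspace K W V"
  using assms by (auto intro!: subspace.intro submodule.intro vectorspace_axioms module_axioms)

lemma
  assumes "subspace K W V"
  shows subspace_subset: "W \<subseteq> carrier V"
    and subspace_zero: "\<zero>\<^bsub>V\<^esub> \<in> W"
    and subspace_add: "x \<in> W \<Longrightarrow> y \<in> W \<Longrightarrow> x \<oplus>\<^bsub>V\<^esub> y \<in> W"
    and subspace_smult: "c \<in> carrier K \<Longrightarrow> x \<in> W \<Longrightarrow> c \<odot>\<^bsub>V\<^esub> x \<in> W"
    and subspace_neg: "x \<in> W \<Longrightarrow> \<ominus>\<^bsub>V\<^esub> x \<in> W"
    and subspace_minus: "x \<in> W \<Longrightarrow> y \<in> W \<Longrightarrow> x \<ominus>\<^bsub>V\<^esub> y \<in> W"
proof -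
  interpret submodule K W V using assms by (simp add: subspace_def)
  show 1: "W \<subseteq> carrier V" by (rule subset)
  show "\<zero>\<^bsub>V\<^esub> \<in> W" by simp
  show 2: "x \<oplus>\<^bsub>V\<^esub> y \<in> W" if "x \<in> W" "y \<in> W" for x y using that by simp
  show 3: "c \<odot>\<^bsub>V\<^esub> x \<in> W" if "c \<in> carrier K" "x \<in> W" for c x using that by simp
  show 4: "\<ominus>\<^bsub>V\<^esub> x \<in> W" if "x \<in> W" for x
    using 3[OF R.a_inv_closed[OF R.one_closed] that] subsetD[OF 1 that] by (simp add: smult_minus_1)
  show "x \<ominus>\<^bsub>V\<^esub> y \<in> W" if "x \<in> W" "y \<in> W" for x y
    using 2 4 that by (simp add: a_minus_def)
qed

subsection \<open>Extension of functionals\<close>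

lemma minus_zero_vector: "\<ominus>\<^bsub>V\<^esub> \<zero>\<^bsub>V\<^esub> = \<zero>\<^bsub>V\<^esub>"
  by (rule M.minus_equality) auto

text \<open>A subspace maximal among those containing \<open>B\<close> and avoiding \<open>v\<close>
  is a complement of the line through \<open>v\<close>, and \<open>\<nu>\<close> is the coordinate
  along \<open>v\<close> modulo that subspace. Zorn's lemma supplies it, since \<open>V\<close> will
  also be an arbitrary graded module of possibly infinite dimension.\<close>

lemma functional_separating:
  assumes B: "subspace K B V" and v: "v \<in> carrier V" "v \<notin> B"
  obtains \<nu> where "functional K V \<nu>" "\<And>x. x \<in> B \<Longrightarrow> \<nu> x = \<zero>\<^bsub>K\<^esub>" "\<nu> v = \<one>\<^bsub>K\<^esub>"
proof -
  let ?S = "{W. subspace K W V \<and> B \<subseteq> W \<and> v \<notin> W}"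
  have zorn: "\<exists>W\<in>?S. \<forall>X\<in>?S. W \<subseteq> X \<longrightarrow> X = W"
  proof (rule subset_Zorn_nonempty)
    show "?S \<noteq> {}" using assms by auto
    fix C assume C: "C \<noteq> {}" "subset.chain ?S C"
    then have CS: "C \<subseteq> ?S" by (simp add: subset.chain_def)
    have "subspace K (\<Union>C) V"
    proof (rule subspaceI)
      show "\<Union>C \<subseteq> carrier V" using CS subspace_subset by blast
      show "\<zero>\<^bsub>V\<^esub> \<in> \<Union>C" using CS C(1) subspace_zero by blast
      show "c \<odot>\<^bsub>V\<^esub> x \<in> \<Union>C" if "c \<in> carrier K" "x \<in> \<Union>C" for c x
        using CS that subspace_smult by blast
      fix x y assume "x \<in> \<Union>C" "y \<in> \<Union>C"
      then obtain X Y where XY: "X \<in> C" "Y \<in> C" "x \<in> X" "y \<in> Y" by auto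
      then have "X \<subseteq> Y \<or> Y \<subseteq> X" using C(2) by (auto simp: subset.chain_def)
      then show "x \<oplus>\<^bsub>V\<^esub> y \<in> \<Union>C"
        using XY CS subspace_add by blast
    qed
    then show "\<Union>C \<in> ?S" using CS C(1) by auto
  qed
  obtain W where W: "subspace K W V" "B \<subseteq> W" "v \<notin> W"
    and max: "\<And>X. subspace K X V \<Longrightarrow> W \<subseteq> X \<Longrightarrow> v \<notin> X \<Longrightarrow> X = W"
  proof -
    obtain W where "W \<in> ?S" "\<And>X. X \<in> ?S \<Longrightarrow> W \<subseteq> X \<Longrightarrow> X = W"
      using zorn by auto
    then show thesis using that[of W] by auto
  qed
  note [simp] = subspace_subset[OF W(1), THEN subsetD]
  \<comment> \<open>Maximality makes \<open>W\<close> and \<open>v\<close> span \<open>V\<close>: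
    for \<open>y\<close> outside \<open>W\<close> the larger subspace \<open>W + K y\<close> must
    contain \<open>v\<close>, say \<open>v = w + c y\<close>, and \<open>c\<close> is nonzero
    because \<open>v\<close> is not in \<open>W\<close>. Dividing by \<open>c\<close> expresses
    \<open>y\<close> modulo \<open>W\<close> as a multiple of \<open>v\<close>.\<close>
  have ex: "\<exists>c. c \<in> carrier K \<and> y \<ominus>\<^bsub>V\<^esub> c \<odot>\<^bsub>V\<^esub> v \<in> W" if y: "y \<in> carrier V" for y
  proof (cases "y \<in> W")
    case True
    then show ?thesis
      using v y by (intro exI[of _ "\<zero>\<^bsub>K\<^esub>"]) (simp add: a_minus_def lmult_0 minus_zero_vector)
  next
    case False
    let ?X = "(\<lambda>(w, c). w \<oplus>\<^bsub>V\<^esub> c \<odot>\<^bsub>V\<^esub> y) ` (W \<times> carrier K)"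
    have X: "subspace K ?X V"
    proof (rule subspaceI)
      show "?X \<subseteq> carrier V" using y by auto
      show "\<zero>\<^bsub>V\<^esub> \<in> ?X"
        using y W(1) by (intro image_eqI[of _ _ "(\<zero>\<^bsub>V\<^esub>, \<zero>\<^bsub>K\<^esub>)"]) (auto simp: subspace_zero lmult_0)
      show "x \<oplus>\<^bsub>V\<^esub> x' \<in> ?X" if xx: "x \<in> ?X" "x' \<in> ?X" for x x'
      proof -
        obtain w c w' c' where "w \<in> W" "w' \<in> W" "c \<in> carrier K" "c' \<in> carrier K"
          "x = w \<oplus>\<^bsub>V\<^esub> c \<odot>\<^bsub>V\<^esub> y" "x' = w' \<oplus>\<^bsub>V\<^esub> c' \<odot>\<^bsub>V\<^esub> y"
          using xx by auto
        then show ?thesis using y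
          by (intro image_eqI[of _ _ "(w \<oplus>\<^bsub>V\<^esub> w', c \<oplus>\<^bsub>K\<^esub> c')"])
            (auto simp: subspace_add[OF W(1)] smult_l_distr M.a_ac)
      qed
      show "a \<odot>\<^bsub>V\<^esub> x \<in> ?X" if xx: "a \<in> carrier K" "x \<in> ?X" for a x
      proof -
        obtain w c where "w \<in> W" "c \<in> carrier K" "x = w \<oplus>\<^bsub>V\<^esub> c \<odot>\<^bsub>V\<^esub> y"
          using xx by auto
        then show ?thesis using y xx(1)
          by (intro image_eqI[of _ _ "(a \<odot>\<^bsub>V\<^esub> w, a \<otimes>\<^bsub>K\<^esub> c)"])
            (auto simp: subspace_smult[OF W(1)] smult_r_distr smult_assoc1)
      qed
    qed
    have WX: "W \<subseteq> ?X"
      using y by (auto intro!: image_eqI[of _ _ "(_, \<zero>\<^bsub>K\<^esub>)"] simp: lmult_0)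
    have "y \<in> ?X"
      using y W(1) by (intro image_eqI[of _ _ "(\<zero>\<^bsub>V\<^esub>, \<one>\<^bsub>K\<^esub>)"]) (auto simp: subspace_zero)
    then have "v \<in> ?X" using max[OF X WX] False by blast
    then obtain w c where wc: "w \<in> W" "c \<in> carrier K" "v = w \<oplus>\<^bsub>V\<^esub> c \<odot>\<^bsub>V\<^esub> y" by auto
    have "c \<noteq> \<zero>\<^bsub>K\<^esub>"
      using wc W(3) y by (auto simp: lmult_0)
    then have i: "inv\<^bsub>K\<^esub> c \<in> carrier K" "inv\<^bsub>K\<^esub> c \<otimes>\<^bsub>K\<^esub> c = \<one>\<^bsub>K\<^esub>"
      using wc(2) field_Units by auto
    have "inv\<^bsub>K\<^esub> c \<odot>\<^bsub>V\<^esub> v = inv\<^bsub>K\<^esub> c \<odot>\<^bsub>V\<^esub> w \<oplus>\<^bsub>V\<^esub> y"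
      using wc i y by (simp add: smult_r_distr flip: smult_assoc1)
    then have "y \<ominus>\<^bsub>V\<^esub> inv\<^bsub>K\<^esub> c \<odot>\<^bsub>V\<^esub> v = \<ominus>\<^bsub>V\<^esub> (inv\<^bsub>K\<^esub> c \<odot>\<^bsub>V\<^esub> w)"
      using y i wc(1)
      by (simp add: a_minus_def M.minus_add M.a_lcomm[of y] M.r_neg)
    then show ?thesis using i(1) wc(1) W(1) by (auto simp: subspace_neg subspace_smult)
  qed
  \<comment> \<open>Two different coefficients would put a nonzero multiple of \<open>v\<close>, and
    hence \<open>v\<close> itself, into \<open>W\<close>.\<close>
  have uniq: "c = c'" if "c \<in> carrier K" "c' \<in> carrier K" "y \<in> carrier V"
    and cc: "y \<ominus>\<^bsub>V\<^esub> c \<odot>\<^bsub>V\<^esub> v \<in> W" "y \<ominus>\<^bsub>V\<^esub> c' \<odot>\<^bsub>V\<^esub> v \<in> W" for c c' y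
  proof (rule ccontr)
    assume ne: "c \<noteq> c'"
    have "(y \<ominus>\<^bsub>V\<^esub> c \<odot>\<^bsub>V\<^esub> v) \<ominus>\<^bsub>V\<^esub> (y \<ominus>\<^bsub>V\<^esub> c' \<odot>\<^bsub>V\<^esub> v) = (c' \<ominus>\<^bsub>K\<^esub> c) \<odot>\<^bsub>V\<^esub> v"
      using that v by (simp add: a_minus_def smult_l_distr smult_l_minus M.minus_add M.a_ac M.r_neg M.r_neg1 M.r_neg2)
    then have m: "(c' \<ominus>\<^bsub>K\<^esub> c) \<odot>\<^bsub>V\<^esub> v \<in> W"
      using cc subspace_minus[OF W(1)] by metis
    have nz: "c' \<ominus>\<^bsub>K\<^esub> c \<noteq> \<zero>\<^bsub>K\<^esub>" using ne that by auto
    then have "c' \<ominus>\<^bsub>K\<^esub> c \<in> Units K" using that field_Units by simp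
    then have "inv\<^bsub>K\<^esub> (c' \<ominus>\<^bsub>K\<^esub> c) \<odot>\<^bsub>V\<^esub> ((c' \<ominus>\<^bsub>K\<^esub> c) \<odot>\<^bsub>V\<^esub> v) = v"
      using v that by (simp flip: smult_assoc1)
    then have "v \<in> W" using subspace_smult[OF W(1) _ m] \<open>c' \<ominus>\<^bsub>K\<^esub> c \<in> Units K\<close>
      by (metis Units_inv_closed)
    then show False using W(3) by simp
  qed
  define \<nu> where "\<nu> y = (SOME c. c \<in> carrier K \<and> y \<ominus>\<^bsub>V\<^esub> c \<odot>\<^bsub>V\<^esub> v \<in> W)" for y
  have \<nu>: "\<nu> y \<in> carrier K" "y \<ominus>\<^bsub>V\<^esub> \<nu> y \<odot>\<^bsub>V\<^esub> v \<in> W" if "y \<in> carrier V" for y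
    using someI_ex[OF ex[OF that]] unfolding \<nu>_def by auto
  have \<nu>_eq: "\<nu> y = c" if "y \<in> carrier V" "c \<in> carrier K" "y \<ominus>\<^bsub>V\<^esub> c \<odot>\<^bsub>V\<^esub> v \<in> W" for y c
    using uniq \<nu> that by blast
  show ?thesis
  proof (rule that)
    show "functional K V \<nu>"
    proof (rule functionalI)
      fix x y assume xy: "x \<in> carrier V" "y \<in> carrier V"
      have "(x \<oplus>\<^bsub>V\<^esub> y) \<ominus>\<^bsub>V\<^esub> (\<nu> x \<oplus>\<^bsub>K\<^esub> \<nu> y) \<odot>\<^bsub>V\<^esub> v
          = (x \<ominus>\<^bsub>V\<^esub> \<nu> x \<odot>\<^bsub>V\<^esub> v) \<oplus>\<^bsub>V\<^esub> (y \<ominus>\<^bsub>V\<^esub> \<nu> y \<odot>\<^bsub>V\<^esub> v)"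
        using xy \<nu> v by (simp add: a_minus_def smult_l_distr M.minus_add M.a_ac)
      then show "\<nu> (x \<oplus>\<^bsub>V\<^esub> y) = \<nu> x \<oplus>\<^bsub>K\<^esub> \<nu> y"
        using xy \<nu> subspace_add[OF W(1)] by (intro \<nu>_eq) auto
    next
      fix c x assume cx: "c \<in> carrier K" "x \<in> carrier V"
      have "c \<odot>\<^bsub>V\<^esub> x \<ominus>\<^bsub>V\<^esub> (c \<otimes>\<^bsub>K\<^esub> \<nu> x) \<odot>\<^bsub>V\<^esub> v = c \<odot>\<^bsub>V\<^esub> (x \<ominus>\<^bsub>V\<^esub> \<nu> x \<odot>\<^bsub>V\<^esub> v)"
        using cx \<nu> v by (simp add: a_minus_def smult_r_distr smult_r_minus smult_assoc1)
      then show "\<nu> (c \<odot>\<^bsub>V\<^esub> x) = c \<otimes>\<^bsub>K\<^esub> \<nu> x"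
        using cx \<nu> subspace_smult[OF W(1)] by (intro \<nu>_eq) auto
    qed (simp add: \<nu>)
    show "\<nu> x = \<zero>\<^bsub>K\<^esub>" if "x \<in> B" for x
      using that W v by (intro \<nu>_eq) (auto simp: a_minus_def lmult_0 minus_zero_vector)
    show "\<nu> v = \<one>\<^bsub>K\<^esub>"
      using v W(1) by (intro \<nu>_eq) (auto simp: M.r_neg a_minus_def subspace_zero)
  qed
qed

text \<open>Separating a single vector is enough: if \<open>\<mu> x0 = 1\<close> and
  \<open>A0\<close> is the kernel of \<open>\<mu>\<close> on \<open>A\<close>, a functional that
  kills \<open>A0 + Z\<close> and is 1 at \<open>x0\<close> agrees with \<open>\<mu>\<close> on
  \<open>A\<close>, because \<open>x - \<mu> x \<odot> x0\<close> lies in \<open>A0\<close>. The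
  second subspace \<open>Z\<close> serves to impose a degree on the extension.\<close>

lemma functional_extension:
  assumes A: "subspace K A V" and Z: "subspace K Z V"
    and closed: "\<And>x. x \<in> A \<Longrightarrow> \<mu> x \<in> carrier K"
    and add: "\<And>x y. x \<in> A \<Longrightarrow> y \<in> A \<Longrightarrow> \<mu> (x \<oplus>\<^bsub>V\<^esub> y) = \<mu> x \<oplus>\<^bsub>K\<^esub> \<mu> y"
    and smult: "\<And>c x. c \<in> carrier K \<Longrightarrow> x \<in> A \<Longrightarrow> \<mu> (c \<odot>\<^bsub>V\<^esub> x) = c \<otimes>\<^bsub>K\<^esub> \<mu> x"
    and 0: "\<And>x. x \<in> A \<Longrightarrow> x \<in> Z \<Longrightarrow> \<mu> x = \<zero>\<^bsub>K\<^esub>"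
  obtains \<nu> where "functional K V \<nu>" "\<And>x. x \<in> A \<Longrightarrow> \<nu> x = \<mu> x" "\<And>x. x \<in> Z \<Longrightarrow> \<nu> x = \<zero>\<^bsub>K\<^esub>"
proof (cases "\<forall>x\<in>A. \<mu> x = \<zero>\<^bsub>K\<^esub>")
  case True
  then show ?thesis
    by (intro that[of "\<lambda>_. \<zero>\<^bsub>K\<^esub>"]) (auto intro: functionalI)
next
  case False
  note [simp] = subspace_subset[OF A, THEN subsetD] subspace_subset[OF Z, THEN subsetD]
  obtain x1 where x1: "x1 \<in> A" "\<mu> x1 \<noteq> \<zero>\<^bsub>K\<^esub>" using False by auto
  then have u: "\<mu> x1 \<in> Units K" using closed field_Units by auto
  define x0 where "x0 = inv\<^bsub>K\<^esub> (\<mu> x1) \<odot>\<^bsub>V\<^esub> x1"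
  have x0: "x0 \<in> A" "\<mu> x0 = \<one>\<^bsub>K\<^esub>"
    using u x1 by (auto simp: x0_def subspace_smult[OF A] smult)
  have neg: "\<mu> (\<ominus>\<^bsub>V\<^esub> x) = \<ominus>\<^bsub>K\<^esub> \<mu> x" if "x \<in> A" for x
    using smult[OF R.a_inv_closed[OF R.one_closed] that] that closed[OF that]
    by (simp add: smult_minus_1 R.l_minus)
  define A0 where "A0 = {x \<in> A. \<mu> x = \<zero>\<^bsub>K\<^esub>}"
  have A0: "subspace K A0 V"
  proof (rule subspaceI)
    have "\<mu> \<zero>\<^bsub>V\<^esub> = \<zero>\<^bsub>K\<^esub>"
      using smult[OF R.zero_closed x0(1)] x0 by (simp add: lmult_0)
    then show "\<zero>\<^bsub>V\<^esub> \<in> A0" by (simp add: A0_def subspace_zero[OF A])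
  qed (auto simp: A0_def add smult subspace_add[OF A] subspace_smult[OF A])
  let ?B = "subspace_sum A0 Z"
  have B: "subspace K ?B V" by (rule sum_is_subspace[OF A0 Z])
  \<comment> \<open>The compatibility of \<open>\<mu>\<close> with \<open>Z\<close> enters here: in
    \<open>x0 = a + z\<close> the vector \<open>z = x0 - a\<close> would lie in \<open>A\<close> as
    well as in \<open>Z\<close>, yet have value 1.\<close>
  have "x0 \<notin> ?B"
  proof
    assume "x0 \<in> ?B"
    then obtain a z where az: "a \<in> A" "\<mu> a = \<zero>\<^bsub>K\<^esub>" "z \<in> Z" "x0 = a \<oplus>\<^bsub>V\<^esub> z"
      by (auto simp: submodule_sum_def A0_def)
    then have z: "z = x0 \<ominus>\<^bsub>V\<^esub> a" by (simp add: a_minus_def M.a_comm[of a] M.a_assoc M.r_neg)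
    then have "z \<in> A" "\<mu> z = \<one>\<^bsub>K\<^esub>"
      using az(1,2) x0 subspace_minus[OF A x0(1) az(1)] unfolding z
      by (auto simp: a_minus_def add neg subspace_neg[OF A])
    then show False using 0[of z] az by simp
  qed
  then obtain \<nu> where \<nu>: "functional K V \<nu>" "\<And>x. x \<in> ?B \<Longrightarrow> \<nu> x = \<zero>\<^bsub>K\<^esub>" "\<nu> x0 = \<one>\<^bsub>K\<^esub>"
    using functional_separating[OF B _ \<open>x0 \<notin> ?B\<close>] x0 by auto
  have A0B: "A0 \<subseteq> ?B" by (rule in_sum_vs[OF A0 Z])
  have ZB: "Z \<subseteq> ?B" using in_sum_vs[OF Z A0] vsum_comm[OF A0 Z] by simp
  show ?thesis
  proof (rule that[OF \<nu>(1)])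
    fix x assume x: "x \<in> A"
    define y where "y = x \<ominus>\<^bsub>V\<^esub> \<mu> x \<odot>\<^bsub>V\<^esub> x0"
    have "y \<in> A" using x x0 closed by (auto simp: y_def subspace_minus[OF A] subspace_smult[OF A])
    moreover have "\<mu> y = \<zero>\<^bsub>K\<^esub>"
      using x x0 closed
      by (simp add: y_def a_minus_def add neg smult subspace_neg[OF A] subspace_smult[OF A] R.r_neg)
    ultimately have "\<nu> y = \<zero>\<^bsub>K\<^esub>" using \<nu>(2) A0B by (auto simp: A0_def)
    then have "\<nu> x \<ominus>\<^bsub>K\<^esub> \<mu> x = \<zero>\<^bsub>K\<^esub>"
      using x x0 closed \<nu> by (simp add: y_def functional_minus functional_smult)
    then show "\<nu> x = \<mu> x" using x closed functional_closed[OF \<nu>(1)] by simp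
  qed (use \<nu> ZB in auto)
qed

subsection \<open>Dimension of subspaces\<close>

text \<open>The replacement theorem completes \<open>A\<close> to a spanning set of
  \<open>span B\<close> with at most \<open>card B - card A\<close> further vectors, hence with
  none.\<close>

lemma span_eq_of_card_le:
  assumes "finite A" "finite B" "B \<subseteq> carrier V" "lin_indpt A" "A \<subseteq> span B" "card B \<le> card A"
  shows "span A = span B"
proof -
  obtain C where C: "finite C" "int (card C) \<le> int (card B) - int (card A)" "span (A \<union> C) = span B"
    using replacement[OF assms(1-5)] by auto
  then have "C = {}" using assms(6) by (simp flip: card_0_eq)
  then show ?thesis using C(3) by simp
qed

text \<open>Spans and independence of subsets of \<open>W\<close> are the same in
  \<open>vs W\<close> and in \<open>V\<close> (\<open>nd\<close>), so \<open>dim\<close> bounds the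
  size of independent subsets of \<open>W\<close> and a maximal one exists.\<close>

lemma subspace_basis:
  assumes fin: fin_dim and W: "subspace K W V"
  obtains D where "finite D" "D \<subseteq> W" "lin_indpt D" "span D = W" "card D = vectorspace.dim K (vs W)"
proof -
  interpret W: vectorspace K "vs W" by (rule subspace_is_vs[OF W])
  have sub: "submodule K W V" using W by simp
  note nd = span_li_not_depend[OF _ sub]
  have WV: "W \<subseteq> carrier V" by (rule subspace_subset[OF W])
  have "\<exists>D. finite D \<and> maximal D (\<lambda>S. S \<subseteq> carrier (vs W) \<and> W.lin_indpt S)"
  proof (rule maximal_exists[where N = dim and B = "{}"])
    show "finite S \<and> card S \<le> dim" if "S \<subseteq> carrier (vs W) \<and> W.lin_indpt S" for S
      using that nd(2)[of S] li_le_dim[OF fin, of S] WV by auto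
    show "{} \<subseteq> carrier (vs W) \<and> W.lin_indpt {}"
      by (auto simp: W.lin_dep_def)
  qed
  then obtain D where D: "finite D" "maximal D (\<lambda>S. S \<subseteq> carrier (vs W) \<and> W.lin_indpt S)" by auto
  then have b: "W.basis D" by (intro W.max_li_is_basis)
  then have DW: "D \<subseteq> W" by (simp add: W.basis_def)
  show ?thesis
    using that[of D] D(1) DW b W.dim_basis[OF D(1) b] nd[OF DW] by (auto simp: W.basis_def)
qed

lemma subspace_dim_psubset:
  assumes fin: fin_dim and A: "subspace K A V" and B: "subspace K B V" and "A \<subset> B"
  shows "vectorspace.dim K (vs A) < vectorspace.dim K (vs B)"
proof (rule ccontr)
  assume n: "\<not> ?thesis"
  obtain D where D: "finite D" "D \<subseteq> A" "lin_indpt D" "span D = A" "card D = vectorspace.dim K (vs A)"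
    using subspace_basis[OF fin A] by blast
  obtain E where E: "finite E" "E \<subseteq> B" "lin_indpt E" "span E = B" "card E = vectorspace.dim K (vs B)"
    using subspace_basis[OF fin B] by blast
  have "span D = span E"
    using D E n \<open>A \<subset> B\<close> subspace_subset[OF B] by (intro span_eq_of_card_le) auto
  then show False using D E \<open>A \<subset> B\<close> by auto
qed

text \<open>Replacement makes \<open>A \<union> C\<close> a spanning set with at most
  \<open>dim\<close> elements, and such a spanning set is a basis.\<close>

lemma basis_extension:
  assumes fin: fin_dim and J: "subspace K J V"
  obtains A C where "finite A" "span A = J" "finite C" "A \<inter> C = {}" "basis (A \<union> C)"
    "card A = vectorspace.dim K (vs J)"
proof -
  obtain A where A: "finite A" "A \<subseteq> J" "lin_indpt A" "span A = J" "card A = vectorspace.dim K (vs J)"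
    using subspace_basis[OF fin J] by blast
  obtain B where B: "finite B" "basis B" using finite_basis_exists[OF fin] by auto
  then have B': "B \<subseteq> carrier V" "span B = carrier V" "card B = dim"
    using dim_basis by (auto simp: basis_def)
  have AB: "A \<subseteq> span B" using A(2) subspace_subset[OF J] B' by auto
  obtain C where C: "finite C" "C \<subseteq> carrier V" "C \<inter> A = {}"
    "int (card C) \<le> int (card B) - int (card A)" "span (A \<union> C) = span B"
    using replacement[OF A(1) B(1) B'(1) A(3) AB] by auto
  have "basis (A \<union> C)"
    using A C B' subspace_subset[OF J] card_Un_le[of A C]
    by (intro dim_gen_is_basis) auto
  then show ?thesis using that[of A C] A C by auto
qed

lemma functional_eq_on_span:
  assumes "functional K V f" "functional K V g" "S \<subseteq> carrier V"
    and "\<And>x. x \<in> S \<Longrightarrow> f x = g x" "x \<in> span S"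
  shows "f x = g x"
proof -
  let ?W = "{x \<in> carrier V. f x = g x}"
  have "subspace K ?W V"
    using assms(1,2)
    by (intro subspaceI) (auto simp: functional_add functional_smult functional_zero)
  then have "span S \<subseteq> ?W"
    using assms by (intro span_is_subset) (auto simp: subspace_def)
  then show ?thesis using assms(5) by auto
qed

text \<open>Let \<open>C\<close> be a basis of a complement of \<open>J\<close>. Recording the
  values of \<open>\<beta> c s\<close> for \<open>c\<close> in \<open>C\<close> gives a linear map
  in \<open>s\<close> with kernel \<open>J\<close>, hence of rank \<open>card C\<close>, so every
  tuple of values on \<open>C\<close> occurs. The lemma is applied with \<open>J = 0\<close> to the
  form of \<open>\<rho>\<close> and with the graded Jacobson radical to the form of
  \<open>\<tau>\<close>.\<close>

lemma bilinear_form_represents: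
  assumes fin: fin_dim and J: "subspace K J V"
    and B1: "\<And>s. s \<in> carrier V \<Longrightarrow> functional K V (\<lambda>a. \<beta> a s)"
    and B2: "\<And>a. a \<in> carrier V \<Longrightarrow> functional K V (\<beta> a)"
    and BJ: "\<And>a s. a \<in> J \<Longrightarrow> s \<in> carrier V \<Longrightarrow> \<beta> a s = \<zero>\<^bsub>K\<^esub>"
    and JB: "\<And>s. s \<in> carrier V \<Longrightarrow> (\<forall>a\<in>carrier V. \<beta> a s = \<zero>\<^bsub>K\<^esub>) \<longleftrightarrow> s \<in> J"
    and \<mu>: "functional K V \<mu>" "\<And>a. a \<in> J \<Longrightarrow> \<mu> a = \<zero>\<^bsub>K\<^esub>"
  obtains s where "s \<in> carrier V" "\<And>a. a \<in> carrier V \<Longrightarrow> \<mu> a = \<beta> a s"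
proof -
  obtain A C where AC: "finite A" "span A = J" "finite C" "A \<inter> C = {}" "basis (A \<union> C)"
    "card A = vectorspace.dim K (vs J)"
    using basis_extension[OF fin J] by blast
  then have cV: "A \<subseteq> carrier V" "C \<subseteq> carrier V" and sp: "span (A \<union> C) = carrier V"
    by (auto simp: basis_def)
  have li: "lin_indpt C" using AC(5) subset_li_is_li[of "A \<union> C" C] by (simp add: basis_def)
  have AJ: "A \<subseteq> J" using AC(2) in_own_span[OF cV(1)] by simp
  have eqI: "f x = g x" if "functional K V f" "functional K V g" "\<And>x. x \<in> A \<Longrightarrow> f x = g x"
    "\<And>x. x \<in> C \<Longrightarrow> f x = g x" "x \<in> carrier V" for f g x
    using functional_eq_on_span[OF that(1,2), of "A \<union> C"] that sp cV by auto
  have coeff: "b \<in> C \<rightarrow> carrier K \<Longrightarrow> b' \<in> C \<rightarrow> carrier K \<Longrightarrow> lincomb b C = lincomb b' C \<Longrightarrow>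
      c \<in> C \<Longrightarrow> b c = b' c" for b b' c
  proof -
    assume b: "b \<in> C \<rightarrow> carrier K" "b' \<in> C \<rightarrow> carrier K" "lincomb b C = lincomb b' C" "c \<in> C"
    then have "lincomb (\<lambda>v. b v \<ominus>\<^bsub>K\<^esub> b' v) C = \<zero>\<^bsub>V\<^esub>"
      using lincomb_diff[OF AC(3) cV(2) b(1,2)] cV by (simp add: M.r_neg a_minus_def)
    then have "(\<lambda>v. b v \<ominus>\<^bsub>K\<^esub> b' v) \<in> C \<rightarrow> {\<zero>\<^bsub>K\<^esub>}"
      using b AC by (intro not_lindepD[OF li]) auto
    then have "b c \<ominus>\<^bsub>K\<^esub> b' c = \<zero>\<^bsub>K\<^esub>" using b(4) by auto
    then show "b c = b' c" using b by (auto simp: Pi_iff)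
  qed
  \<comment> \<open>The values on \<open>C\<close> are packed into one vector of
    \<open>span C\<close>, so that rank-nullity can be applied to an endomorphism of
    \<open>V\<close>.\<close>
  define T where "T s = lincomb (\<lambda>c. \<beta> c s) C" for s
  have \<beta>c: "\<beta> a s \<in> carrier K" if "a \<in> carrier V" "s \<in> carrier V" for a s
    using functional_closed[OF B1] that by simp
  have \<beta>C: "(\<lambda>c. \<beta> c s) \<in> C \<rightarrow> carrier K" if "s \<in> carrier V" for s
    using that cV \<beta>c by auto
  have T: "T \<in> module_hom K V V"
    unfolding module_hom_def mem_Collect_eq
  proof (intro conjI allI impI funcsetI)
    fix s assume "s \<in> carrier V"
    then show "T s \<in> carrier V" using \<beta>C cV by (auto simp: T_def)
  next
    fix s t assume "s \<in> carrier V \<and> t \<in> carrier V"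
    then show "T (s \<oplus>\<^bsub>V\<^esub> t) = T s \<oplus>\<^bsub>V\<^esub> T t"
      using \<beta>C \<beta>c cV AC unfolding T_def
      by (subst lincomb_sum[symmetric]) (auto intro!: lincomb_cong simp: functional_add[OF B2])
  next
    fix r s assume "r \<in> carrier K \<and> s \<in> carrier V"
    then show "T (r \<odot>\<^bsub>V\<^esub> s) = r \<odot>\<^bsub>V\<^esub> T s"
      using \<beta>C \<beta>c cV AC unfolding T_def
      by (subst lincomb_smult[symmetric]) (auto intro!: lincomb_cong simp: functional_smult[OF B2])
  qed
  interpret T: linear_map K V V T
    using T vectorspace_axioms
    by (auto simp: linear_map_def mod_hom_def mod_hom_axioms_def vectorspace_def)
  have ker: "T.kerT = J"
  proof (rule Set.set_eqI)
    fix s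
    show "s \<in> T.kerT \<longleftrightarrow> s \<in> J"
    proof (cases "s \<in> carrier V")
      case s: True
      have "T s = \<zero>\<^bsub>V\<^esub> \<longleftrightarrow> (\<forall>c\<in>C. \<beta> c s = \<zero>\<^bsub>K\<^esub>)"
      proof
        assume "T s = \<zero>\<^bsub>V\<^esub>"
        then have "(\<lambda>c. \<beta> c s) \<in> C \<rightarrow> {\<zero>\<^bsub>K\<^esub>}"
          using \<beta>C[OF s] AC by (intro not_lindepD[OF li]) (auto simp: T_def)
        then show "\<forall>c\<in>C. \<beta> c s = \<zero>\<^bsub>K\<^esub>" by auto
      next
        assume "\<forall>c\<in>C. \<beta> c s = \<zero>\<^bsub>K\<^esub>"
        then have "T s = lincomb (\<lambda>_. \<zero>\<^bsub>K\<^esub>) C"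
          using cV unfolding T_def by (intro lincomb_cong) auto
        then show "T s = \<zero>\<^bsub>V\<^esub>"
          using cV by (auto simp: lincomb_zero)
      qed
      \<comment> \<open>Vanishing on \<open>C\<close> suffices, since \<open>\<beta> a s\<close> is
        zero for \<open>a\<close> in \<open>A \<subseteq> J\<close> and \<open>A \<union> C\<close>
        spans.\<close>
      also have "\<dots> \<longleftrightarrow> (\<forall>a\<in>carrier V. \<beta> a s = \<zero>\<^bsub>K\<^esub>)"
      proof
        assume C0: "\<forall>c\<in>C. \<beta> c s = \<zero>\<^bsub>K\<^esub>"
        have z: "functional K V (\<lambda>_. \<zero>\<^bsub>K\<^esub>)" by (rule functionalI) auto
        show "\<forall>a\<in>carrier V. \<beta> a s = \<zero>\<^bsub>K\<^esub>"
          using eqI[OF B1[OF s] z] C0 BJ AJ s by blast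
      qed (use cV in auto)
      finally show ?thesis using JB[OF s] s by (auto simp: T.ker_def)
    next
      case False
      then show ?thesis using subspace_subset[OF J] by (auto simp: T.ker_def)
    qed
  qed
  have card: "card A + card C = dim"
    using dim_basis[OF _ AC(5)] AC by (simp add: card_Un_disjoint)
  obtain D where D: "finite D" "D \<subseteq> T.imT" "lin_indpt D" "span D = T.imT"
    "card D = vectorspace.dim K (vs T.imT)"
    using subspace_basis[OF fin T.imT_is_subspace] by blast
  have "T.imT \<subseteq> span C"
    using \<beta>C AC by (auto simp: T.im_def T_def span_def)
  moreover have "card D = card C"
    using T.rank_nullity[OF fin] D(5) card AC(6) by (simp add: ker)
  ultimately have "T.imT = span C"
    using span_eq_of_card_le[OF D(1) AC(3) cV(2) D(3)] D(2,4) by auto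
  moreover have \<mu>C: "\<mu> \<in> C \<rightarrow> carrier K" using functional_closed[OF \<mu>(1)] cV by auto
  ultimately have "lincomb \<mu> C \<in> T.imT"
    using AC by (auto simp: span_def)
  then obtain s where s: "s \<in> carrier V" "T s = lincomb \<mu> C" by (auto simp: T.im_def)
  have "\<mu> c = \<beta> c s" if "c \<in> C" for c
    using coeff[OF \<mu>C \<beta>C[OF s(1)] _ that] s(2) by (simp add: T_def)
  then have "\<mu> a = \<beta> a s" if "a \<in> carrier V" for a
    using eqI[OF \<mu>(1) B1[OF s(1)] _ _ that] \<mu>(2) BJ AJ s(1) by (metis subsetD)
  then show ?thesis using that s(1) by blast
qed

end

section \<open>Homogeneous components\<close>

lemma (in abelian_group) additive_subgroup_iff:
  "additive_subgroup H G \<longleftrightarrow> H \<subseteq> carrier G \<and> \<zero> \<in> H \<and>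
     (\<forall>x\<in>H. \<forall>y\<in>H. x \<oplus> y \<in> H) \<and> (\<forall>x\<in>H. \<ominus> x \<in> H)"
  by (auto simp: additive_subgroup_def subgroup_def a_inv_def)

lemma (in abelian_group) abelian_group_restrict:
  assumes "additive_subgroup H G"
  shows "abelian_group (G\<lparr>carrier := H\<rparr>)"
  using assms by (intro abelian_groupI)
    (auto simp: additive_subgroup_iff subset_iff a_assoc intro: a_comm intro!: bexI[of _ "\<ominus> _"] l_neg)

lemma (in abelian_group) finsum_restrict_carrier:
  assumes H: "additive_subgroup H G" and f: "f \<in> S \<rightarrow> H"
  shows "finsum (G\<lparr>carrier := H\<rparr>) f S = finsum G f S"
proof -
  interpret H: abelian_group "G\<lparr>carrier := H\<rparr>" by (rule abelian_group_restrict[OF H])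
  have HG: "H \<subseteq> carrier G" using H by (simp add: additive_subgroup_iff)
  show ?thesis
    using f
  proof (induction S rule: infinite_finite_induct)
    case (insert x S)
    then have "f \<in> S \<rightarrow> carrier G" "f x \<in> carrier G" using HG by auto
    then show ?case using insert by (simp add: Pi_iff)
  next
    case (infinite S)
    then show ?case using H.finsum_infinite finsum_infinite by simp
  next
    case empty
    then show ?case using H.finsum_empty by simp
  qed
qed

lemma (in abelian_group) finsum_mem:
  assumes H: "additive_subgroup H G" and f: "f \<in> S \<rightarrow> H"
  shows "finsum G f S \<in> H"
  using f
proof (induction S rule: infinite_finite_induct)
  case (insert x S)
  then have "f \<in> S \<rightarrow> carrier G" "f x \<in> carrier G" using H by (auto simp: additive_subgroup_iff)
  then show ?case using insert H by (simp add: Pi_iff additive_subgroup_iff)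
qed (use H in \<open>auto simp: additive_subgroup_iff finsum_infinite\<close>)

text \<open>The families in \<open>internal_direct_sum\<close> are extensional, so a component is
  meaningful only at indices in \<open>I\<close>.\<close>

definition component ::
    "('m, 'b) ring_scheme \<Rightarrow> 'i set \<Rightarrow> ('i \<Rightarrow> 'm set) \<Rightarrow> 'm \<Rightarrow> 'i \<Rightarrow> 'm" where
  "component M I A x = (THE f. f \<in> (\<Pi>\<^sub>E i\<in>I. A i) \<and> finite {i\<in>I. f i \<noteq> \<zero>\<^bsub>M\<^esub>} \<and>
     x = (\<Oplus>\<^bsub>M\<^esub> i\<in>{i\<in>I. f i \<noteq> \<zero>\<^bsub>M\<^esub>}. f i))"

text \<open>Purely additive, so that rings and modules share one theory of components.\<close>

locale direct_sum_decomposition = abelian_group M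
  for M :: "('m, 'b) ring_scheme" (structure) and I :: "'i set" and A :: "'i \<Rightarrow> 'm set" +
  assumes decomposition: "internal_direct_sum M I A"
begin

abbreviation comp :: "'m \<Rightarrow> 'i \<Rightarrow> 'm" where "comp \<equiv> component M I A"

lemma summand_subgroup: "i \<in> I \<Longrightarrow> additive_subgroup (A i) M"
  using decomposition by (simp add: internal_direct_sum_def)

lemma
  assumes "i \<in> I"
  shows summand_closed: "x \<in> A i \<Longrightarrow> x \<in> carrier M"
    and summand_zero: "\<zero> \<in> A i"
    and summand_add: "x \<in> A i \<Longrightarrow> y \<in> A i \<Longrightarrow> x \<oplus> y \<in> A i"
  using summand_subgroup[OF assms] by (auto simp: additive_subgroup_iff)

lemma component_spec:
  assumes "x \<in> carrier M"
  shows "comp x \<in> (\<Pi>\<^sub>E i\<in>I. A i) \<and> finite {i\<in>I. comp x i \<noteq> \<zero>} \<and>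
    x = (\<Oplus> i\<in>{i\<in>I. comp x i \<noteq> \<zero>}. comp x i)"
proof -
  have "\<exists>!f. f \<in> (\<Pi>\<^sub>E i\<in>I. A i) \<and> finite {i\<in>I. f i \<noteq> \<zero>} \<and> x = (\<Oplus> i\<in>{i\<in>I. f i \<noteq> \<zero>}. f i)"
    using decomposition assms by (simp add: internal_direct_sum_def)
  from theI'[OF this] show ?thesis unfolding component_def .
qed

lemma component_mem: "x \<in> carrier M \<Longrightarrow> i \<in> I \<Longrightarrow> comp x i \<in> A i"
  using component_spec by blast

lemma component_closed: "x \<in> carrier M \<Longrightarrow> i \<in> I \<Longrightarrow> comp x i \<in> carrier M"
  using component_mem summand_closed by blast

lemma finite_support: "x \<in> carrier M \<Longrightarrow> finite {i\<in>I. comp x i \<noteq> \<zero>}"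
  using component_spec by blast

lemma sum_support:
  assumes f: "f \<in> (\<Pi> i\<in>I. A i)" and S: "finite S" "S \<subseteq> I" "\<And>i. i \<in> I - S \<Longrightarrow> f i = \<zero>"
  shows "(\<Oplus>i\<in>S. f i) = (\<Oplus>i\<in>{i\<in>I. f i \<noteq> \<zero>}. f i)"
  using f S summand_closed by (intro add.finprod_mono_neutral_cong_right) (auto simp: Pi_iff)

lemma sum_components:
  assumes "x \<in> carrier M" "finite S" "S \<subseteq> I" "\<And>i. i \<in> I - S \<Longrightarrow> comp x i = \<zero>"
  shows "(\<Oplus>i\<in>S. comp x i) = x"
  using sum_support[of "comp x" S] component_spec[OF assms(1)] assms component_mem by auto

lemma component_unique:
  assumes f: "f \<in> (\<Pi> i\<in>I. A i)" and S: "finite S" "S \<subseteq> I" "\<And>i. i \<in> I - S \<Longrightarrow> f i = \<zero>"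
    and i: "i \<in> I"
  shows "comp (\<Oplus>i\<in>S. f i) i = f i"
proof -
  let ?x = "\<Oplus>i\<in>S. f i" and ?f = "restrict f I"
  have eq: "{i\<in>I. ?f i \<noteq> \<zero>} = {i\<in>I. f i \<noteq> \<zero>}" by auto
  have "?x \<in> carrier M" using f S summand_closed by (intro finsum_closed) (auto simp: Pi_iff)
  then have ex: "\<exists>!f. f \<in> (\<Pi>\<^sub>E i\<in>I. A i) \<and> finite {i\<in>I. f i \<noteq> \<zero>} \<and> ?x = (\<Oplus> i\<in>{i\<in>I. f i \<noteq> \<zero>}. f i)"
    using decomposition by (simp add: internal_direct_sum_def)
  have "comp ?x = ?f"
    unfolding component_def
  proof (rule the1_equality[OF ex], intro conjI)
    show "?f \<in> (\<Pi>\<^sub>E i\<in>I. A i)" using f by auto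
    show "finite {i\<in>I. ?f i \<noteq> \<zero>}"
      by (rule finite_subset[OF _ S(1)]) (use S(3) in auto)
    have "(\<Oplus>i\<in>{i\<in>I. ?f i \<noteq> \<zero>}. ?f i) = (\<Oplus>i\<in>{i\<in>I. f i \<noteq> \<zero>}. f i)"
      unfolding eq using f summand_closed by (intro finsum_cong') auto
    then show "?x = (\<Oplus>i\<in>{i\<in>I. ?f i \<noteq> \<zero>}. ?f i)"
      using sum_support[OF f S] by simp
  qed
  then show ?thesis using i by simp
qed

lemma component_homogeneous:
  assumes "x \<in> A i" "i \<in> I" "j \<in> I"
  shows "comp x j = (if j = i then x else \<zero>)"
proof -
  let ?f = "\<lambda>j. if j = i then x else \<zero>"
  have "comp (\<Oplus>j\<in>{i}. ?f j) j = ?f j"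
    using assms by (intro component_unique) (auto simp: summand_zero)
  moreover have "(\<Oplus>j\<in>{i}. ?f j) = x"
    using assms summand_closed by simp
  ultimately show ?thesis by simp
qed

lemma component_add:
  assumes xy: "x \<in> carrier M" "y \<in> carrier M" and i: "i \<in> I"
  shows "comp (x \<oplus> y) i = comp x i \<oplus> comp y i"
proof -
  let ?S = "{i\<in>I. comp x i \<noteq> \<zero>} \<union> {i\<in>I. comp y i \<noteq> \<zero>}"
  have "(\<Oplus>i\<in>?S. comp x i \<oplus> comp y i) = (\<Oplus>i\<in>?S. comp x i) \<oplus> (\<Oplus>i\<in>?S. comp y i)"
    using xy component_closed by (intro finsum_addf) auto
  also have "\<dots> = x \<oplus> y"
    using xy finite_support by (subst (1 2) sum_components) auto
  finally have s: "(\<Oplus>i\<in>?S. comp x i \<oplus> comp y i) = x \<oplus> y" .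
  have "comp (\<Oplus>i\<in>?S. comp x i \<oplus> comp y i) i = comp x i \<oplus> comp y i"
    using xy i finite_support component_mem summand_add by (intro component_unique) auto
  then show ?thesis by (simp add: s)
qed

lemma component_zero: "i \<in> I \<Longrightarrow> comp \<zero> i = \<zero>"
  using component_homogeneous[of \<zero> i i] summand_zero by simp

lemma component_neg:
  assumes "x \<in> carrier M" "i \<in> I"
  shows "comp (\<ominus> x) i = \<ominus> comp x i"
  using component_add[of "\<ominus> x" x i] assms
  by (intro minus_equality[symmetric]) (auto simp: component_zero l_neg component_closed)

lemma mem_by_components:
  assumes "additive_subgroup H M" "x \<in> carrier M" "\<And>i. i \<in> I \<Longrightarrow> comp x i \<in> H"
  shows "x \<in> H"
proof -
  have "(\<Oplus>i\<in>{i\<in>I. comp x i \<noteq> \<zero>}. comp x i) \<in> H"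
    using assms by (intro finsum_mem) auto
  then show ?thesis using component_spec[OF assms(2)] by simp
qed

lemma homogeneous_induct [consumes 1, case_names zero add homogeneous]:
  assumes x: "x \<in> carrier M" and "P \<zero>"
    and add: "\<And>x y. x \<in> carrier M \<Longrightarrow> y \<in> carrier M \<Longrightarrow> P x \<Longrightarrow> P y \<Longrightarrow> P (x \<oplus> y)"
    and hom: "\<And>i x. i \<in> I \<Longrightarrow> x \<in> A i \<Longrightarrow> P x"
  shows "P x"
proof -
  have "P (\<Oplus>i\<in>S. comp x i)" if "finite S" "S \<subseteq> I" for S
    using that
  proof (induction S)
    case (insert i S)
    then have "comp x \<in> S \<rightarrow> carrier M" "comp x i \<in> carrier M"
      using x component_closed by auto
    then show ?case
      using insert x hom[OF _ component_mem[OF x]] by (auto intro: add)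
  qed (use \<open>P \<zero>\<close> in simp)
  from this[OF finite_support[OF x]] show ?thesis
    using component_spec[OF x] by auto
qed

text \<open>A decomposition inside \<open>H\<close> is also one in \<open>M\<close>, so by
  uniqueness its terms are the components in \<open>M\<close>. Gradedness of an ideal thereby
  becomes closure under \<open>comp\<close>, which is far easier to check.\<close>

lemma internal_direct_sum_restrict:
  assumes H: "additive_subgroup H M"
  shows "internal_direct_sum (M\<lparr>carrier := H\<rparr>) I (\<lambda>i. H \<inter> A i) \<longleftrightarrow>
    (\<forall>x\<in>H. \<forall>i\<in>I. comp x i \<in> H)"
proof
  have HM: "H \<subseteq> carrier M" using H by (simp add: additive_subgroup_iff)
  {
    assume d: "internal_direct_sum (M\<lparr>carrier := H\<rparr>) I (\<lambda>i. H \<inter> A i)"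
    show "\<forall>x\<in>H. \<forall>i\<in>I. comp x i \<in> H"
    proof (intro ballI)
      fix x i assume x: "x \<in> H" and i: "i \<in> I"
      let ?P = "\<lambda>f. f \<in> (\<Pi>\<^sub>E i\<in>I. H \<inter> A i) \<and> finite {i \<in> I. f i \<noteq> \<zero>\<^bsub>M\<lparr>carrier := H\<rparr>\<^esub>} \<and>
          x = (\<Oplus>\<^bsub>M\<lparr>carrier := H\<rparr>\<^esub>i\<in>{i \<in> I. f i \<noteq> \<zero>\<^bsub>M\<lparr>carrier := H\<rparr>\<^esub>}. f i)"
      have "\<exists>!f. ?P f" using d x unfolding internal_direct_sum_def by simp
      then obtain f where f: "f \<in> (\<Pi>\<^sub>E i\<in>I. H \<inter> A i)" "finite {i\<in>I. f i \<noteq> \<zero>}"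
          "x = (\<Oplus>\<^bsub>M\<lparr>carrier := H\<rparr>\<^esub>i\<in>{i\<in>I. f i \<noteq> \<zero>}. f i)"
        by auto
      have fH: "f \<in> {i\<in>I. f i \<noteq> \<zero>} \<rightarrow> H" using f(1) by auto
      have "comp x i = f i"
        unfolding f(3) finsum_restrict_carrier[OF H fH]
        by (rule component_unique) (use f i in auto)
      then show "comp x i \<in> H" using f(1) i by auto
    qed
  }
  {
    assume c: "\<forall>x\<in>H. \<forall>i\<in>I. comp x i \<in> H"
    show "internal_direct_sum (M\<lparr>carrier := H\<rparr>) I (\<lambda>i. H \<inter> A i)"
      unfolding internal_direct_sum_def
    proof (intro conjI ballI)
      fix i assume i: "i \<in> I"
      have "subgroup (H \<inter> A i) (add_monoid M)" "subgroup H (add_monoid M)"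
        using H summand_subgroup[OF i] add.subgroups_Inter_pair
        by (auto simp: additive_subgroup_def)
      then have "subgroup (H \<inter> A i) (add_monoid M\<lparr>carrier := H\<rparr>)"
        by (intro add.subgroup_incl) auto
      then show "additive_subgroup (H \<inter> A i) (M\<lparr>carrier := H\<rparr>)"
        by (simp add: additive_subgroup_def)
    next
      fix x assume "x \<in> carrier (M\<lparr>carrier := H\<rparr>)"
      then have x: "x \<in> H" "x \<in> carrier M" using HM by auto
      show "\<exists>!f. f \<in> (\<Pi>\<^sub>E i\<in>I. H \<inter> A i) \<and> finite {i \<in> I. f i \<noteq> \<zero>\<^bsub>M\<lparr>carrier := H\<rparr>\<^esub>} \<and>
          x = (\<Oplus>\<^bsub>M\<lparr>carrier := H\<rparr>\<^esub>i\<in>{i \<in> I. f i \<noteq> \<zero>\<^bsub>M\<lparr>carrier := H\<rparr>\<^esub>}. f i)"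
      proof (rule ex1I[of _ "comp x"])
        have "(\<Oplus>\<^bsub>M\<lparr>carrier := H\<rparr>\<^esub>i\<in>{i \<in> I. comp x i \<noteq> \<zero>}. comp x i) = x"
          using component_spec[OF x(2)] c x by (subst finsum_restrict_carrier[OF H]) auto
        then show "comp x \<in> (\<Pi>\<^sub>E i\<in>I. H \<inter> A i) \<and> finite {i \<in> I. comp x i \<noteq> \<zero>\<^bsub>M\<lparr>carrier := H\<rparr>\<^esub>} \<and>
          x = (\<Oplus>\<^bsub>M\<lparr>carrier := H\<rparr>\<^esub>i\<in>{i \<in> I. comp x i \<noteq> \<zero>\<^bsub>M\<lparr>carrier := H\<rparr>\<^esub>}. comp x i)"
          using component_spec[OF x(2)] c x by auto
      next
        fix f assume "f \<in> (\<Pi>\<^sub>E i\<in>I. H \<inter> A i) \<and> finite {i \<in> I. f i \<noteq> \<zero>\<^bsub>M\<lparr>carrier := H\<rparr>\<^esub>} \<and>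
          x = (\<Oplus>\<^bsub>M\<lparr>carrier := H\<rparr>\<^esub>i\<in>{i \<in> I. f i \<noteq> \<zero>\<^bsub>M\<lparr>carrier := H\<rparr>\<^esub>}. f i)"
        then have f: "f \<in> (\<Pi>\<^sub>E i\<in>I. H \<inter> A i)" "finite {i\<in>I. f i \<noteq> \<zero>}"
          "x = (\<Oplus>\<^bsub>M\<lparr>carrier := H\<rparr>\<^esub>i\<in>{i\<in>I. f i \<noteq> \<zero>}. f i)"
          by auto
        have fH: "f \<in> {i\<in>I. f i \<noteq> \<zero>} \<rightarrow> H" using f(1) by auto
        have "comp x i = f i" if "i \<in> I" for i
          unfolding f(3) finsum_restrict_carrier[OF H fH]
          by (rule component_unique) (use f that in auto)
        then show "f = comp x"
          using f(1) component_spec[OF x(2)] by (intro PiE_ext[of f I]) (auto intro: PiE_ext)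
      qed
    qed
  }
qed

end

text \<open>By additivity only homogeneous \<open>x\<close> need checking. The map
  \<open>\<pi>\<close> records how degrees move, and its injectivity keeps other components out of
  degree \<open>\<pi> i\<close>. Multiplication by a homogeneous element on either side, scalar
  multiplication and graded morphisms are all instances.\<close>

lemma component_hom:
  assumes M: "direct_sum_decomposition M I A" and N: "direct_sum_decomposition N J B"
    and T: "\<And>x. x \<in> carrier M \<Longrightarrow> T x \<in> carrier N"
    and T_add: "\<And>x y. x \<in> carrier M \<Longrightarrow> y \<in> carrier M \<Longrightarrow> T (x \<oplus>\<^bsub>M\<^esub> y) = T x \<oplus>\<^bsub>N\<^esub> T y"
    and deg: "\<And>i. i \<in> I \<Longrightarrow> \<pi> i \<in> J" "\<And>i x. i \<in> I \<Longrightarrow> x \<in> A i \<Longrightarrow> T x \<in> B (\<pi> i)"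
    and inj: "inj_on \<pi> I" and x: "x \<in> carrier M" and i: "i \<in> I"
  shows "component N J B (T x) (\<pi> i) = T (component M I A x i)"
proof -
  interpret M: direct_sum_decomposition M I A by fact
  interpret N: direct_sum_decomposition N J B by fact
  have T0: "T \<zero>\<^bsub>M\<^esub> = \<zero>\<^bsub>N\<^esub>"
    using T_add[of "\<zero>\<^bsub>M\<^esub>" "\<zero>\<^bsub>M\<^esub>"] T[of "\<zero>\<^bsub>M\<^esub>"] by simp
  show ?thesis
    using x
  proof (induction x rule: M.homogeneous_induct)
    case zero
    then show ?case using i deg by (simp add: T0 M.component_zero N.component_zero)
  next
    case (add x y)
    then show ?case
      using i deg T by (simp add: T_add M.component_add N.component_add M.component_closed)
  next
    case (homogeneous j x)
    then show ?case
      using i deg inj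
      by (auto simp: M.component_homogeneous[OF homogeneous(2,1)]
          N.component_homogeneous[OF deg(2)[OF homogeneous] deg(1)[OF homogeneous(1)]] T0 inj_on_eq_iff)
  qed
qed

section \<open>Graded ideals\<close>

sublocale graded_ring \<subseteq> grd: direct_sum_decomposition R "carrier G" \<R>
  by unfold_locales (rule direct_sum)

context graded_ring
begin

lemma comp_mult_left:
  assumes "h \<in> carrier G" "a \<in> \<R> h" "x \<in> carrier R" "g \<in> carrier G"
  shows "grd.comp (a \<otimes>\<^bsub>R\<^esub> x) (h \<otimes>\<^bsub>G\<^esub> g) = a \<otimes>\<^bsub>R\<^esub> grd.comp x g"
  using assms grd.summand_closed[OF assms(1,2)]
  by (intro component_hom[OF grd.direct_sum_decomposition_axioms grd.direct_sum_decomposition_axioms])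
     (auto simp: R.r_distr mult_comp inj_on_def)

lemma comp_mult_right:
  assumes "h \<in> carrier G" "a \<in> \<R> h" "x \<in> carrier R" "g \<in> carrier G"
  shows "grd.comp (x \<otimes>\<^bsub>R\<^esub> a) (g \<otimes>\<^bsub>G\<^esub> h) = grd.comp x g \<otimes>\<^bsub>R\<^esub> a"
  using assms grd.summand_closed[OF assms(1,2)]
  by (intro component_hom[OF grd.direct_sum_decomposition_axioms grd.direct_sum_decomposition_axioms,
        where T = "\<lambda>x. x \<otimes>\<^bsub>R\<^esub> a" and \<pi> = "\<lambda>g. g \<otimes>\<^bsub>G\<^esub> h"])
     (auto simp: R.l_distr mult_comp inj_on_def)

text \<open>The component \<open>u\<close> of the identity in degree \<open>\<one>\<close> is a
  right identity: for \<open>x\<close> of degree \<open>g\<close>, the components of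
  \<open>x = x \<otimes> \<one>\<close> in degree \<open>g\<close> give
  \<open>x = x \<otimes> u\<close>. Taking \<open>x = \<one>\<close> yields
  \<open>u = \<one>\<close>.\<close>

lemma one_homogeneous: "\<one>\<^bsub>R\<^esub> \<in> \<R> \<one>\<^bsub>G\<^esub>"
proof -
  let ?u = "grd.comp \<one>\<^bsub>R\<^esub> \<one>\<^bsub>G\<^esub>"
  have u: "?u \<in> \<R> \<one>\<^bsub>G\<^esub>" "?u \<in> carrier R"
    by (auto simp: grd.component_mem grd.component_closed)
  have "x \<otimes>\<^bsub>R\<^esub> ?u = x" if "x \<in> carrier R" for x
    using that
  proof (induction x rule: grd.homogeneous_induct)
    case (homogeneous g x)
    then show ?case
      using comp_mult_left[OF homogeneous, of "\<one>\<^bsub>R\<^esub>" "\<one>\<^bsub>G\<^esub>"] grd.summand_closed[OF homogeneous]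
        grd.component_homogeneous[OF homogeneous(2,1,1)] by simp
  qed (use u in \<open>auto simp: R.l_distr\<close>)
  from this[of "\<one>\<^bsub>R\<^esub>"] show ?thesis using u by simp
qed

abbreviation left_ideal :: "'r set \<Rightarrow> bool" where
  "left_ideal \<equiv> graded_left_ideal G R \<R>"

lemma left_ideal_iff:
  "left_ideal I \<longleftrightarrow> additive_subgroup I R \<and> (\<forall>a\<in>carrier R. \<forall>x\<in>I. a \<otimes>\<^bsub>R\<^esub> x \<in> I) \<and>
     (\<forall>x\<in>I. \<forall>g\<in>carrier G. grd.comp x g \<in> I)"
  using grd.internal_direct_sum_restrict by (auto simp: graded_left_ideal_def)

lemma left_idealI:
  assumes "I \<subseteq> carrier R" "\<zero>\<^bsub>R\<^esub> \<in> I"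
    and add: "\<And>x y. x \<in> I \<Longrightarrow> y \<in> I \<Longrightarrow> x \<oplus>\<^bsub>R\<^esub> y \<in> I"
    and mult: "\<And>a x. a \<in> carrier R \<Longrightarrow> x \<in> I \<Longrightarrow> a \<otimes>\<^bsub>R\<^esub> x \<in> I"
    and comp: "\<And>x g. x \<in> I \<Longrightarrow> g \<in> carrier G \<Longrightarrow> grd.comp x g \<in> I"
  shows "left_ideal I"
proof -
  have "\<ominus>\<^bsub>R\<^esub> x \<in> I" if "x \<in> I" for x
    using mult[OF R.a_inv_closed[OF R.one_closed] that] that assms(1) by (auto simp: R.l_minus)
  then show ?thesis
    using assms by (auto simp: left_ideal_iff R.additive_subgroup_iff)
qed

lemma
  assumes "left_ideal I"
  shows left_ideal_subset: "I \<subseteq> carrier R"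
    and left_ideal_zero: "\<zero>\<^bsub>R\<^esub> \<in> I"
    and left_ideal_add: "x \<in> I \<Longrightarrow> y \<in> I \<Longrightarrow> x \<oplus>\<^bsub>R\<^esub> y \<in> I"
    and left_ideal_neg: "x \<in> I \<Longrightarrow> \<ominus>\<^bsub>R\<^esub> x \<in> I"
    and left_ideal_minus: "x \<in> I \<Longrightarrow> y \<in> I \<Longrightarrow> x \<ominus>\<^bsub>R\<^esub> y \<in> I"
    and left_ideal_mult: "a \<in> carrier R \<Longrightarrow> x \<in> I \<Longrightarrow> a \<otimes>\<^bsub>R\<^esub> x \<in> I"
    and left_ideal_comp: "x \<in> I \<Longrightarrow> g \<in> carrier G \<Longrightarrow> grd.comp x g \<in> I"
    and left_ideal_subgroup: "additive_subgroup I R"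
  using assms by (auto simp: left_ideal_iff R.additive_subgroup_iff a_minus_def)

lemma left_ideal_carrier: "left_ideal (carrier R)"
  by (rule left_idealI) (auto simp: grd.component_closed)

text \<open>Intersecting with \<open>carrier R\<close> covers the empty family and matches the form
  of \<open>gr_jacobson\<close>.\<close>

lemma left_ideal_Inter:
  assumes "\<And>I. I \<in> \<F> \<Longrightarrow> left_ideal I"
  shows "left_ideal (carrier R \<inter> \<Inter>\<F>)"
  using assms
  by (intro left_idealI)
     (auto simp: grd.component_closed left_ideal_zero left_ideal_add left_ideal_mult left_ideal_comp)

lemma left_ideal_sum:
  assumes I: "left_ideal I" and J: "left_ideal J"
  shows "left_ideal (I <+>\<^bsub>R\<^esub> J)"
proof -
  have IJ: "I <+>\<^bsub>R\<^esub> J = {x \<oplus>\<^bsub>R\<^esub> y | x y. x \<in> I \<and> y \<in> J}"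
    by (auto simp: set_add_def set_mult_def)
  note sub = left_ideal_subset[OF I, THEN subsetD] left_ideal_subset[OF J, THEN subsetD]
  show ?thesis
    unfolding IJ
  proof (rule left_idealI)
    fix u v assume "u \<in> {x \<oplus>\<^bsub>R\<^esub> y | x y. x \<in> I \<and> y \<in> J}" "v \<in> {x \<oplus>\<^bsub>R\<^esub> y | x y. x \<in> I \<and> y \<in> J}"
    then obtain x y x' y' where xy: "x \<in> I" "y \<in> J" "x' \<in> I" "y' \<in> J" "u = x \<oplus>\<^bsub>R\<^esub> y" "v = x' \<oplus>\<^bsub>R\<^esub> y'"
      by auto
    then have "u \<oplus>\<^bsub>R\<^esub> v = (x \<oplus>\<^bsub>R\<^esub> x') \<oplus>\<^bsub>R\<^esub> (y \<oplus>\<^bsub>R\<^esub> y')" using sub by (simp add: R.a_ac)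
    then show "u \<oplus>\<^bsub>R\<^esub> v \<in> {x \<oplus>\<^bsub>R\<^esub> y | x y. x \<in> I \<and> y \<in> J}"
      using xy I J left_ideal_add by blast
  next
    fix a u assume a: "a \<in> carrier R" and "u \<in> {x \<oplus>\<^bsub>R\<^esub> y | x y. x \<in> I \<and> y \<in> J}"
    then obtain x y where xy: "x \<in> I" "y \<in> J" "u = x \<oplus>\<^bsub>R\<^esub> y" by auto
    then have "a \<otimes>\<^bsub>R\<^esub> u = a \<otimes>\<^bsub>R\<^esub> x \<oplus>\<^bsub>R\<^esub> a \<otimes>\<^bsub>R\<^esub> y" using a sub by (simp add: R.r_distr)
    then show "a \<otimes>\<^bsub>R\<^esub> u \<in> {x \<oplus>\<^bsub>R\<^esub> y | x y. x \<in> I \<and> y \<in> J}"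
      using xy I J a left_ideal_mult by blast
  next
    fix u g assume g: "g \<in> carrier G" and "u \<in> {x \<oplus>\<^bsub>R\<^esub> y | x y. x \<in> I \<and> y \<in> J}"
    then obtain x y where xy: "x \<in> I" "y \<in> J" "u = x \<oplus>\<^bsub>R\<^esub> y" by auto
    then have "grd.comp u g = grd.comp x g \<oplus>\<^bsub>R\<^esub> grd.comp y g"
      using g sub by (simp add: grd.component_add)
    then show "grd.comp u g \<in> {x \<oplus>\<^bsub>R\<^esub> y | x y. x \<in> I \<and> y \<in> J}"
      using xy I J g left_ideal_comp by blast
  next
    show "\<zero>\<^bsub>R\<^esub> \<in> {x \<oplus>\<^bsub>R\<^esub> y | x y. x \<in> I \<and> y \<in> J}"
      using left_ideal_zero[OF I] left_ideal_zero[OF J] by force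
  qed (use sub in auto)
qed

text \<open>Gradedness comes from the homogeneity of \<open>x\<close>: right multiplication by
  \<open>x\<close> carries the component of \<open>a\<close> in degree \<open>h\<close> to the
  component of \<open>a \<otimes> x\<close> in degree \<open>h \<otimes> g\<close>.\<close>

lemma left_ideal_colon:
  assumes I: "left_ideal I" and g: "g \<in> carrier G" and x: "x \<in> \<R> g"
  shows "left_ideal {a \<in> carrier R. a \<otimes>\<^bsub>R\<^esub> x \<in> I}"
proof (rule left_idealI)
  have [simp]: "x \<in> carrier R" using grd.summand_closed[OF g x] .
  show "\<zero>\<^bsub>R\<^esub> \<in> {a \<in> carrier R. a \<otimes>\<^bsub>R\<^esub> x \<in> I}" using left_ideal_zero[OF I] by simp
  show "a \<oplus>\<^bsub>R\<^esub> b \<in> {a \<in> carrier R. a \<otimes>\<^bsub>R\<^esub> x \<in> I}"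
    if "a \<in> {a \<in> carrier R. a \<otimes>\<^bsub>R\<^esub> x \<in> I}" "b \<in> {a \<in> carrier R. a \<otimes>\<^bsub>R\<^esub> x \<in> I}" for a b
    using that left_ideal_add[OF I] by (auto simp: R.l_distr)
  show "b \<otimes>\<^bsub>R\<^esub> a \<in> {a \<in> carrier R. a \<otimes>\<^bsub>R\<^esub> x \<in> I}"
    if "b \<in> carrier R" "a \<in> {a \<in> carrier R. a \<otimes>\<^bsub>R\<^esub> x \<in> I}" for a b
    using that left_ideal_mult[OF I] by (auto simp: R.m_assoc)
  show "grd.comp a h \<in> {a \<in> carrier R. a \<otimes>\<^bsub>R\<^esub> x \<in> I}"
    if "a \<in> {a \<in> carrier R. a \<otimes>\<^bsub>R\<^esub> x \<in> I}" "h \<in> carrier G" for a h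
    using that left_ideal_comp[OF I, of "a \<otimes>\<^bsub>R\<^esub> x" "h \<otimes>\<^bsub>G\<^esub> g"] comp_mult_right[OF g x] g
    by (auto simp: grd.component_closed)
qed auto

lemma left_ideal_zero_set: "left_ideal {\<zero>\<^bsub>R\<^esub>}"
  by (rule left_idealI) (auto simp: grd.component_zero)

lemma left_ideal_mult_right:
  assumes I: "left_ideal I" and g: "g \<in> carrier G" and x: "x \<in> \<R> g"
  shows "left_ideal ((\<lambda>a. a \<otimes>\<^bsub>R\<^esub> x) ` I)"
proof (rule left_idealI)
  have x': "x \<in> carrier R" using grd.summand_closed[OF g x] .
  let ?I = "(\<lambda>a. a \<otimes>\<^bsub>R\<^esub> x) ` I"
  note Isub = left_ideal_subset[OF I, THEN subsetD]
  show "?I \<subseteq> carrier R" using Isub x' by auto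
  show "\<zero>\<^bsub>R\<^esub> \<in> ?I" using x' left_ideal_zero[OF I] by (intro image_eqI[of _ _ "\<zero>\<^bsub>R\<^esub>"]) auto
  show "u \<oplus>\<^bsub>R\<^esub> v \<in> ?I" if "u \<in> ?I" "v \<in> ?I" for u v
    using that R.l_distr[OF _ _ x', symmetric] Isub left_ideal_add[OF I] by auto
  show "c \<otimes>\<^bsub>R\<^esub> u \<in> ?I" if "c \<in> carrier R" "u \<in> ?I" for c u
    using that R.m_assoc[OF _ _ x', symmetric] Isub left_ideal_mult[OF I] by auto
  show "grd.comp u h \<in> ?I" if "u \<in> ?I" "h \<in> carrier G" for u h
  proof -
    obtain a where a: "a \<in> I" "u = a \<otimes>\<^bsub>R\<^esub> x" using \<open>u \<in> ?I\<close> by auto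
    \<comment> \<open>The component of \<open>a \<otimes> x\<close> in degree \<open>h\<close> stems
      from the component of \<open>a\<close> in degree \<open>h \<otimes> inv g\<close>.\<close>
    have "grd.comp u h = grd.comp a (h \<otimes>\<^bsub>G\<^esub> inv\<^bsub>G\<^esub> g) \<otimes>\<^bsub>R\<^esub> x"
      using comp_mult_right[OF g x Isub[OF a(1)], of "h \<otimes>\<^bsub>G\<^esub> inv\<^bsub>G\<^esub> g"] a g \<open>h \<in> carrier G\<close>
      by (simp add: G.m_assoc)
    then show ?thesis using a g \<open>h \<in> carrier G\<close> left_ideal_comp[OF I] by auto
  qed
qed

section \<open>Maximal and minimal graded left ideals, and the graded Jacobson radical\<close>

abbreviation J :: "'r set" where "J \<equiv> gr_jacobson G R \<R>"

abbreviation maximal_left :: "'r set \<Rightarrow> bool" where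
  "maximal_left \<equiv> maximal_graded_left_ideal G R \<R>"

abbreviation minimal_left :: "'r set \<Rightarrow> bool" where
  "minimal_left \<equiv> minimal_graded_left_ideal G R \<R>"

lemma maximal_left_ideal: "maximal_left m \<Longrightarrow> left_ideal m"
  and maximal_left_proper: "maximal_left m \<Longrightarrow> m \<noteq> carrier R"
  and maximal_left_eq:
    "maximal_left m \<Longrightarrow> left_ideal I \<Longrightarrow> m \<subseteq> I \<Longrightarrow> I \<noteq> m \<Longrightarrow> I = carrier R"
  by (auto simp: maximal_graded_left_ideal_def VectorSpace.maximal_def)

lemma minimal_left_ideal: "minimal_left I \<Longrightarrow> left_ideal I"
  and minimal_left_nonzero: "minimal_left I \<Longrightarrow> I \<noteq> {\<zero>\<^bsub>R\<^esub>}"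
  and minimal_left_eq:
    "minimal_left I \<Longrightarrow> left_ideal L \<Longrightarrow> L \<subseteq> I \<Longrightarrow> L \<noteq> {\<zero>\<^bsub>R\<^esub>} \<Longrightarrow> L = I"
  by (auto simp: minimal_graded_left_ideal_def VectorSpace.minimal_def)

lemma one_not_in_maximal:
  assumes "maximal_left m"
  shows "\<one>\<^bsub>R\<^esub> \<notin> m"
proof
  assume "\<one>\<^bsub>R\<^esub> \<in> m"
  then have "a \<in> m" if "a \<in> carrier R" for a
    using left_ideal_mult[OF maximal_left_ideal[OF assms] that] that by force
  then show False
    using maximal_left_proper[OF assms] left_ideal_subset[OF maximal_left_ideal[OF assms]] by auto
qed

lemma left_ideal_jacobson: "left_ideal J"
  unfolding gr_jacobson_def by (rule left_ideal_Inter) (simp add: maximal_left_ideal)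

lemma jacobson_closed: "j \<in> J \<Longrightarrow> j \<in> carrier R"
  by (simp add: gr_jacobson_def)

text \<open>For homogeneous \<open>b \<notin> m\<close> the colon ideal \<open>(m : b)\<close> is again maximal, because it is the
  annihilator of a generator of the simple module \<open>R / m\<close>.\<close>

lemma maximal_left_colon:
  assumes m: "maximal_left m" and g: "g \<in> carrier G" and b: "b \<in> \<R> g" "b \<notin> m"
  shows "maximal_left {a \<in> carrier R. a \<otimes>\<^bsub>R\<^esub> b \<in> m}"
proof -
  let ?C = "{a \<in> carrier R. a \<otimes>\<^bsub>R\<^esub> b \<in> m}"
  have lm: "left_ideal m" by (rule maximal_left_ideal[OF m])
  have bc: "b \<in> carrier R" using grd.summand_closed[OF g b(1)] .
  have C: "left_ideal ?C" by (rule left_ideal_colon[OF lm g b(1)])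
  have "I = ?C" if I: "left_ideal I" "I \<noteq> carrier R" "?C \<subseteq> I" for I
  proof (rule ccontr)
    assume "I \<noteq> ?C"
    then obtain a where a: "a \<in> I" "a \<otimes>\<^bsub>R\<^esub> b \<notin> m"
      using I left_ideal_subset[OF I(1)] by auto
    \<comment> \<open>By maximality \<open>m + I b\<close> is all of \<open>R\<close>. Writing
      \<open>b = x + y b\<close> with \<open>x\<close> in \<open>m\<close> and \<open>y\<close> in
      \<open>I\<close> puts \<open>1 - y\<close> into the colon ideal and hence into
      \<open>I\<close>, so \<open>I\<close> contains the identity.\<close>
    let ?L = "m <+>\<^bsub>R\<^esub> ((\<lambda>a. a \<otimes>\<^bsub>R\<^esub> b) ` I)"
    have Ib: "left_ideal ((\<lambda>a. a \<otimes>\<^bsub>R\<^esub> b) ` I)"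
      by (rule left_ideal_mult_right[OF I(1) g b(1)])
    note msub = left_ideal_subset[OF lm, THEN subsetD] left_ideal_subset[OF Ib, THEN subsetD]
    have L: "left_ideal ?L" by (rule left_ideal_sum[OF lm Ib])
    have Lelem: "u \<in> ?L \<longleftrightarrow> (\<exists>x\<in>m. \<exists>y\<in>I. u = x \<oplus>\<^bsub>R\<^esub> y \<otimes>\<^bsub>R\<^esub> b)" for u
      by (auto simp: set_add_def set_mult_def)
    have "m \<subseteq> ?L"
    proof
      fix x assume "x \<in> m"
      then show "x \<in> ?L" unfolding Lelem using msub bc left_ideal_zero[OF I(1)]
        by (intro bexI[of _ x] bexI[of _ "\<zero>\<^bsub>R\<^esub>"]) auto
    qed
    moreover have "a \<otimes>\<^bsub>R\<^esub> b \<in> ?L"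
      unfolding Lelem using a msub bc left_ideal_zero[OF lm]
      by (intro bexI[of _ a] bexI[of _ "\<zero>\<^bsub>R\<^esub>"]) auto
    ultimately have "?L = carrier R" using maximal_left_eq[OF m L] a(2) by auto
    then obtain x y where xy: "x \<in> m" "y \<in> I" "b = x \<oplus>\<^bsub>R\<^esub> y \<otimes>\<^bsub>R\<^esub> b"
      using bc Lelem by auto
    have yc: "y \<in> carrier R" "x \<in> carrier R" using xy msub left_ideal_subset[OF I(1)] by auto
    have "(\<one>\<^bsub>R\<^esub> \<ominus>\<^bsub>R\<^esub> y) \<otimes>\<^bsub>R\<^esub> b = b \<ominus>\<^bsub>R\<^esub> y \<otimes>\<^bsub>R\<^esub> b"
      using yc bc by (simp add: R.l_distr R.l_minus a_minus_def)
    also have "\<dots> = x"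
      using yc bc xy(3) R.minus_eq R.a_assoc R.r_neg by (metis R.m_closed R.a_inv_closed R.r_zero)
    finally have "\<one>\<^bsub>R\<^esub> \<ominus>\<^bsub>R\<^esub> y \<in> I" using xy(1) yc I(3) by auto
    then have "(\<one>\<^bsub>R\<^esub> \<ominus>\<^bsub>R\<^esub> y) \<oplus>\<^bsub>R\<^esub> y \<in> I" by (rule left_ideal_add[OF I(1)]) (rule xy(2))
    then have "\<one>\<^bsub>R\<^esub> \<in> I" using yc by (simp add: a_minus_def R.a_assoc R.l_neg)
    then have "c \<in> I" if "c \<in> carrier R" for c
      using left_ideal_mult[OF I(1) that] that by force
    then show False using I(2) left_ideal_subset[OF I(1)] by auto
  qed
  moreover have "?C \<noteq> carrier R"
    using b(2) bc by (metis (no_types, lifting) R.l_one R.one_closed mem_Collect_eq)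
  ultimately show ?thesis
    using C by (auto simp: maximal_graded_left_ideal_def VectorSpace.maximal_def)
qed

text \<open>By additivity \<open>b\<close> may be taken homogeneous. For each maximal
  \<open>m\<close>, the claim \<open>j \<otimes> b \<in> m\<close> says that \<open>j\<close> lies
  in the colon ideal of \<open>b\<close>, which is everything if \<open>b \<in> m\<close> and
  otherwise a maximal graded left ideal.\<close>

lemma jacobson_mult_right:
  assumes j: "j \<in> J" and b: "b \<in> carrier R"
  shows "j \<otimes>\<^bsub>R\<^esub> b \<in> J"
  using b
proof (induction b rule: grd.homogeneous_induct)
  case zero
  then show ?case using j left_ideal_zero[OF left_ideal_jacobson] by (simp add: jacobson_closed)
next
  case (add x y)
  then show ?case
    using j left_ideal_add[OF left_ideal_jacobson] by (simp add: jacobson_closed R.r_distr)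
next
  case (homogeneous g b)
  have bc: "b \<in> carrier R" using grd.summand_closed[OF homogeneous] .
  have "j \<otimes>\<^bsub>R\<^esub> b \<in> m" if m: "maximal_left m" for m
  proof (cases "b \<in> m")
    case True
    then show ?thesis
      using left_ideal_mult[OF maximal_left_ideal[OF m]] j by (simp add: jacobson_closed)
  next
    case False
    from maximal_left_colon[OF m homogeneous this] j show ?thesis by (auto simp: gr_jacobson_def)
  qed
  then show ?case using j bc by (auto simp: gr_jacobson_def)
qed

end

section \<open>Chain conditions and the socle\<close>

context vectorspace
begin

text \<open>A term of least dimension stops the chain. The predicate \<open>P\<close> allows left
  and right graded ideals to be treated alike.\<close>

lemma dcc_subspaces:
  assumes fin: fin_dim and P: "\<And>W. P W \<Longrightarrow> subspace K W V"
  shows "dcc P"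
  unfolding dcc_def
proof (intro allI impI)
  fix I :: "nat \<Rightarrow> 'c set" assume I: "\<forall>n. P (I n) \<and> I (Suc n) \<subseteq> I n"
  let ?d = "\<lambda>n. vectorspace.dim K (vs (I n))"
  obtain N where N: "\<And>n. ?d N \<le> ?d n" using ex_has_least_nat[of "\<lambda>_. True" 0 ?d] by auto
  have "I n = I N" if "n \<ge> N" for n
  proof (rule ccontr)
    assume "I n \<noteq> I N"
    moreover have "I n \<subseteq> I N" by (rule lift_Suc_antimono_le[of I, OF _ that]) (simp add: I)
    ultimately have "?d n < ?d N"
      using I by (intro subspace_dim_psubset[OF fin] P) (simp_all add: psubset_eq)
    then show False using N[of n] by simp
  qed
  then show "\<exists>N. \<forall>n\<ge>N. I n = I N" by auto
qed

lemma subspace_dim_le: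
  assumes fin: fin_dim and W: "subspace K W V"
  shows "vectorspace.dim K (vs W) \<le> dim"
proof -
  have "subspace K (carrier V) V" by (rule subspaceI) auto
  from subspace_dim_psubset[OF fin W this] subspace_subset[OF W]
  show ?thesis by (cases "W = carrier V") (auto simp: psubset_eq)
qed

lemma acc_subspaces:
  assumes fin: fin_dim and P: "\<And>W. P W \<Longrightarrow> subspace K W V"
  shows "acc P"
  unfolding acc_def
proof (intro allI impI)
  fix I :: "nat \<Rightarrow> 'c set" assume I: "\<forall>n. P (I n) \<and> I n \<subseteq> I (Suc n)"
  let ?d = "\<lambda>n. vectorspace.dim K (vs (I n))"
  have "?d n < Suc dim" for n
    using subspace_dim_le[OF fin P] I by (simp add: less_Suc_eq_le)
  then have "\<exists>N. True \<and> (\<forall>n. True \<longrightarrow> ?d n \<le> ?d N)"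
    by (intro ex_has_greatest_nat[of _ 0 _ "Suc dim"]) auto
  then obtain N where N: "\<And>n. ?d n \<le> ?d N" by auto
  have "I n = I N" if "n \<ge> N" for n
  proof (rule ccontr)
    assume "I n \<noteq> I N"
    moreover have "I N \<subseteq> I n" by (rule lift_Suc_mono_le[of I, OF _ that]) (simp add: I)
    ultimately have "?d N < ?d n"
      using I by (intro subspace_dim_psubset[OF fin] P) (simp_all add: psubset_eq)
    then show False using N[of n] by simp
  qed
  then show "\<exists>N. \<forall>n\<ge>N. I n = I N" by auto
qed

end

section \<open>Graded ideals of a finite-dimensional graded algebra\<close>

locale fd_graded_algebra = graded_algebra G K R \<R>
  for G :: "('g, 'c) monoid_scheme" and K :: "('k, 'd) ring_scheme"
    and R :: "('k, 'r, 'a) module_scheme" and \<R> :: "'g \<Rightarrow> 'r set" +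
  assumes fin_dim: "K.fin_dim"
begin

text \<open>Scalars act through the elements \<open>c \<odot> \<one>\<close> of \<open>R\<close>,
  which is why one-sided ideals are subspaces.\<close>

lemma smult_eq_mult: "c \<in> carrier K \<Longrightarrow> x \<in> carrier R \<Longrightarrow> c \<odot>\<^bsub>R\<^esub> x = (c \<odot>\<^bsub>R\<^esub> \<one>\<^bsub>R\<^esub>) \<otimes>\<^bsub>R\<^esub> x"
  by (simp add: smult_mult_left)

lemma left_ideal_subspace:
  assumes "left_ideal I" shows "subspace K I R"
proof (rule K.subspaceI)
  show "c \<odot>\<^bsub>R\<^esub> x \<in> I" if "c \<in> carrier K" "x \<in> I" for c x
  proof -
    have "x \<in> carrier R" using left_ideal_subset[OF assms] that(2) by auto
    then show ?thesis
      using that left_ideal_mult[OF assms _ that(2)] by (subst smult_eq_mult) simp_all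
  qed
qed (use assms left_ideal_subset left_ideal_zero left_ideal_add in auto)

lemma right_ideal_subspace:
  assumes "graded_right_ideal G R \<R> I" shows "subspace K I R"
proof (rule K.subspaceI)
  have I: "I \<subseteq> carrier R" "\<zero>\<^bsub>R\<^esub> \<in> I" "\<And>x y. x \<in> I \<Longrightarrow> y \<in> I \<Longrightarrow> x \<oplus>\<^bsub>R\<^esub> y \<in> I"
    "\<And>a x. a \<in> carrier R \<Longrightarrow> x \<in> I \<Longrightarrow> x \<otimes>\<^bsub>R\<^esub> a \<in> I"
    using assms by (auto simp: graded_right_ideal_def R.additive_subgroup_iff)
  then show "I \<subseteq> carrier R" "\<zero>\<^bsub>R\<^esub> \<in> I" "\<And>x y. x \<in> I \<Longrightarrow> y \<in> I \<Longrightarrow> x \<oplus>\<^bsub>R\<^esub> y \<in> I" by auto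
  show "c \<odot>\<^bsub>R\<^esub> x \<in> I" if "c \<in> carrier K" "x \<in> I" for c x
  proof -
    have "c \<odot>\<^bsub>R\<^esub> x = x \<otimes>\<^bsub>R\<^esub> (c \<odot>\<^bsub>R\<^esub> \<one>\<^bsub>R\<^esub>)" using that I(1) by (auto simp: smult_mult_right)
    then show ?thesis using I(4) that by simp
  qed
qed

lemma graded_artinian: "graded_artinian G R \<R>"
  unfolding graded_artinian_def
  by (intro conjI K.dcc_subspaces[OF fin_dim] left_ideal_subspace right_ideal_subspace)

lemma acc_left_ideals: "acc (graded_left_ideal G R \<R>)"
  by (intro K.acc_subspaces[OF fin_dim] left_ideal_subspace)

text \<open>A nonzero graded left ideal of least dimension inside \<open>L\<close> is minimal. This
  is what makes the socle essential.\<close>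

lemma minimal_left_exists:
  assumes L: "left_ideal L" "L \<noteq> {\<zero>\<^bsub>R\<^esub>}"
  obtains I where "minimal_left I" "I \<subseteq> L"
proof -
  let ?d = "\<lambda>I. vectorspace.dim K (K.vs I)"
  obtain I where I: "left_ideal I" "I \<noteq> {\<zero>\<^bsub>R\<^esub>}" "I \<subseteq> L"
    and least: "\<And>I'. left_ideal I' \<Longrightarrow> I' \<noteq> {\<zero>\<^bsub>R\<^esub>} \<Longrightarrow> I' \<subseteq> L \<Longrightarrow> ?d I \<le> ?d I'"
    using ex_has_least_nat[of "\<lambda>I. left_ideal I \<and> I \<noteq> {\<zero>\<^bsub>R\<^esub>} \<and> I \<subseteq> L" L ?d] L by auto
  have "I' = I" if I': "left_ideal I'" "I' \<noteq> {\<zero>\<^bsub>R\<^esub>}" "I' \<subseteq> I" for I'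
  proof (rule ccontr)
    assume "I' \<noteq> I"
    then have "?d I' < ?d I"
      using I' I by (intro K.subspace_dim_psubset[OF fin_dim] left_ideal_subspace) auto
    moreover have "?d I \<le> ?d I'" using I' I(3) by (intro least) auto
    ultimately show False by simp
  qed
  then have "minimal_left I"
    using I by (auto simp: minimal_graded_left_ideal_def VectorSpace.minimal_def)
  then show ?thesis using that I by auto
qed

text \<open>Two minimisations: a finite family of maximal ideals whose intersection has least
  dimension already has intersection \<open>J\<close>, and among the finite families with
  intersection \<open>J\<close> one of least size is irredundant. Irredundance is the source of the
  idempotents.\<close>

lemma jacobson_finite_intersection:
  obtains F where "finite F" "\<And>m. m \<in> F \<Longrightarrow> maximal_left m" "J = carrier R \<inter> \<Inter>F"
    "\<And>m. m \<in> F \<Longrightarrow> \<not> carrier R \<inter> \<Inter>(F - {m}) \<subseteq> m"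
proof -
  let ?P = "\<lambda>F. finite F \<and> (\<forall>m\<in>F. maximal_left m)"
  let ?d = "\<lambda>F. vectorspace.dim K (K.vs (carrier R \<inter> \<Inter>F))"
  obtain F0 where F0: "?P F0" and least: "\<And>F. ?P F \<Longrightarrow> ?d F0 \<le> ?d F"
  proof -
    have "\<exists>F. ?P F \<and> (\<forall>F'. ?P F' \<longrightarrow> ?d F \<le> ?d F')"
      by (rule ex_has_least_nat[of _ "{}"]) simp
    then show thesis using that by blast
  qed
  have sub: "subspace K (carrier R \<inter> \<Inter>F) R" if "?P F" for F
    using that by (intro left_ideal_subspace left_ideal_Inter) (auto intro: maximal_left_ideal)
  have "carrier R \<inter> \<Inter>F0 \<subseteq> m" if m: "maximal_left m" for m
  proof (rule ccontr)
    assume "\<not> ?thesis"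
    then have "carrier R \<inter> \<Inter>(insert m F0) \<subset> carrier R \<inter> \<Inter>F0" by auto
    moreover have "?P (insert m F0)" using F0 m by auto
    ultimately have "?d (insert m F0) < ?d F0"
      by (intro K.subspace_dim_psubset[OF fin_dim] sub F0)
    then show False using least[OF \<open>?P (insert m F0)\<close>] by simp
  qed
  then have J0: "J = carrier R \<inter> \<Inter>F0" using F0 by (auto simp: gr_jacobson_def)
  define Q where "Q F \<longleftrightarrow> ?P F \<and> J = carrier R \<inter> \<Inter>F" for F
  have "\<exists>F. Q F \<and> (\<forall>F'. Q F' \<longrightarrow> card F \<le> card F')"
    by (rule ex_has_least_nat[of _ F0]) (simp add: Q_def F0 flip: J0)
  then obtain F where "Q F" and leastF: "\<And>F'. Q F' \<Longrightarrow> card F \<le> card F'" by blast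
  then have F: "?P F" "J = carrier R \<inter> \<Inter>F" by (simp_all add: Q_def)
  have "\<not> carrier R \<inter> \<Inter>(F - {m}) \<subseteq> m" if "m \<in> F" for m
  proof
    assume "carrier R \<inter> \<Inter>(F - {m}) \<subseteq> m"
    then have "J = carrier R \<inter> \<Inter>(F - {m})" using F(2) by auto
    then have "card F \<le> card (F - {m})" using F(1) by (intro leastF) (simp add: Q_def)
    then show False using F(1) that by (meson card_Diff1_less not_less)
  qed
  then show ?thesis using F by (intro that[of F]) auto
qed

end

text \<open>Modulo \<open>J\<close> the elements \<open>e m\<close> are the orthogonal idempotents belonging to the decomposition of
  \<open>R / J\<close> into the simple modules \<open>R / m\<close>.\<close>

locale idempotent_system = fd_graded_algebra G K R \<R>
  for G :: "('g, 'c) monoid_scheme" and K :: "('k, 'd) ring_scheme"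
    and R :: "('k, 'r, 'a) module_scheme" and \<R> :: "'g \<Rightarrow> 'r set" +
  fixes F :: "'r set set" and e :: "'r set \<Rightarrow> 'r"
  assumes finite_maximal: "finite F"
    and maximal: "m \<in> F \<Longrightarrow> maximal_left m"
    and Inter_maximal: "J = carrier R \<inter> \<Inter>F"
    and idem_homogeneous: "m \<in> F \<Longrightarrow> e m \<in> \<R> \<one>\<^bsub>G\<^esub>"
    and idem_notin: "m \<in> F \<Longrightarrow> e m \<notin> m"
    and idem: "m \<in> F \<Longrightarrow> e m \<ominus>\<^bsub>R\<^esub> e m \<otimes>\<^bsub>R\<^esub> e m \<in> J"
    and mem_maximal_iff: "m \<in> F \<Longrightarrow> x \<in> carrier R \<Longrightarrow> x \<in> m \<longleftrightarrow> x \<otimes>\<^bsub>R\<^esub> e m \<in> J"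
    and idem_orthogonal: "m \<in> F \<Longrightarrow> m' \<in> F \<Longrightarrow> m \<noteq> m' \<Longrightarrow> e m \<otimes>\<^bsub>R\<^esub> e m' \<in> J"
    and sum_idem: "\<one>\<^bsub>R\<^esub> \<ominus>\<^bsub>R\<^esub> (\<Oplus>\<^bsub>R\<^esub>m\<in>F. e m) \<in> J"
begin

lemma idem_closed: "m \<in> F \<Longrightarrow> e m \<in> carrier R"
  using grd.summand_closed[OF G.one_closed idem_homogeneous] .

end

context fd_graded_algebra
begin

text \<open>This is the Chinese remainder argument. If \<open>L\<close> is the intersection of the
  members of \<open>F\<close> other than \<open>m\<close>, irredundance and maximality give
  \<open>m + L = R\<close>. Hence there is \<open>e m\<close> congruent to 1 modulo \<open>m\<close>
  and to 0 modulo the other members, and the relations modulo \<open>J\<close> reduce to relations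
  modulo each member of \<open>F\<close>.\<close>

lemma idempotent_system_exists: "\<exists>F e. idempotent_system G K R \<R> F e"
proof -
  obtain F where F: "finite F" "\<And>m. m \<in> F \<Longrightarrow> maximal_left m" "J = carrier R \<inter> \<Inter>F"
    "\<And>m. m \<in> F \<Longrightarrow> \<not> carrier R \<inter> \<Inter>(F - {m}) \<subseteq> m"
    using jacobson_finite_intersection by blast
  have "\<exists>e. e \<in> \<R> \<one>\<^bsub>G\<^esub> \<and> (\<forall>m'\<in>F - {m}. e \<in> m') \<and> \<one>\<^bsub>R\<^esub> \<ominus>\<^bsub>R\<^esub> e \<in> m" if m: "m \<in> F" for m
  proof -
    let ?L = "carrier R \<inter> \<Inter>(F - {m})"
    have lm: "left_ideal m" using F(2)[OF m] by (rule maximal_left_ideal)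
    have L: "left_ideal ?L" using F(2) by (intro left_ideal_Inter) (auto intro: maximal_left_ideal)
    note msub = left_ideal_subset[OF lm, THEN subsetD]
    have S: "left_ideal (m <+>\<^bsub>R\<^esub> ?L)" by (rule left_ideal_sum[OF lm L])
    have Selem: "u \<in> m <+>\<^bsub>R\<^esub> ?L \<longleftrightarrow> (\<exists>x\<in>m. \<exists>y\<in>?L. u = x \<oplus>\<^bsub>R\<^esub> y)" for u
      by (auto simp: set_add_def set_mult_def)
    have "m \<subseteq> m <+>\<^bsub>R\<^esub> ?L"
    proof
      fix x assume "x \<in> m"
      then show "x \<in> m <+>\<^bsub>R\<^esub> ?L" unfolding Selem using msub left_ideal_zero[OF L]
        by (intro bexI[of _ x] bexI[of _ "\<zero>\<^bsub>R\<^esub>"]) auto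
    qed
    moreover obtain l where l: "l \<in> ?L" "l \<notin> m" using F(4)[OF m] by auto
    then have "l \<in> m <+>\<^bsub>R\<^esub> ?L" unfolding Selem using left_ideal_zero[OF lm]
      by (intro bexI[of _ l] bexI[of _ "\<zero>\<^bsub>R\<^esub>"]) auto
    ultimately have "m <+>\<^bsub>R\<^esub> ?L = carrier R"
      using maximal_left_eq[OF F(2)[OF m] S] l(2) by auto
    then obtain u y where uy: "u \<in> m" "y \<in> ?L" "\<one>\<^bsub>R\<^esub> = u \<oplus>\<^bsub>R\<^esub> y"
      using Selem[of "\<one>\<^bsub>R\<^esub>"] by auto
    \<comment> \<open>The identity has degree \<open>\<one>\<close> and the ideals are graded, so
      the splitting \<open>1 = u + y\<close> may be projected to that degree. This gives an
      idempotent modulo \<open>J\<close> that is homogeneous.\<close>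
    let ?u = "grd.comp u \<one>\<^bsub>G\<^esub>" and ?e = "grd.comp y \<one>\<^bsub>G\<^esub>"
    have c: "u \<in> carrier R" "y \<in> carrier R" using uy msub by auto
    have "grd.comp \<one>\<^bsub>R\<^esub> \<one>\<^bsub>G\<^esub> = ?u \<oplus>\<^bsub>R\<^esub> ?e"
      unfolding uy(3) using c by (simp add: grd.component_add)
    then have "\<one>\<^bsub>R\<^esub> = ?u \<oplus>\<^bsub>R\<^esub> ?e"
      using grd.component_homogeneous[OF one_homogeneous, of "\<one>\<^bsub>G\<^esub>"] by simp
    then have "\<one>\<^bsub>R\<^esub> \<ominus>\<^bsub>R\<^esub> ?e = ?u"
      using c grd.component_closed by (simp add: a_minus_def R.a_assoc R.r_neg)
    then have "\<one>\<^bsub>R\<^esub> \<ominus>\<^bsub>R\<^esub> ?e \<in> m" using left_ideal_comp[OF lm uy(1)] by simp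
    moreover have "?e \<in> ?L" using left_ideal_comp[OF L uy(2)] by simp
    moreover have "?e \<in> \<R> \<one>\<^bsub>G\<^esub>" using c grd.component_mem by simp
    ultimately show ?thesis by blast
  qed
  then have "\<forall>m\<in>F. \<exists>e. e \<in> \<R> \<one>\<^bsub>G\<^esub> \<and> (\<forall>m'\<in>F - {m}. e \<in> m') \<and> \<one>\<^bsub>R\<^esub> \<ominus>\<^bsub>R\<^esub> e \<in> m" by blast
  from bchoice[OF this] obtain e where
    "\<forall>m\<in>F. e m \<in> \<R> \<one>\<^bsub>G\<^esub> \<and> (\<forall>m'\<in>F - {m}. e m \<in> m') \<and> \<one>\<^bsub>R\<^esub> \<ominus>\<^bsub>R\<^esub> e m \<in> m" ..
  then have e: "\<And>m. m \<in> F \<Longrightarrow> e m \<in> \<R> \<one>\<^bsub>G\<^esub>"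
      "\<And>m m'. m \<in> F \<Longrightarrow> m' \<in> F \<Longrightarrow> m' \<noteq> m \<Longrightarrow> e m \<in> m'"
      "\<And>m. m \<in> F \<Longrightarrow> \<one>\<^bsub>R\<^esub> \<ominus>\<^bsub>R\<^esub> e m \<in> m"
    by simp_all
  have ec: "e m \<in> carrier R" if "m \<in> F" for m using grd.summand_closed e(1) that by auto
  note lm = maximal_left_ideal[OF F(2)]
  \<comment> \<open>The difference \<open>x - x (e m) = x (1 - e m)\<close> always lies in
    \<open>m\<close>, so \<open>x\<close> and \<open>x (e m)\<close> belong to \<open>m\<close>
    together. The other members of \<open>F\<close> contain \<open>e m\<close>, hence also
    \<open>x (e m)\<close>.\<close>
  have iff: "x \<in> m \<longleftrightarrow> x \<otimes>\<^bsub>R\<^esub> e m \<in> J" if m: "m \<in> F" and x: "x \<in> carrier R" for m x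
  proof -
    have eq: "x \<ominus>\<^bsub>R\<^esub> x \<otimes>\<^bsub>R\<^esub> e m = x \<otimes>\<^bsub>R\<^esub> (\<one>\<^bsub>R\<^esub> \<ominus>\<^bsub>R\<^esub> e m)"
      using x ec[OF m] by (simp add: a_minus_def R.r_distr R.r_minus)
    have d: "x \<ominus>\<^bsub>R\<^esub> x \<otimes>\<^bsub>R\<^esub> e m \<in> m"
      unfolding eq using e(3)[OF m] x by (intro left_ideal_mult[OF lm[OF m]]) auto
    show ?thesis
    proof
      assume xm: "x \<in> m"
      have "x \<otimes>\<^bsub>R\<^esub> e m = x \<ominus>\<^bsub>R\<^esub> (x \<ominus>\<^bsub>R\<^esub> x \<otimes>\<^bsub>R\<^esub> e m)"
        using x ec[OF m] by (simp add: a_minus_def R.minus_add R.r_neg1 R.r_neg2)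
      then have "x \<otimes>\<^bsub>R\<^esub> e m \<in> m" using left_ideal_minus[OF lm[OF m] xm d] by simp
      moreover have "x \<otimes>\<^bsub>R\<^esub> e m \<in> m'" if "m' \<in> F" "m' \<noteq> m" for m'
        using left_ideal_mult[OF lm[OF that(1)] x] e(2)[OF m that] by simp
      ultimately show "x \<otimes>\<^bsub>R\<^esub> e m \<in> J" using x ec[OF m] unfolding F(3) by auto
    next
      assume "x \<otimes>\<^bsub>R\<^esub> e m \<in> J"
      then have "x \<otimes>\<^bsub>R\<^esub> e m \<in> m" using F(3) m by auto
      then have "(x \<ominus>\<^bsub>R\<^esub> x \<otimes>\<^bsub>R\<^esub> e m) \<oplus>\<^bsub>R\<^esub> x \<otimes>\<^bsub>R\<^esub> e m \<in> m" by (rule left_ideal_add[OF lm[OF m] d])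
      then show "x \<in> m" using x ec[OF m] by (simp add: a_minus_def R.a_assoc R.l_neg)
    qed
  qed
  have nm: "e m \<notin> m" if m: "m \<in> F" for m
  proof
    assume "e m \<in> m"
    then have "(\<one>\<^bsub>R\<^esub> \<ominus>\<^bsub>R\<^esub> e m) \<oplus>\<^bsub>R\<^esub> e m \<in> m" by (rule left_ideal_add[OF lm[OF m] e(3)[OF m]])
    then have "\<one>\<^bsub>R\<^esub> \<in> m" using ec[OF m] by (simp add: a_minus_def R.a_assoc R.l_neg)
    then show False using one_not_in_maximal[OF F(2)[OF m]] by simp
  qed
  have orth: "e m \<otimes>\<^bsub>R\<^esub> e m' \<in> J" if "m \<in> F" "m' \<in> F" "m \<noteq> m'" for m m'
    using iff[OF that(2) ec[OF that(1)]] e(2)[OF that(1,2)] that(3) by auto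
  have idem: "e m \<ominus>\<^bsub>R\<^esub> e m \<otimes>\<^bsub>R\<^esub> e m \<in> J" if m: "m \<in> F" for m
  proof -
    have "(\<one>\<^bsub>R\<^esub> \<ominus>\<^bsub>R\<^esub> e m) \<otimes>\<^bsub>R\<^esub> e m \<in> J" using iff[OF m, of "\<one>\<^bsub>R\<^esub> \<ominus>\<^bsub>R\<^esub> e m"] e(3)[OF m] ec[OF m] by simp
    then show ?thesis using ec[OF m] by (simp add: a_minus_def R.l_distr R.l_minus)
  qed
  have ecF: "e \<in> F \<rightarrow> carrier R" using ec by auto
  \<comment> \<open>Modulo \<open>m'\<close> only the summand \<open>e m'\<close> survives, and it
    is congruent to 1.\<close>
  have sum1: "\<one>\<^bsub>R\<^esub> \<ominus>\<^bsub>R\<^esub> (\<Oplus>\<^bsub>R\<^esub>m\<in>F. e m) \<in> m'" if m': "m' \<in> F" for m'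
  proof -
    let ?s = "\<Oplus>\<^bsub>R\<^esub>m\<in>F - {m'}. e m"
    have s: "?s \<in> m'"
      using e(2) m' by (intro R.finsum_mem left_ideal_subgroup[OF lm]) auto
    have sc: "?s \<in> carrier R" using ecF by (intro R.finsum_closed) auto
    have "(\<Oplus>\<^bsub>R\<^esub>m\<in>insert m' (F - {m'}). e m) = e m' \<oplus>\<^bsub>R\<^esub> ?s"
      using F(1) ecF ec[OF m'] by (intro R.finsum_insert) auto
    then have "(\<Oplus>\<^bsub>R\<^esub>m\<in>F. e m) = e m' \<oplus>\<^bsub>R\<^esub> ?s" using m' by (simp add: insert_absorb)
    then have "\<one>\<^bsub>R\<^esub> \<ominus>\<^bsub>R\<^esub> (\<Oplus>\<^bsub>R\<^esub>m\<in>F. e m) = (\<one>\<^bsub>R\<^esub> \<ominus>\<^bsub>R\<^esub> e m') \<ominus>\<^bsub>R\<^esub> ?s"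
      using sc ec[OF m'] by (simp add: a_minus_def R.minus_add R.a_assoc)
    then show ?thesis using left_ideal_minus[OF lm[OF m'] e(3)[OF m'] s] by simp
  qed
  have "\<one>\<^bsub>R\<^esub> \<ominus>\<^bsub>R\<^esub> (\<Oplus>\<^bsub>R\<^esub>m\<in>F. e m) \<in> J"
    unfolding F(3) using sum1 R.finsum_closed[OF ecF] by auto
  then have "idempotent_system G K R \<R> F e"
    using F(1-3) e(1) nm idem iff orth by unfold_locales
  then show ?thesis by blast
qed

section \<open>The graded socle as the right annihilator of \<open>J\<close>\<close>

abbreviation soc :: "'r set" where "soc \<equiv> gr_soc G R \<R>"

lemma minimal_subset_soc: "minimal_left I \<Longrightarrow> I \<subseteq> soc"
proof
  fix x assume I: "minimal_left I" "x \<in> I"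
  have "x = (\<Oplus>\<^bsub>R\<^esub>L\<in>{I}. x)"
    using I left_ideal_subset[OF minimal_left_ideal[OF I(1)]] by auto
  then show "x \<in> soc"
    unfolding gr_soc_def using I by (intro CollectI exI[of _ "{I}"] exI[of _ "\<lambda>_. x"]) auto
qed

lemma soc_subgroup: "additive_subgroup soc R"
proof -
  have sub: "x I \<in> carrier R" if "minimal_left I \<and> x I \<in> I" for x I
    using that left_ideal_subset minimal_left_ideal by blast
  have closed: "soc \<subseteq> carrier R"
    using sub by (auto simp: gr_soc_def intro!: R.finsum_closed)
  have "(\<Oplus>\<^bsub>R\<^esub>I\<in>{}. \<zero>\<^bsub>R\<^esub>) \<in> soc"
    unfolding gr_soc_def by (intro CollectI exI[of _ "{}"] exI[of _ "\<lambda>_. \<zero>\<^bsub>R\<^esub>"]) auto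
  then have zero: "\<zero>\<^bsub>R\<^esub> \<in> soc" by simp
  have mult: "a \<otimes>\<^bsub>R\<^esub> u \<in> soc" if au: "a \<in> carrier R" "u \<in> soc" for a u
  proof -
    obtain F x where F: "finite F" "\<forall>I\<in>F. minimal_left I \<and> x I \<in> I" "u = (\<Oplus>\<^bsub>R\<^esub>I\<in>F. x I)"
      using au(2) by (auto simp: gr_soc_def)
    have "a \<otimes>\<^bsub>R\<^esub> u = (\<Oplus>\<^bsub>R\<^esub>I\<in>F. a \<otimes>\<^bsub>R\<^esub> x I)"
      unfolding F(3) using F au(1) sub by (intro R.finsum_rdistr) auto
    moreover have "\<forall>I\<in>F. minimal_left I \<and> a \<otimes>\<^bsub>R\<^esub> x I \<in> I"
      using F au(1) left_ideal_mult minimal_left_ideal by blast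
    ultimately show ?thesis
      unfolding gr_soc_def using F(1) by (intro CollectI exI[of _ F] exI[of _ "\<lambda>I. a \<otimes>\<^bsub>R\<^esub> x I"]) auto
  qed
  have add: "u \<oplus>\<^bsub>R\<^esub> v \<in> soc" if uv: "u \<in> soc" "v \<in> soc" for u v
  proof -
    obtain F x where F: "finite F" "\<forall>I\<in>F. minimal_left I \<and> x I \<in> I" "u = (\<Oplus>\<^bsub>R\<^esub>I\<in>F. x I)"
      using uv(1) by (auto simp: gr_soc_def)
    obtain F' x' where F': "finite F'" "\<forall>I\<in>F'. minimal_left I \<and> x' I \<in> I" "v = (\<Oplus>\<^bsub>R\<^esub>I\<in>F'. x' I)"
      using uv(2) by (auto simp: gr_soc_def)
    \<comment> \<open>Both families are extended by zero to \<open>F \<union> F'\<close>, so that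
      the two sums can be added term by term.\<close>
    define y where "y I = (if I \<in> F then x I else \<zero>\<^bsub>R\<^esub>)" for I
    define y' where "y' I = (if I \<in> F' then x' I else \<zero>\<^bsub>R\<^esub>)" for I
    let ?U = "F \<union> F'"
    have mem: "minimal_left I \<and> y I \<in> I \<and> y' I \<in> I" if "I \<in> ?U" for I
      using that F(2) F'(2) left_ideal_zero[OF minimal_left_ideal] by (auto simp: y_def y'_def)
    have yc: "y \<in> ?U \<rightarrow> carrier R" "y' \<in> ?U \<rightarrow> carrier R"
      using mem left_ideal_subset minimal_left_ideal by blast+
    have "u = (\<Oplus>\<^bsub>R\<^esub>I\<in>?U. y I)"
      unfolding F(3) using F F' yc sub
      by (intro R.add.finprod_mono_neutral_cong_left) (auto simp: y_def)
    moreover have "v = (\<Oplus>\<^bsub>R\<^esub>I\<in>?U. y' I)"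
      unfolding F'(3) using F F' yc sub
      by (intro R.add.finprod_mono_neutral_cong_left) (auto simp: y'_def)
    ultimately have "u \<oplus>\<^bsub>R\<^esub> v = (\<Oplus>\<^bsub>R\<^esub>I\<in>?U. y I \<oplus>\<^bsub>R\<^esub> y' I)"
      using yc by (simp add: R.finsum_addf)
    moreover have "\<forall>I\<in>?U. minimal_left I \<and> y I \<oplus>\<^bsub>R\<^esub> y' I \<in> I"
      using mem left_ideal_add minimal_left_ideal by blast
    ultimately show ?thesis
      unfolding gr_soc_def using F(1) F'(1)
      by (intro CollectI exI[of _ ?U] exI[of _ "\<lambda>I. y I \<oplus>\<^bsub>R\<^esub> y' I"]) auto
  qed
  have neg: "\<ominus>\<^bsub>R\<^esub> u \<in> soc" if "u \<in> soc" for u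
    using mult[OF R.a_inv_closed[OF R.one_closed] that] closed that by (auto simp: R.l_minus)
  show ?thesis using closed zero add neg by (auto simp: R.additive_subgroup_iff)
qed

text \<open>The map \<open>a \<mapsto> a y\<close> sends \<open>R\<close> onto the simple module
  \<open>I\<close>, so its kernel is maximal. In terms of elements, a larger \<open>L\<close> has
  \<open>L y = I\<close>, so \<open>y = k y\<close> with \<open>k\<close> in \<open>L\<close>, and
  \<open>1 - k\<close> annihilates \<open>y\<close>. The condition is written with
  \<open>\<in> {\<zero>}\<close> to be an instance of a colon ideal.\<close>

lemma annihilator_maximal:
  assumes I: "minimal_left I" and g: "g \<in> carrier G" and y: "y \<in> I" "y \<in> \<R> g" "y \<noteq> \<zero>\<^bsub>R\<^esub>"
  shows "maximal_left {a \<in> carrier R. a \<otimes>\<^bsub>R\<^esub> y \<in> {\<zero>\<^bsub>R\<^esub>}}"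
proof -
  let ?C = "{a \<in> carrier R. a \<otimes>\<^bsub>R\<^esub> y \<in> {\<zero>\<^bsub>R\<^esub>}}"
  have yc: "y \<in> carrier R" using grd.summand_closed[OF g y(2)] .
  have C: "left_ideal ?C" by (rule left_ideal_colon[OF left_ideal_zero_set g y(2)])
  have "L = ?C" if L: "left_ideal L" "L \<noteq> carrier R" "?C \<subseteq> L" for L
  proof (rule ccontr)
    assume "L \<noteq> ?C"
    then obtain a where a: "a \<in> L" "a \<otimes>\<^bsub>R\<^esub> y \<noteq> \<zero>\<^bsub>R\<^esub>"
      using L left_ideal_subset[OF L(1)] by auto
    have "(\<lambda>a. a \<otimes>\<^bsub>R\<^esub> y) ` L = I"
    proof (rule minimal_left_eq[OF I])
      show "left_ideal ((\<lambda>a. a \<otimes>\<^bsub>R\<^esub> y) ` L)" by (rule left_ideal_mult_right[OF L(1) g y(2)])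
      show "(\<lambda>a. a \<otimes>\<^bsub>R\<^esub> y) ` L \<subseteq> I"
        using left_ideal_mult[OF minimal_left_ideal[OF I] _ y(1)] left_ideal_subset[OF L(1)] by auto
      show "(\<lambda>a. a \<otimes>\<^bsub>R\<^esub> y) ` L \<noteq> {\<zero>\<^bsub>R\<^esub>}" using a by auto
    qed
    then obtain k where k: "k \<in> L" "y = k \<otimes>\<^bsub>R\<^esub> y" using y(1) by auto
    have kc: "k \<in> carrier R" using left_ideal_subset[OF L(1)] k by auto
    have "(\<one>\<^bsub>R\<^esub> \<ominus>\<^bsub>R\<^esub> k) \<otimes>\<^bsub>R\<^esub> y = y \<ominus>\<^bsub>R\<^esub> k \<otimes>\<^bsub>R\<^esub> y"
      using kc yc by (simp add: R.l_distr R.l_minus a_minus_def)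
    also have "\<dots> = \<zero>\<^bsub>R\<^esub>" using yc by (simp add: k(2)[symmetric] a_minus_def R.r_neg)
    finally have "\<one>\<^bsub>R\<^esub> \<ominus>\<^bsub>R\<^esub> k \<in> L" using kc L(3) by auto
    then have "(\<one>\<^bsub>R\<^esub> \<ominus>\<^bsub>R\<^esub> k) \<oplus>\<^bsub>R\<^esub> k \<in> L" by (rule left_ideal_add[OF L(1)]) (rule k(1))
    then have "\<one>\<^bsub>R\<^esub> \<in> L" using kc by (simp add: a_minus_def R.a_assoc R.l_neg)
    then have "c \<in> L" if "c \<in> carrier R" for c
      using left_ideal_mult[OF L(1) that] that by force
    then show False using L(2) left_ideal_subset[OF L(1)] by auto
  qed
  moreover have "?C \<noteq> carrier R"
    using y(3) yc by (metis (no_types, lifting) R.l_one R.one_closed mem_Collect_eq singletonD)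
  ultimately show ?thesis
    using C by (auto simp: maximal_graded_left_ideal_def VectorSpace.maximal_def)
qed

text \<open>For homogeneous \<open>x\<close> the annihilator is a maximal graded left ideal and so
  contains \<open>J\<close>. A general \<open>x\<close> is treated through its components, which
  stay in \<open>I\<close>.\<close>

lemma jacobson_annihilates_minimal:
  assumes I: "minimal_left I" and x: "x \<in> I" and j: "j \<in> J"
  shows "j \<otimes>\<^bsub>R\<^esub> x = \<zero>\<^bsub>R\<^esub>"
proof -
  let ?H = "{x \<in> carrier R. j \<otimes>\<^bsub>R\<^esub> x = \<zero>\<^bsub>R\<^esub>}"
  have jc: "j \<in> carrier R" using j by (rule jacobson_closed)
  have xc: "x \<in> carrier R" using x left_ideal_subset[OF minimal_left_ideal[OF I]] by auto
  have "x \<in> ?H"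
  proof (rule grd.mem_by_components)
    show "additive_subgroup ?H R"
      using jc by (auto simp: R.additive_subgroup_iff R.r_distr R.r_minus)
    fix g assume g: "g \<in> carrier G"
    have y: "grd.comp x g \<in> I" "grd.comp x g \<in> \<R> g" "grd.comp x g \<in> carrier R"
      using left_ideal_comp[OF minimal_left_ideal[OF I] x g] grd.component_mem[OF xc g]
        grd.component_closed[OF xc g] by auto
    show "grd.comp x g \<in> ?H"
    proof (cases "grd.comp x g = \<zero>\<^bsub>R\<^esub>")
      case False
      from annihilator_maximal[OF I g y(1,2) this] j y(3) show ?thesis
        by (auto simp: gr_jacobson_def)
    qed (use jc in simp)
  qed (rule xc)
  then show ?thesis by simp
qed

text \<open>The module \<open>R y\<close> is a quotient of the simple module \<open>R / m\<close>,
  hence zero or a minimal graded left ideal.\<close>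

lemma simple_module_in_soc:
  assumes m: "maximal_left m" and g: "g \<in> carrier G" and y: "y \<in> \<R> g"
    and my: "\<And>a. a \<in> m \<Longrightarrow> a \<otimes>\<^bsub>R\<^esub> y = \<zero>\<^bsub>R\<^esub>"
  shows "y \<in> soc"
proof (cases "y = \<zero>\<^bsub>R\<^esub>")
  case True
  then show ?thesis using soc_subgroup by (simp add: R.additive_subgroup_iff)
next
  case False
  let ?I = "(\<lambda>a. a \<otimes>\<^bsub>R\<^esub> y) ` carrier R"
  have yc: "y \<in> carrier R" using grd.summand_closed[OF g y] .
  have I: "left_ideal ?I" by (rule left_ideal_mult_right[OF left_ideal_carrier g y])
  have yI: "y \<in> ?I" using yc by (intro image_eqI[of _ _ "\<one>\<^bsub>R\<^esub>"]) auto
  have "L = ?I" if L: "left_ideal L" "L \<noteq> {\<zero>\<^bsub>R\<^esub>}" "L \<subseteq> ?I" for L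
  proof -
    let ?C = "{a \<in> carrier R. a \<otimes>\<^bsub>R\<^esub> y \<in> L}"
    have C: "left_ideal ?C" by (rule left_ideal_colon[OF L(1) g y])
    have mC: "m \<subseteq> ?C"
      using my left_ideal_zero[OF L(1)] left_ideal_subset[OF maximal_left_ideal[OF m]] by auto
    obtain z where z: "z \<in> L" "z \<noteq> \<zero>\<^bsub>R\<^esub>" using L(2) left_ideal_zero[OF L(1)] by auto
    then obtain a where a: "a \<in> carrier R" "z = a \<otimes>\<^bsub>R\<^esub> y" using L(3) by auto
    then have "a \<in> ?C" "a \<notin> m" using z my by auto
    then have "?C = carrier R" using maximal_left_eq[OF m C mC] by auto
    then show "L = ?I" using L(3) by auto
  qed
  moreover have "?I \<noteq> {\<zero>\<^bsub>R\<^esub>}" using yI False by auto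
  ultimately have "minimal_left ?I"
    using I by (auto simp: minimal_graded_left_ideal_def VectorSpace.minimal_def)
  then show ?thesis using minimal_subset_soc yI by auto
qed

text \<open>Since \<open>J\<close> is graded, it annihilates the component \<open>y\<close> of
  \<open>x\<close> along with \<open>x\<close>. Modulo \<open>J\<close> the identity is the sum of
  the \<open>e m\<close>, so \<open>y\<close> is the sum of the elements
  \<open>e m \<otimes> y\<close>, and each of these is annihilated by \<open>m\<close> because
  \<open>a \<otimes> e m\<close> lies in \<open>J\<close> for \<open>a\<close> in
  \<open>m\<close>.\<close>

lemma component_in_soc:
  assumes x: "x \<in> carrier R" "\<And>j. j \<in> J \<Longrightarrow> j \<otimes>\<^bsub>R\<^esub> x = \<zero>\<^bsub>R\<^esub>" and g: "g \<in> carrier G"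
  shows "grd.comp x g \<in> soc"
proof -
  obtain F e where "idempotent_system G K R \<R> F e" using idempotent_system_exists by blast
  then interpret sys: idempotent_system G K R \<R> F e .
  let ?y = "grd.comp x g"
  have y: "?y \<in> \<R> g" "?y \<in> carrier R"
    using x g by (auto simp: grd.component_mem grd.component_closed)
  have Jy: "j \<otimes>\<^bsub>R\<^esub> ?y = \<zero>\<^bsub>R\<^esub>" if j: "j \<in> J" for j
  proof -
    have jc: "j \<in> carrier R" using j by (rule jacobson_closed)
    let ?H = "{j \<in> carrier R. j \<otimes>\<^bsub>R\<^esub> ?y = \<zero>\<^bsub>R\<^esub>}"
    have "j \<in> ?H"
    proof (rule grd.mem_by_components)
      show "additive_subgroup ?H R"
        using y by (auto simp: R.additive_subgroup_iff R.l_distr R.l_minus)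
      fix h assume h: "h \<in> carrier G"
      have jh: "grd.comp j h \<in> J" "grd.comp j h \<in> \<R> h"
        using left_ideal_comp[OF left_ideal_jacobson j h] grd.component_mem[OF jc h] by auto
      have "grd.comp j h \<otimes>\<^bsub>R\<^esub> ?y = \<zero>\<^bsub>R\<^esub>"
        using comp_mult_left[OF h jh(2), of x g] x g h jh(1) by (simp add: grd.component_zero)
      then show "grd.comp j h \<in> ?H" using jc h by (simp add: grd.component_closed)
    qed (rule jc)
    then show ?thesis by simp
  qed
  have "e m \<otimes>\<^bsub>R\<^esub> ?y \<in> soc" if m: "m \<in> F" for m
  proof (rule simple_module_in_soc[OF sys.maximal[OF m] g])
    show "e m \<otimes>\<^bsub>R\<^esub> ?y \<in> \<R> g" using mult_comp[OF G.one_closed g sys.idem_homogeneous[OF m] y(1)] g by simp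
    fix a assume a: "a \<in> m"
    then have ac: "a \<in> carrier R" using left_ideal_subset[OF maximal_left_ideal[OF sys.maximal[OF m]]] by auto
    have "(a \<otimes>\<^bsub>R\<^esub> e m) \<otimes>\<^bsub>R\<^esub> ?y = \<zero>\<^bsub>R\<^esub>" using sys.mem_maximal_iff[OF m ac] a by (intro Jy) auto
    then show "a \<otimes>\<^bsub>R\<^esub> (e m \<otimes>\<^bsub>R\<^esub> ?y) = \<zero>\<^bsub>R\<^esub>" using ac sys.idem_closed[OF m] y by (simp add: R.m_assoc)
  qed
  then have "(\<Oplus>\<^bsub>R\<^esub>m\<in>F. e m \<otimes>\<^bsub>R\<^esub> ?y) \<in> soc"
    by (intro R.finsum_mem soc_subgroup) auto
  moreover have ecF: "e \<in> F \<rightarrow> carrier R" using sys.idem_closed by auto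
  then have "(\<Oplus>\<^bsub>R\<^esub>m\<in>F. e m \<otimes>\<^bsub>R\<^esub> ?y) = (\<Oplus>\<^bsub>R\<^esub>m\<in>F. e m) \<otimes>\<^bsub>R\<^esub> ?y"
    using sys.finite_maximal y(2) by (intro R.finsum_ldistr[symmetric])
  moreover have "(\<one>\<^bsub>R\<^esub> \<ominus>\<^bsub>R\<^esub> (\<Oplus>\<^bsub>R\<^esub>m\<in>F. e m)) \<otimes>\<^bsub>R\<^esub> ?y = \<zero>\<^bsub>R\<^esub>" by (rule Jy[OF sys.sum_idem])
  then have "?y \<ominus>\<^bsub>R\<^esub> (\<Oplus>\<^bsub>R\<^esub>m\<in>F. e m) \<otimes>\<^bsub>R\<^esub> ?y = \<zero>\<^bsub>R\<^esub>"
    using y R.finsum_closed[OF ecF] by (simp add: a_minus_def R.l_distr R.l_minus)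
  then have "?y = (\<Oplus>\<^bsub>R\<^esub>m\<in>F. e m) \<otimes>\<^bsub>R\<^esub> ?y"
    using y R.finsum_closed[OF ecF] by simp
  ultimately show "?y \<in> soc" by simp
qed

lemma soc_iff: "x \<in> soc \<longleftrightarrow> x \<in> carrier R \<and> (\<forall>j\<in>J. j \<otimes>\<^bsub>R\<^esub> x = \<zero>\<^bsub>R\<^esub>)"
proof
  assume x: "x \<in> soc"
  then obtain F y where F: "finite F" "\<forall>I\<in>F. minimal_left I \<and> y I \<in> I" "x = (\<Oplus>\<^bsub>R\<^esub>I\<in>F. y I)"
    by (auto simp: gr_soc_def)
  have yc: "y \<in> F \<rightarrow> carrier R" using F left_ideal_subset minimal_left_ideal by blast
  have "j \<otimes>\<^bsub>R\<^esub> x = \<zero>\<^bsub>R\<^esub>" if j: "j \<in> J" for j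
  proof -
    have "j \<otimes>\<^bsub>R\<^esub> x = (\<Oplus>\<^bsub>R\<^esub>I\<in>F. j \<otimes>\<^bsub>R\<^esub> y I)"
      unfolding F(3) using F(1) jacobson_closed[OF j] yc by (rule R.finsum_rdistr)
    also have "\<dots> = \<zero>\<^bsub>R\<^esub>"
      using F(2) jacobson_annihilates_minimal[OF _ _ j] by (intro R.add.finprod_one_eqI) auto
    finally show ?thesis .
  qed
  then show "x \<in> carrier R \<and> (\<forall>j\<in>J. j \<otimes>\<^bsub>R\<^esub> x = \<zero>\<^bsub>R\<^esub>)"
    using x soc_subgroup by (auto simp: R.additive_subgroup_iff)
next
  assume x: "x \<in> carrier R \<and> (\<forall>j\<in>J. j \<otimes>\<^bsub>R\<^esub> x = \<zero>\<^bsub>R\<^esub>)"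
  then show "x \<in> soc"
    using grd.mem_by_components[OF soc_subgroup, of x] component_in_soc by blast
qed

text \<open>Closure under left multiplication uses that \<open>J\<close> is two-sided:
  \<open>j (a x) = (j a) x\<close>.\<close>

lemma left_ideal_soc: "left_ideal soc"
proof -
  have "a \<otimes>\<^bsub>R\<^esub> x \<in> soc" if "a \<in> carrier R" "x \<in> soc" for a x
  proof -
    have "j \<otimes>\<^bsub>R\<^esub> (a \<otimes>\<^bsub>R\<^esub> x) = \<zero>\<^bsub>R\<^esub>" if "j \<in> J" for j
      using \<open>a \<in> carrier R\<close> \<open>x \<in> soc\<close> jacobson_mult_right[OF that] jacobson_closed[OF that]
      by (simp add: soc_iff flip: R.m_assoc)
    then show ?thesis using that by (simp add: soc_iff)
  qed
  then show ?thesis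
    using soc_subgroup component_in_soc by (auto simp: left_ideal_iff soc_iff)
qed

end

section \<open>Homogeneous functionals\<close>

context fd_graded_algebra
begin

lemma comp_smult:
  assumes "c \<in> carrier K" "x \<in> carrier R" "g \<in> carrier G"
  shows "grd.comp (c \<odot>\<^bsub>R\<^esub> x) g = c \<odot>\<^bsub>R\<^esub> grd.comp x g"
proof (rule component_hom[OF grd.direct_sum_decomposition_axioms grd.direct_sum_decomposition_axioms,
      where T = "\<lambda>x. c \<odot>\<^bsub>R\<^esub> x" and \<pi> = "\<lambda>g. g"])
  show "c \<odot>\<^bsub>R\<^esub> x \<in> \<R> i" if "i \<in> carrier G" "x \<in> \<R> i" for i x
    using K.subspace_smult[OF comp_subspace] assms that by simp
qed (use assms in \<open>auto simp: K.smult_r_distr\<close>)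

lemma functional_mult_right:
  assumes "functional K R \<rho>" "r \<in> carrier R"
  shows "functional K R (\<lambda>a. \<rho> (a \<otimes>\<^bsub>R\<^esub> r))"
  using assms(2)
  by (intro K.functionalI)
     (auto simp: R.l_distr smult_mult_left K.functional_closed[OF assms(1)]
       K.functional_add[OF assms(1)] K.functional_smult[OF assms(1)])

lemma functional_mult_left:
  assumes "functional K R \<rho>" "r \<in> carrier R"
  shows "functional K R (\<lambda>a. \<rho> (r \<otimes>\<^bsub>R\<^esub> a))"
  using assms(2)
  by (intro K.functionalI)
     (auto simp: R.r_distr smult_mult_right K.functional_closed[OF assms(1)]
       K.functional_add[OF assms(1)] K.functional_smult[OF assms(1)])

lemma functional_zero_by_components:
  assumes f: "functional K R f" and "x \<in> carrier R"
    and "\<And>h x. h \<in> carrier G \<Longrightarrow> x \<in> \<R> h \<Longrightarrow> f x = \<zero>\<^bsub>K\<^esub>"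
  shows "f x = \<zero>\<^bsub>K\<^esub>"
  using assms(2)
proof (induction x rule: grd.homogeneous_induct)
  case (homogeneous i x)
  then show ?case by (rule assms(3))
qed (simp_all add: K.functional_zero[OF f] K.functional_add[OF f])

definition homogeneous_functional :: "'g \<Rightarrow> ('r \<Rightarrow> 'k) \<Rightarrow> bool" where
  "homogeneous_functional \<sigma> \<rho> \<longleftrightarrow> functional K R \<rho> \<and>
     (\<forall>h\<in>carrier G. h \<noteq> \<sigma> \<longrightarrow> (\<forall>x\<in>\<R> h. \<rho> x = \<zero>\<^bsub>K\<^esub>))"

definition nondegenerate :: "('r \<Rightarrow> 'k) \<Rightarrow> bool" where
  "nondegenerate \<rho> \<longleftrightarrow>
     (\<forall>r\<in>carrier R. (\<forall>a\<in>carrier R. \<rho> (a \<otimes>\<^bsub>R\<^esub> r) = \<zero>\<^bsub>K\<^esub>) \<longrightarrow> r = \<zero>\<^bsub>R\<^esub>)"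

context
  fixes \<sigma> \<rho> assumes \<sigma>: "\<sigma> \<in> carrier G" and \<rho>: "homogeneous_functional \<sigma> \<rho>"
begin

lemma hf_functional: "functional K R \<rho>"
  using \<rho> by (simp add: homogeneous_functional_def)

lemma hf_zero: "h \<in> carrier G \<Longrightarrow> h \<noteq> \<sigma> \<Longrightarrow> x \<in> \<R> h \<Longrightarrow> \<rho> x = \<zero>\<^bsub>K\<^esub>"
  using \<rho> by (simp add: homogeneous_functional_def)

lemma hf_component: "x \<in> carrier R \<Longrightarrow> \<rho> (grd.comp x \<sigma>) = \<rho> x"
proof (induction x rule: grd.homogeneous_induct)
  case zero
  then show ?case using \<sigma> by (simp add: grd.component_zero)
next
  case (add x y)
  then show ?case
    using \<sigma> by (simp add: grd.component_add grd.component_closed K.functional_add[OF hf_functional])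
next
  case (homogeneous h x)
  then show ?case
    using \<sigma> hf_zero[OF homogeneous(1) _ homogeneous(2)]
    by (auto simp: grd.component_homogeneous[OF homogeneous(2,1)] K.functional_zero[OF hf_functional])
qed

text \<open>Since \<open>\<rho>\<close> sees only degree \<open>\<sigma>\<close>, an element
  \<open>a\<close> of degree \<open>h\<close> pairs only with the component of \<open>r\<close> in
  degree \<open>inv h \<otimes> \<sigma>\<close>.\<close>

lemma hf_mult_component:
  assumes h: "h \<in> carrier G" "a \<in> \<R> h" and r: "r \<in> carrier R" and g: "g \<in> carrier G"
  shows "\<rho> (a \<otimes>\<^bsub>R\<^esub> grd.comp r g) = (if h \<otimes>\<^bsub>G\<^esub> g = \<sigma> then \<rho> (a \<otimes>\<^bsub>R\<^esub> r) else \<zero>\<^bsub>K\<^esub>)"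
proof (cases "h \<otimes>\<^bsub>G\<^esub> g = \<sigma>")
  case True
  then show ?thesis
    using comp_mult_left[OF h r g] hf_component[of "a \<otimes>\<^bsub>R\<^esub> r"] grd.summand_closed[OF h] r by simp
next
  case False
  then show ?thesis
    using hf_zero[OF _ False mult_comp[OF h(1) g h(2) grd.component_mem[OF r g]]] h g by simp
qed

text \<open>The homogeneity of \<open>\<rho>\<close> makes the radical of its form graded, so that
  it can be compared with maximal graded left ideals and, if nonzero, contains a minimal
  one.\<close>

lemma left_ideal_radical: "left_ideal {r \<in> carrier R. \<forall>a\<in>carrier R. \<rho> (a \<otimes>\<^bsub>R\<^esub> r) = \<zero>\<^bsub>K\<^esub>}"
proof (rule left_idealI)
  let ?N = "{r \<in> carrier R. \<forall>a\<in>carrier R. \<rho> (a \<otimes>\<^bsub>R\<^esub> r) = \<zero>\<^bsub>K\<^esub>}"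
  show "\<zero>\<^bsub>R\<^esub> \<in> ?N" by (simp add: K.functional_zero[OF hf_functional])
  show "x \<oplus>\<^bsub>R\<^esub> y \<in> ?N" if "x \<in> ?N" "y \<in> ?N" for x y
    using that by (auto simp: R.r_distr K.functional_add[OF hf_functional])
  show "b \<otimes>\<^bsub>R\<^esub> x \<in> ?N" if "b \<in> carrier R" "x \<in> ?N" for b x
    using that by (auto simp flip: R.m_assoc)
  show "grd.comp x g \<in> ?N" if x: "x \<in> ?N" and g: "g \<in> carrier G" for x g
  proof -
    have xc: "x \<in> carrier R" "grd.comp x g \<in> carrier R" using x g by (auto simp: grd.component_closed)
    have "\<rho> (a \<otimes>\<^bsub>R\<^esub> grd.comp x g) = \<zero>\<^bsub>K\<^esub>" if "a \<in> carrier R" for a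
    proof (rule functional_zero_by_components[OF functional_mult_right[OF hf_functional xc(2)] that])
      show "\<rho> (a \<otimes>\<^bsub>R\<^esub> grd.comp x g) = \<zero>\<^bsub>K\<^esub>" if "h \<in> carrier G" "a \<in> \<R> h" for h a
        using hf_mult_component[OF that xc(1) g] x grd.summand_closed[OF that] by auto
    qed
    then show ?thesis using xc by simp
  qed
qed auto

end

context
  fixes \<sigma> \<rho> assumes \<sigma>: "\<sigma> \<in> carrier G" and \<rho>: "homogeneous_functional \<sigma> \<rho>"
    and nd: "nondegenerate \<rho>"
begin

lemma nondegenerate_cancel:
  assumes r: "r \<in> carrier R" "s \<in> carrier R"
    and "\<And>a. a \<in> carrier R \<Longrightarrow> \<rho> (a \<otimes>\<^bsub>R\<^esub> r) = \<rho> (a \<otimes>\<^bsub>R\<^esub> s)"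
  shows "r = s"
proof -
  note f = hf_functional[OF \<sigma> \<rho>]
  have "\<rho> (a \<otimes>\<^bsub>R\<^esub> (r \<ominus>\<^bsub>R\<^esub> s)) = \<zero>\<^bsub>K\<^esub>" if a: "a \<in> carrier R" for a
  proof -
    have "a \<otimes>\<^bsub>R\<^esub> (r \<ominus>\<^bsub>R\<^esub> s) = a \<otimes>\<^bsub>R\<^esub> r \<ominus>\<^bsub>R\<^esub> a \<otimes>\<^bsub>R\<^esub> s"
      using a r by (simp add: a_minus_def R.r_distr R.r_minus)
    then show ?thesis
      using a r assms(3)[OF a] K.functional_closed[OF f]
      by (simp add: K.functional_minus[OF f])
  qed
  then have "r \<ominus>\<^bsub>R\<^esub> s = \<zero>\<^bsub>R\<^esub>" using nd r by (simp add: nondegenerate_def)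
  then show ?thesis using r by simp
qed

text \<open>This is \<open>bilinear_form_represents\<close> with radical zero: the form of
  \<open>\<rho>\<close> identifies \<open>R\<close> with its dual space.\<close>

lemma nondegenerate_represents:
  assumes \<mu>: "functional K R \<mu>"
  obtains r where "r \<in> carrier R" "\<And>a. a \<in> carrier R \<Longrightarrow> \<mu> a = \<rho> (a \<otimes>\<^bsub>R\<^esub> r)"
proof -
  note f = hf_functional[OF \<sigma> \<rho>]
  have z: "subspace K {\<zero>\<^bsub>R\<^esub>} R" by (rule left_ideal_subspace[OF left_ideal_zero_set])
  have "\<exists>r. r \<in> carrier R \<and> (\<forall>a\<in>carrier R. \<mu> a = \<rho> (a \<otimes>\<^bsub>R\<^esub> r))"
  proof (rule K.bilinear_form_represents[OF fin_dim z, where \<beta> = "\<lambda>a s. \<rho> (a \<otimes>\<^bsub>R\<^esub> s)" and \<mu> = \<mu>])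
    show "(\<forall>a\<in>carrier R. \<rho> (a \<otimes>\<^bsub>R\<^esub> s) = \<zero>\<^bsub>K\<^esub>) = (s \<in> {\<zero>\<^bsub>R\<^esub>})" if "s \<in> carrier R" for s
      using nd that K.functional_zero[OF f] by (auto simp: nondegenerate_def)
  qed (use f \<mu> functional_mult_left functional_mult_right in \<open>auto simp: K.functional_zero\<close>)
  then show ?thesis using that by blast
qed

text \<open>If \<open>\<mu>\<close> is concentrated in degree \<open>t\<close>, then the component
  of \<open>r\<close> in degree \<open>inv t \<otimes> \<sigma>\<close> represents
  \<open>\<mu>\<close> too, and nondegeneracy makes the representing element unique.\<close>

lemma representing_element_degree:
  assumes t: "t \<in> carrier G" and \<mu>: "\<And>h a. h \<in> carrier G \<Longrightarrow> h \<noteq> t \<Longrightarrow> a \<in> \<R> h \<Longrightarrow> \<mu> a = \<zero>\<^bsub>K\<^esub>"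
    and r: "r \<in> carrier R" "\<And>a. a \<in> carrier R \<Longrightarrow> \<mu> a = \<rho> (a \<otimes>\<^bsub>R\<^esub> r)"
  shows "r \<in> \<R> (inv\<^bsub>G\<^esub> t \<otimes>\<^bsub>G\<^esub> \<sigma>)"
proof -
  let ?g = "inv\<^bsub>G\<^esub> t \<otimes>\<^bsub>G\<^esub> \<sigma>"
  note f = hf_functional[OF \<sigma> \<rho>]
  have g: "?g \<in> carrier G" using t \<sigma> by simp
  have c: "grd.comp r ?g \<in> carrier R" using r g by (simp add: grd.component_closed)
  have "r = grd.comp r ?g"
  proof (rule nondegenerate_cancel[OF r(1) c])
    fix a assume a: "a \<in> carrier R"
    show "\<rho> (a \<otimes>\<^bsub>R\<^esub> r) = \<rho> (a \<otimes>\<^bsub>R\<^esub> grd.comp r ?g)"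
      using a
    proof (induction a rule: grd.homogeneous_induct)
      case zero
      then show ?case using r c by simp
    next
      case (add x y)
      then show ?case using r c by (simp add: R.l_distr K.functional_add[OF f])
    next
      case (homogeneous h a)
      have "h \<otimes>\<^bsub>G\<^esub> ?g = \<sigma> \<longleftrightarrow> h = t"
      proof
        assume "h \<otimes>\<^bsub>G\<^esub> ?g = \<sigma>"
        then have "(h \<otimes>\<^bsub>G\<^esub> inv\<^bsub>G\<^esub> t) \<otimes>\<^bsub>G\<^esub> \<sigma> = \<sigma>" using homogeneous(1) t \<sigma> by (simp add: G.m_assoc)
        then have "h \<otimes>\<^bsub>G\<^esub> inv\<^bsub>G\<^esub> t = \<one>\<^bsub>G\<^esub>" using homogeneous(1) t \<sigma> by simp
        then show "h = t" using homogeneous(1) t by (metis G.inv_equality G.inv_closed G.inv_inv)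
      qed (use t \<sigma> in \<open>simp flip: G.m_assoc\<close>)
      then show ?case
        using hf_mult_component[OF \<sigma> \<rho> homogeneous r(1) g] \<mu>[OF homogeneous(1) _ homogeneous(2)]
          r(2)[OF grd.summand_closed[OF homogeneous]] by auto
    qed
  qed
  then show ?thesis using grd.component_mem[OF r(1) g] by simp
qed

end

end

section \<open>A functional of degree one whose form has radical \<open>J\<close>\<close>

context idempotent_system
begin

text \<open>The subspace \<open>?B\<close> contains \<open>J\<close> and every homogeneous element
  of degree other than \<open>\<one>\<close>. It does not contain \<open>e m\<close>, which has
  degree \<open>\<one>\<close> and lies outside \<open>m \<supseteq> J\<close>. Separating
  \<open>e m\<close> from \<open>?B\<close> meets all three requirements.\<close>

lemma idem_functional_exists:
  assumes m: "m \<in> F"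
  shows "\<exists>\<nu>. homogeneous_functional \<one>\<^bsub>G\<^esub> \<nu> \<and> (\<forall>j\<in>J. \<nu> j = \<zero>\<^bsub>K\<^esub>) \<and> \<nu> (e m) = \<one>\<^bsub>K\<^esub>"
proof -
  let ?B = "{x \<in> carrier R. grd.comp x \<one>\<^bsub>G\<^esub> \<in> J}"
  note J = left_ideal_jacobson
  have B: "subspace K ?B R"
  proof (rule K.subspaceI)
    show "c \<odot>\<^bsub>R\<^esub> x \<in> ?B" if "c \<in> carrier K" "x \<in> ?B" for c x
      using that K.subspace_smult[OF left_ideal_subspace[OF J]] by (simp add: comp_smult)
  qed (auto simp: grd.component_zero grd.component_add left_ideal_zero[OF J] left_ideal_add[OF J])
  have "J \<subseteq> m" using Inter_maximal m by blast
  then have "e m \<notin> J" using idem_notin[OF m] by blast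
  then have "e m \<notin> ?B"
    using grd.component_homogeneous[OF idem_homogeneous[OF m], of "\<one>\<^bsub>G\<^esub>"] by simp
  then obtain \<nu> where \<nu>: "functional K R \<nu>" "\<And>x. x \<in> ?B \<Longrightarrow> \<nu> x = \<zero>\<^bsub>K\<^esub>" "\<nu> (e m) = \<one>\<^bsub>K\<^esub>"
    using K.functional_separating[OF B idem_closed[OF m]] by blast
  have "\<nu> x = \<zero>\<^bsub>K\<^esub>" if "h \<in> carrier G" "h \<noteq> \<one>\<^bsub>G\<^esub>" "x \<in> \<R> h" for h x
    using that grd.component_homogeneous[OF that(3,1), of "\<one>\<^bsub>G\<^esub>"] left_ideal_zero[OF J]
      grd.summand_closed[OF that(1,3)] by (intro \<nu>(2)) auto
  moreover have "\<nu> j = \<zero>\<^bsub>K\<^esub>" if "j \<in> J" for j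
    using that left_ideal_comp[OF J that] jacobson_closed by (intro \<nu>(2)) auto
  ultimately show ?thesis using \<nu> by (auto simp: homogeneous_functional_def)
qed

text \<open>If \<open>\<tau>\<close> is the sum of the functionals \<open>b \<mapsto> \<nu> m (e m b e m)\<close>, then orthogonality gives
  \<open>\<tau> (e m a r) = \<nu> m (e m a r e m)\<close>, and the elements \<open>r\<close> for which this vanishes for all \<open>a\<close> form a
  proper graded left ideal containing \<open>m\<close>, hence \<open>m\<close> itself.\<close>

lemma semisimple_functional_exists:
  "\<exists>\<tau>. homogeneous_functional \<one>\<^bsub>G\<^esub> \<tau> \<and>
     (\<forall>r\<in>carrier R. (\<forall>a\<in>carrier R. \<tau> (a \<otimes>\<^bsub>R\<^esub> r) = \<zero>\<^bsub>K\<^esub>) \<longleftrightarrow> r \<in> J)"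
proof -
  obtain \<nu> where "\<forall>m\<in>F. homogeneous_functional \<one>\<^bsub>G\<^esub> (\<nu> m) \<and> (\<forall>j\<in>J. \<nu> m j = \<zero>\<^bsub>K\<^esub>) \<and> \<nu> m (e m) = \<one>\<^bsub>K\<^esub>"
    using bchoice[of F "\<lambda>m \<nu>. homogeneous_functional \<one>\<^bsub>G\<^esub> \<nu> \<and> (\<forall>j\<in>J. \<nu> j = \<zero>\<^bsub>K\<^esub>) \<and> \<nu> (e m) = \<one>\<^bsub>K\<^esub>"]
      idem_functional_exists by blast
  then have \<nu>: "\<And>m. m \<in> F \<Longrightarrow> homogeneous_functional \<one>\<^bsub>G\<^esub> (\<nu> m)"
    and \<nu>J: "\<And>m j. m \<in> F \<Longrightarrow> j \<in> J \<Longrightarrow> \<nu> m j = \<zero>\<^bsub>K\<^esub>"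
    and \<nu>e: "\<And>m. m \<in> F \<Longrightarrow> \<nu> m (e m) = \<one>\<^bsub>K\<^esub>"
    by simp_all
  note \<nu>f = hf_functional[OF G.one_closed \<nu>]
  note [simp] = idem_closed
  note J = left_ideal_jacobson
  define \<phi> where "\<phi> m b = \<nu> m (e m \<otimes>\<^bsub>R\<^esub> b \<otimes>\<^bsub>R\<^esub> e m)" for m b
  have \<phi>f: "functional K R (\<phi> m)" if "m \<in> F" for m
  proof -
    have "\<phi> m = (\<lambda>b. \<nu> m (e m \<otimes>\<^bsub>R\<^esub> b \<otimes>\<^bsub>R\<^esub> e m))" by (simp add: \<phi>_def fun_eq_iff)
    then show ?thesis
      using functional_mult_left[OF functional_mult_right[OF \<nu>f[OF that] idem_closed[OF that]] idem_closed[OF that]]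
      by simp
  qed
  have \<phi>h: "\<phi> m b = \<zero>\<^bsub>K\<^esub>" if "m \<in> F" "h \<in> carrier G" "h \<noteq> \<one>\<^bsub>G\<^esub>" "b \<in> \<R> h" for m h b
    unfolding \<phi>_def
  proof (rule hf_zero[OF G.one_closed \<nu>[OF that(1)] that(2,3)])
    have "e m \<otimes>\<^bsub>R\<^esub> b \<otimes>\<^bsub>R\<^esub> e m \<in> \<R> (\<one>\<^bsub>G\<^esub> \<otimes>\<^bsub>G\<^esub> h \<otimes>\<^bsub>G\<^esub> \<one>\<^bsub>G\<^esub>)"
      using that idem_homogeneous by (intro mult_comp) auto
    then show "e m \<otimes>\<^bsub>R\<^esub> b \<otimes>\<^bsub>R\<^esub> e m \<in> \<R> h" using that by simp
  qed
  have \<phi>J: "\<phi> m j = \<zero>\<^bsub>K\<^esub>" if "m \<in> F" "j \<in> J" for m j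
    unfolding \<phi>_def using that
    by (intro \<nu>J jacobson_mult_right[OF left_ideal_mult[OF J]]) auto
  have \<phi>c: "\<phi> m b \<in> carrier K" if "m \<in> F" "b \<in> carrier R" for m b
    using K.functional_closed[OF \<phi>f] that by simp
  define \<tau> where "\<tau> b = (\<Oplus>\<^bsub>K\<^esub>m\<in>F. \<phi> m b)" for b
  have \<tau>0: "\<tau> b = \<zero>\<^bsub>K\<^esub>" if "\<And>m. m \<in> F \<Longrightarrow> \<phi> m b = \<zero>\<^bsub>K\<^esub>" for b
    unfolding \<tau>_def using that by (intro K.R.add.finprod_one_eqI)
  have \<tau>f: "functional K R \<tau>"
  proof (rule K.functionalI)
    show "\<tau> x \<in> carrier K" if "x \<in> carrier R" for x
      unfolding \<tau>_def using that \<phi>c by (intro K.R.finsum_closed) auto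
    show "\<tau> (x \<oplus>\<^bsub>R\<^esub> y) = \<tau> x \<oplus>\<^bsub>K\<^esub> \<tau> y" if "x \<in> carrier R" "y \<in> carrier R" for x y
    proof -
      have "\<tau> (x \<oplus>\<^bsub>R\<^esub> y) = (\<Oplus>\<^bsub>K\<^esub>m\<in>F. \<phi> m x \<oplus>\<^bsub>K\<^esub> \<phi> m y)"
        unfolding \<tau>_def using that \<phi>c
        by (intro K.R.finsum_cong') (auto simp: K.functional_add[OF \<phi>f])
      also have "\<dots> = \<tau> x \<oplus>\<^bsub>K\<^esub> \<tau> y"
        unfolding \<tau>_def using that \<phi>c by (intro K.R.finsum_addf) auto
      finally show ?thesis .
    qed
    show "\<tau> (c \<odot>\<^bsub>R\<^esub> x) = c \<otimes>\<^bsub>K\<^esub> \<tau> x" if "c \<in> carrier K" "x \<in> carrier R" for c x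
    proof -
      have "\<tau> (c \<odot>\<^bsub>R\<^esub> x) = (\<Oplus>\<^bsub>K\<^esub>m\<in>F. c \<otimes>\<^bsub>K\<^esub> \<phi> m x)"
        unfolding \<tau>_def using that \<phi>c
        by (intro K.R.finsum_cong') (auto simp: K.functional_smult[OF \<phi>f])
      also have "\<dots> = c \<otimes>\<^bsub>K\<^esub> \<tau> x"
        unfolding \<tau>_def using that \<phi>c finite_maximal by (intro K.R.finsum_rdistr[symmetric]) auto
      finally show ?thesis .
    qed
  qed
  have hf: "homogeneous_functional \<one>\<^bsub>G\<^esub> \<tau>"
    using \<tau>f \<tau>0 \<phi>h by (auto simp: homogeneous_functional_def)
  moreover have "\<tau> (a \<otimes>\<^bsub>R\<^esub> r) = \<zero>\<^bsub>K\<^esub>" if "r \<in> J" "a \<in> carrier R" for a r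
    using that left_ideal_mult[OF J] \<phi>J by (intro \<tau>0) auto
  moreover have "r \<in> J" if r: "r \<in> carrier R" and 0: "\<forall>a\<in>carrier R. \<tau> (a \<otimes>\<^bsub>R\<^esub> r) = \<zero>\<^bsub>K\<^esub>" for r
  proof -
    have "r \<in> m" if m: "m \<in> F" for m
    proof -
      define \<psi> where "\<psi> b = \<nu> m (e m \<otimes>\<^bsub>R\<^esub> b \<otimes>\<^bsub>R\<^esub> e m)" for b
      have "\<psi> = \<phi> m" by (simp add: \<psi>_def \<phi>_def fun_eq_iff)
      then have \<psi>f: "functional K R \<psi>" using \<phi>f[OF m] by simp
      have \<psi>h: "homogeneous_functional \<one>\<^bsub>G\<^esub> \<psi>"
        using \<psi>f \<phi>h[OF m] by (auto simp: homogeneous_functional_def \<psi>_def \<phi>_def)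
      let ?X = "{x \<in> carrier R. \<forall>a\<in>carrier R. \<psi> (a \<otimes>\<^bsub>R\<^esub> x) = \<zero>\<^bsub>K\<^esub>}"
      have X: "left_ideal ?X" by (rule left_ideal_radical[OF G.one_closed \<psi>h])
      have "m \<subseteq> ?X"
      proof
        fix x assume x: "x \<in> m"
        then have xc: "x \<in> carrier R" using left_ideal_subset[OF maximal_left_ideal[OF maximal[OF m]]] by auto
        have "x \<otimes>\<^bsub>R\<^esub> e m \<in> J" using mem_maximal_iff[OF m xc] x by simp
        then have "e m \<otimes>\<^bsub>R\<^esub> a \<otimes>\<^bsub>R\<^esub> (x \<otimes>\<^bsub>R\<^esub> e m) \<in> J" if "a \<in> carrier R" for a
          using that m left_ideal_mult[OF J] by simp
        then have "e m \<otimes>\<^bsub>R\<^esub> (a \<otimes>\<^bsub>R\<^esub> x) \<otimes>\<^bsub>R\<^esub> e m \<in> J" if "a \<in> carrier R" for a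
          using that m xc by (simp add: R.m_assoc)
        then show "x \<in> ?X" using xc \<nu>J[OF m] by (simp add: \<psi>_def)
      qed
      \<comment> \<open>The identity is not in \<open>?X\<close>: at the identity
        \<open>\<psi>\<close> takes the value of \<open>\<nu> m\<close> at
        \<open>e m \<otimes> e m\<close>, which equals \<open>\<nu> m (e m) = 1\<close> since the
        two arguments agree modulo \<open>J\<close>.\<close>
      moreover have "?X \<noteq> carrier R"
      proof
        assume "?X = carrier R"
        then have "\<psi> (\<one>\<^bsub>R\<^esub> \<otimes>\<^bsub>R\<^esub> \<one>\<^bsub>R\<^esub>) = \<zero>\<^bsub>K\<^esub>" using R.one_closed by blast
        then have z: "\<nu> m (e m \<otimes>\<^bsub>R\<^esub> e m) = \<zero>\<^bsub>K\<^esub>" using m by (simp add: \<psi>_def)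
        have "\<nu> m (e m \<ominus>\<^bsub>R\<^esub> e m \<otimes>\<^bsub>R\<^esub> e m) = \<zero>\<^bsub>K\<^esub>" by (rule \<nu>J[OF m idem[OF m]])
        then have "\<one>\<^bsub>K\<^esub> \<ominus>\<^bsub>K\<^esub> \<zero>\<^bsub>K\<^esub> = \<zero>\<^bsub>K\<^esub>"
          using m z \<nu>e[OF m] by (simp add: K.functional_minus[OF \<nu>f[OF m]])
        then show False by simp
      qed
      ultimately have Xm: "?X = m" using maximal_left_eq[OF maximal[OF m] X] by blast
      have "\<psi> (a \<otimes>\<^bsub>R\<^esub> r) = \<zero>\<^bsub>K\<^esub>" if a: "a \<in> carrier R" for a
      proof -
        let ?b = "e m \<otimes>\<^bsub>R\<^esub> a \<otimes>\<^bsub>R\<^esub> r"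
        have bc: "?b \<in> carrier R" using a r m by simp
        have other: "\<phi> m' ?b = \<zero>\<^bsub>K\<^esub>" if m': "m' \<in> F" "m' \<noteq> m" for m'
        proof -
          \<comment> \<open>The product from the orthogonality relation stands at the left end, so
            \<open>J\<close> has to absorb the remaining factors on its right.\<close>
          have "e m' \<otimes>\<^bsub>R\<^esub> e m \<otimes>\<^bsub>R\<^esub> (a \<otimes>\<^bsub>R\<^esub> r \<otimes>\<^bsub>R\<^esub> e m') \<in> J"
            using a r m m' by (intro jacobson_mult_right[OF idem_orthogonal[OF m'(1) m m'(2)]]) simp
          then have "e m' \<otimes>\<^bsub>R\<^esub> ?b \<otimes>\<^bsub>R\<^esub> e m' \<in> J" using a r m m' by (simp add: R.m_assoc)
          then show ?thesis unfolding \<phi>_def by (rule \<nu>J[OF m'(1)])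
        qed
        have "\<tau> ?b = \<phi> m ?b"
        proof -
          have "\<tau> ?b = (\<Oplus>\<^bsub>K\<^esub>m'\<in>{m}. \<phi> m' ?b)"
            unfolding \<tau>_def using finite_maximal m bc \<phi>c other
            by (intro K.R.add.finprod_mono_neutral_cong_right) auto
          then show ?thesis using \<phi>c[OF m bc] by simp
        qed
        moreover have "\<tau> ?b = \<zero>\<^bsub>K\<^esub>" using bspec[OF 0, of "e m \<otimes>\<^bsub>R\<^esub> a"] a m by simp
        ultimately have z: "\<phi> m ?b = \<zero>\<^bsub>K\<^esub>" by simp
        \<comment> \<open>The argument of \<open>\<phi> m\<close> at \<open>?b\<close> begins with
          the doubled factor \<open>e m \<otimes> e m\<close>. Idempotence modulo \<open>J\<close>
          replaces it by \<open>e m\<close>, because the difference \<open>?d \<otimes> ?w\<close>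
          lies in \<open>J\<close> and is invisible to \<open>\<nu> m\<close>.\<close>
        let ?d = "e m \<ominus>\<^bsub>R\<^esub> e m \<otimes>\<^bsub>R\<^esub> e m" and ?w = "a \<otimes>\<^bsub>R\<^esub> r \<otimes>\<^bsub>R\<^esub> e m"
        have "?d \<otimes>\<^bsub>R\<^esub> ?w = e m \<otimes>\<^bsub>R\<^esub> (a \<otimes>\<^bsub>R\<^esub> r) \<otimes>\<^bsub>R\<^esub> e m \<ominus>\<^bsub>R\<^esub> e m \<otimes>\<^bsub>R\<^esub> ?b \<otimes>\<^bsub>R\<^esub> e m"
          using a r m by (simp add: a_minus_def R.l_distr R.l_minus R.m_assoc)
        moreover have "?d \<otimes>\<^bsub>R\<^esub> ?w \<in> J" using a r m by (intro jacobson_mult_right[OF idem]) auto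
        ultimately have "\<nu> m (e m \<otimes>\<^bsub>R\<^esub> (a \<otimes>\<^bsub>R\<^esub> r) \<otimes>\<^bsub>R\<^esub> e m \<ominus>\<^bsub>R\<^esub> e m \<otimes>\<^bsub>R\<^esub> ?b \<otimes>\<^bsub>R\<^esub> e m) = \<zero>\<^bsub>K\<^esub>"
          using \<nu>J[OF m] by simp
        then have "\<psi> (a \<otimes>\<^bsub>R\<^esub> r) \<ominus>\<^bsub>K\<^esub> \<phi> m ?b = \<zero>\<^bsub>K\<^esub>"
          using a r m bc by (simp add: K.functional_minus[OF \<nu>f[OF m]] \<psi>_def \<phi>_def)
        then show ?thesis
          using z K.functional_closed[OF \<psi>f, of "a \<otimes>\<^bsub>R\<^esub> r"] a r by simp
      qed
      then have "r \<in> ?X" using r by simp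
      then show "r \<in> m" using Xm by simp
    qed
    then show "r \<in> J" using r Inter_maximal by auto
  qed
  ultimately show ?thesis by (intro exI[of _ \<tau>] conjI ballI iffI) auto
qed

end

section \<open>Frobenius algebras via functionals\<close>

context fd_graded_algebra
begin

lemma frobenius_algebra_iff:
  assumes \<sigma>: "\<sigma> \<in> carrier G"
  shows "graded_frobenius_algebra G K R \<R> \<sigma> \<longleftrightarrow>
    (\<exists>\<rho>. homogeneous_functional \<sigma> \<rho> \<and> nondegenerate \<rho>)"
proof
  assume "graded_frobenius_algebra G K R \<R> \<sigma>"
  then obtain \<phi> where \<phi>: "\<phi> \<in> module_hom R (regular_module R) (dual_module K R)"
    "\<And>g. g \<in> carrier G \<Longrightarrow> \<phi> ` gr_shift G \<sigma> \<R> g \<subseteq> dual_grading G K R \<R> g"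
    "bij_betw \<phi> (carrier R) (carrier (dual_module K R))"
    by (auto simp: graded_frobenius_algebra_def gr_isomorphic_def gr_hom_def)
  define \<rho> where "\<rho> = \<phi> \<one>\<^bsub>R\<^esub>"
  have \<phi>_eq: "\<phi> r = (\<lambda>b\<in>carrier R. \<rho> (b \<otimes>\<^bsub>R\<^esub> r))" if "r \<in> carrier R" for r
    using module_hom_smult[OF \<phi>(1), of r "\<one>\<^bsub>R\<^esub>"] that by (simp add: \<rho>_def dual_module_def)
  \<comment> \<open>The identity has degree \<open>\<one>\<close> in \<open>R\<close>, hence degree
    \<open>inv \<sigma>\<close> in the shifted grading. In that degree the dual consists of the
    functionals concentrated in degree \<open>\<sigma>\<close>.\<close>
  have "\<rho> \<in> dual_grading G K R \<R> (inv\<^bsub>G\<^esub> \<sigma>)"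
    using \<phi>(2)[of "inv\<^bsub>G\<^esub> \<sigma>"] \<sigma> one_homogeneous by (auto simp: \<rho>_def gr_shift_def)
  then have "homogeneous_functional \<sigma> \<rho>"
    using \<sigma> by (auto simp: dual_grading_def homogeneous_functional_def dual_module_def)
  moreover have "nondegenerate \<rho>"
    unfolding nondegenerate_def
  proof (intro ballI impI)
    fix r assume r: "r \<in> carrier R" "\<forall>a\<in>carrier R. \<rho> (a \<otimes>\<^bsub>R\<^esub> r) = \<zero>\<^bsub>K\<^esub>"
    have f: "functional K R \<rho>" using \<open>homogeneous_functional \<sigma> \<rho>\<close> by (simp add: homogeneous_functional_def)
    have "\<phi> r = \<phi> \<zero>\<^bsub>R\<^esub>"
      using r K.functional_zero[OF f] by (auto simp: \<phi>_eq restrict_def fun_eq_iff)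
    then show "r = \<zero>\<^bsub>R\<^esub>" using \<phi>(3) r(1) by (auto simp: bij_betw_def dest: inj_onD)
  qed
  ultimately show "\<exists>\<rho>. homogeneous_functional \<sigma> \<rho> \<and> nondegenerate \<rho>" by blast
next
  assume "\<exists>\<rho>. homogeneous_functional \<sigma> \<rho> \<and> nondegenerate \<rho>"
  then obtain \<rho> where \<rho>: "homogeneous_functional \<sigma> \<rho>" "nondegenerate \<rho>" by blast
  note f = hf_functional[OF \<sigma> \<rho>(1)]
  define \<phi> where "\<phi> r = (\<lambda>b\<in>carrier R. \<rho> (b \<otimes>\<^bsub>R\<^esub> r))" for r
  have \<phi>_dual: "\<phi> r \<in> carrier (dual_module K R)" if r: "r \<in> carrier R" for r
  proof -
    have "functional K R (\<phi> r)"
      using functional_mult_right[OF f r] by (auto simp: module_hom_def \<phi>_def)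
    then show ?thesis by (simp add: dual_module_def \<phi>_def)
  qed
  have "\<phi> \<in> module_hom R (regular_module R) (dual_module K R)"
    unfolding module_hom_def mem_Collect_eq
  proof (intro conjI allI impI funcsetI)
    fix x y assume "x \<in> carrier (regular_module R) \<and> y \<in> carrier (regular_module R)"
    then show "\<phi> (x \<oplus>\<^bsub>regular_module R\<^esub> y) = \<phi> x \<oplus>\<^bsub>dual_module K R\<^esub> \<phi> y"
      by (auto simp: \<phi>_def dual_module_def R.r_distr K.functional_add[OF f] intro!: restrict_ext)
  next
    fix a x assume "a \<in> carrier R \<and> x \<in> carrier (regular_module R)"
    then show "\<phi> (a \<odot>\<^bsub>regular_module R\<^esub> x) = a \<odot>\<^bsub>dual_module K R\<^esub> \<phi> x"
      by (auto simp: \<phi>_def dual_module_def R.m_assoc intro!: restrict_ext)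
  qed (simp add: \<phi>_dual)
  moreover have "\<phi> r \<in> dual_grading G K R \<R> g" if g: "g \<in> carrier G" and r: "r \<in> gr_shift G \<sigma> \<R> g" for g r
  proof -
    have r': "r \<in> \<R> (g \<otimes>\<^bsub>G\<^esub> \<sigma>)" using r by (simp add: gr_shift_def)
    have rc: "r \<in> carrier R" using grd.summand_closed[OF _ r'] g \<sigma> by simp
    have "\<phi> r x = \<zero>\<^bsub>K\<^esub>" if h: "h \<in> carrier G" "h \<noteq> inv\<^bsub>G\<^esub> g" and x: "x \<in> \<R> h" for h x
    proof -
      \<comment> \<open>The product has degree \<open>h \<otimes> g \<otimes> \<sigma>\<close>,
        which is \<open>\<sigma>\<close> only for \<open>h = inv g\<close>. This is the inverse in
        the definition of the dual grading.\<close>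
      have "x \<otimes>\<^bsub>R\<^esub> r \<in> \<R> (h \<otimes>\<^bsub>G\<^esub> (g \<otimes>\<^bsub>G\<^esub> \<sigma>))" using h g \<sigma> x r' by (intro mult_comp) auto
      moreover have "h \<otimes>\<^bsub>G\<^esub> (g \<otimes>\<^bsub>G\<^esub> \<sigma>) \<noteq> \<sigma>"
      proof
        assume "h \<otimes>\<^bsub>G\<^esub> (g \<otimes>\<^bsub>G\<^esub> \<sigma>) = \<sigma>"
        then have "(h \<otimes>\<^bsub>G\<^esub> g) \<otimes>\<^bsub>G\<^esub> \<sigma> = \<sigma>" using h g \<sigma> by (simp add: G.m_assoc)
        then have "h \<otimes>\<^bsub>G\<^esub> g = \<one>\<^bsub>G\<^esub>" using h g \<sigma> by simp
        then show False using h g G.inv_equality by simp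
      qed
      ultimately have "\<rho> (x \<otimes>\<^bsub>R\<^esub> r) = \<zero>\<^bsub>K\<^esub>" using h g \<sigma> by (intro hf_zero[OF \<sigma> \<rho>(1)]) auto
      then show ?thesis using grd.summand_closed[OF h(1) x] by (simp add: \<phi>_def)
    qed
    then show ?thesis using \<phi>_dual[OF rc] by (auto simp: dual_grading_def)
  qed
  moreover have "bij_betw \<phi> (carrier R) (carrier (dual_module K R))"
    unfolding bij_betw_def
  proof
    show "inj_on \<phi> (carrier R)"
    proof (rule inj_onI)
      fix r s assume rs: "r \<in> carrier R" "s \<in> carrier R" "\<phi> r = \<phi> s"
      show "r = s"
      proof (rule nondegenerate_cancel[OF \<sigma> \<rho> rs(1,2)])
        show "\<rho> (a \<otimes>\<^bsub>R\<^esub> r) = \<rho> (a \<otimes>\<^bsub>R\<^esub> s)" if "a \<in> carrier R" for a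
          using fun_cong[OF rs(3), of a] that by (simp add: \<phi>_def)
      qed
    qed
    show "\<phi> ` carrier R = carrier (dual_module K R)"
    proof
      show "\<phi> ` carrier R \<subseteq> carrier (dual_module K R)" using \<phi>_dual by auto
      show "carrier (dual_module K R) \<subseteq> \<phi> ` carrier R"
      proof
        fix \<mu> assume "\<mu> \<in> carrier (dual_module K R)"
        then have \<mu>: "functional K R \<mu>" "\<mu> \<in> extensional (carrier R)" by (auto simp: dual_module_def)
        obtain r where r: "r \<in> carrier R" "\<And>a. a \<in> carrier R \<Longrightarrow> \<mu> a = \<rho> (a \<otimes>\<^bsub>R\<^esub> r)"
          using nondegenerate_represents[OF \<sigma> \<rho> \<mu>(1)] by blast
        have "\<mu> = \<phi> r"
          by (rule extensionalityI[OF \<mu>(2)]) (auto simp: \<phi>_def r(2))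
        then show "\<mu> \<in> \<phi> ` carrier R" using r(1) by blast
      qed
    qed
  qed
  ultimately show "graded_frobenius_algebra G K R \<R> \<sigma>"
    by (auto simp: graded_frobenius_algebra_def gr_isomorphic_def gr_hom_def image_subset_iff)
qed

section \<open>The socle condition\<close>

lemma jacobson_coset_mem:
  "u \<in> J +>\<^bsub>regular_module R\<^esub> s \<longleftrightarrow> (\<exists>j\<in>J. u = j \<oplus>\<^bsub>R\<^esub> s)"
  by (auto simp: a_r_coset_def')

lemma jacobson_coset_mem_iff:
  assumes "u \<in> carrier R" "s \<in> carrier R"
  shows "u \<in> J +>\<^bsub>regular_module R\<^esub> s \<longleftrightarrow> u \<ominus>\<^bsub>R\<^esub> s \<in> J"
proof
  assume "u \<in> J +>\<^bsub>regular_module R\<^esub> s"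
  then obtain j where j: "j \<in> J" "u = j \<oplus>\<^bsub>R\<^esub> s" unfolding jacobson_coset_mem by blast
  then have "u \<ominus>\<^bsub>R\<^esub> s = j"
    using assms jacobson_closed[OF j(1)] by (simp add: a_minus_def R.a_assoc R.r_neg)
  then show "u \<ominus>\<^bsub>R\<^esub> s \<in> J" using j by simp
next
  assume "u \<ominus>\<^bsub>R\<^esub> s \<in> J"
  moreover have "u = (u \<ominus>\<^bsub>R\<^esub> s) \<oplus>\<^bsub>R\<^esub> s" using assms by (simp add: a_minus_def R.a_assoc R.l_neg)
  ultimately show "u \<in> J +>\<^bsub>regular_module R\<^esub> s" unfolding jacobson_coset_mem by blast
qed

lemma jacobson_coset_closed:
  "s \<in> carrier R \<Longrightarrow> u \<in> J +>\<^bsub>regular_module R\<^esub> s \<Longrightarrow> u \<in> carrier R"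
  unfolding jacobson_coset_mem using jacobson_closed by auto

lemma jacobson_coset_eqI:
  assumes "s \<in> carrier R" "t \<in> carrier R" "s \<ominus>\<^bsub>R\<^esub> t \<in> J"
  shows "J +>\<^bsub>regular_module R\<^esub> s = J +>\<^bsub>regular_module R\<^esub> t"
proof (rule Set.set_eqI)
  fix u
  show "u \<in> J +>\<^bsub>regular_module R\<^esub> s \<longleftrightarrow> u \<in> J +>\<^bsub>regular_module R\<^esub> t"
  proof (cases "u \<in> carrier R")
    case True
    have 1: "u \<ominus>\<^bsub>R\<^esub> t = (u \<ominus>\<^bsub>R\<^esub> s) \<oplus>\<^bsub>R\<^esub> (s \<ominus>\<^bsub>R\<^esub> t)"
      using True assms by (simp add: a_minus_def R.a_assoc R.r_neg1)
    have 2: "u \<ominus>\<^bsub>R\<^esub> s = (u \<ominus>\<^bsub>R\<^esub> t) \<ominus>\<^bsub>R\<^esub> (s \<ominus>\<^bsub>R\<^esub> t)"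
      using True assms by (simp add: a_minus_def R.a_assoc R.minus_add R.r_neg1 R.r_neg2 R.a_comm[of "\<ominus>\<^bsub>R\<^esub> s"])
    show ?thesis
      unfolding jacobson_coset_mem_iff[OF True assms(1)] jacobson_coset_mem_iff[OF True assms(2)]
      using left_ideal_add[OF left_ideal_jacobson _ assms(3)]
        left_ideal_minus[OF left_ideal_jacobson _ assms(3)] 1 2 by metis
  next
    case False
    then show ?thesis using jacobson_coset_closed assms by blast
  qed
qed

lemma jacobson_cosets:
  "a_rcosets\<^bsub>regular_module R\<^esub> J = (\<lambda>s. J +>\<^bsub>regular_module R\<^esub> s) ` carrier R"
  by (auto simp: A_RCOSETS_def')

abbreviation socle_top_isomorphic :: "'g \<Rightarrow> bool" where
  "socle_top_isomorphic \<sigma> \<equiv>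
     gr_isomorphic G R ((regular_module R)\<lparr>carrier := soc\<rparr>) (gr_shift G \<sigma> (\<lambda>g. soc \<inter> \<R> g))
       (quotient_module R (regular_module R) J) (quotient_grading (regular_module R) J \<R>)"

lemma socle_top_isomorphic_of_nondegenerate:
  assumes \<sigma>: "\<sigma> \<in> carrier G" and \<rho>: "homogeneous_functional \<sigma> \<rho>" "nondegenerate \<rho>"
  shows "socle_top_isomorphic \<sigma>"
proof -
  note f = hf_functional[OF \<sigma> \<rho>(1)]
  note J = left_ideal_jacobson
  obtain F e where "idempotent_system G K R \<R> F e" using idempotent_system_exists by blast
  then interpret sys: idempotent_system G K R \<R> F e .
  obtain \<tau> where \<tau>: "homogeneous_functional \<one>\<^bsub>G\<^esub> \<tau>"
    and \<tau>J: "\<And>r. r \<in> carrier R \<Longrightarrow> (\<forall>a\<in>carrier R. \<tau> (a \<otimes>\<^bsub>R\<^esub> r) = \<zero>\<^bsub>K\<^esub>) \<longleftrightarrow> r \<in> J"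
    using sys.semisimple_functional_exists by blast
  note \<tau>f = hf_functional[OF G.one_closed \<tau>]
  obtain x0 where x0: "x0 \<in> carrier R" "\<And>a. a \<in> carrier R \<Longrightarrow> \<tau> a = \<rho> (a \<otimes>\<^bsub>R\<^esub> x0)"
    using nondegenerate_represents[OF \<sigma> \<rho> \<tau>f] by blast
  have "x0 \<in> \<R> (inv\<^bsub>G\<^esub> \<one>\<^bsub>G\<^esub> \<otimes>\<^bsub>G\<^esub> \<sigma>)"
    by (rule representing_element_degree[OF \<sigma> \<rho> G.one_closed hf_zero[OF G.one_closed \<tau>] x0])
  then have x0d: "x0 \<in> \<R> \<sigma>" using \<sigma> by simp
  \<comment> \<open>Since \<open>\<tau> (a s) = \<rho> (a s x0)\<close> and \<open>\<rho>\<close> is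
    nondegenerate, \<open>s x0 = 0\<close> means that \<open>s\<close> lies in the radical of the
    form of \<open>\<tau>\<close>, which is \<open>J\<close>.\<close>
  have ann: "s \<otimes>\<^bsub>R\<^esub> x0 = \<zero>\<^bsub>R\<^esub> \<longleftrightarrow> s \<in> J" if s: "s \<in> carrier R" for s
  proof -
    have "s \<otimes>\<^bsub>R\<^esub> x0 = \<zero>\<^bsub>R\<^esub> \<longleftrightarrow> (\<forall>a\<in>carrier R. \<rho> (a \<otimes>\<^bsub>R\<^esub> (s \<otimes>\<^bsub>R\<^esub> x0)) = \<zero>\<^bsub>K\<^esub>)"
      using \<rho>(2) s x0(1) K.functional_zero[OF f] by (auto simp: nondegenerate_def)
    also have "\<dots> \<longleftrightarrow> (\<forall>a\<in>carrier R. \<tau> (a \<otimes>\<^bsub>R\<^esub> s) = \<zero>\<^bsub>K\<^esub>)"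
      using s x0 by (simp add: R.m_assoc)
    finally show ?thesis using \<tau>J[OF s] by simp
  qed
  have image_soc: "s \<otimes>\<^bsub>R\<^esub> x0 \<in> soc" if s: "s \<in> carrier R" for s
  proof -
    have "j \<otimes>\<^bsub>R\<^esub> (s \<otimes>\<^bsub>R\<^esub> x0) = \<zero>\<^bsub>R\<^esub>" if "j \<in> J" for j
      using ann[of "j \<otimes>\<^bsub>R\<^esub> s"] jacobson_mult_right[OF that s] jacobson_closed[OF that] s x0
      by (simp add: R.m_assoc)
    then show ?thesis using s x0 by (simp add: soc_iff)
  qed
  \<comment> \<open>For \<open>x\<close> in the socle the functional \<open>\<rho> (_ x)\<close>
    vanishes on \<open>J\<close>, so the form of \<open>\<tau>\<close> represents it:
    \<open>\<rho> (a x) = \<tau> (a s) = \<rho> (a s x0)\<close> for some \<open>s\<close>.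
    Nondegeneracy cancels \<open>a\<close>.\<close>
  have soc_image: "\<exists>s\<in>carrier R. x = s \<otimes>\<^bsub>R\<^esub> x0" if x: "x \<in> soc" for x
  proof -
    have xc: "x \<in> carrier R" using x by (simp add: soc_iff)
    have "\<exists>s. s \<in> carrier R \<and> (\<forall>a\<in>carrier R. \<rho> (a \<otimes>\<^bsub>R\<^esub> x) = \<tau> (a \<otimes>\<^bsub>R\<^esub> s))"
    proof (rule K.bilinear_form_represents[OF fin_dim left_ideal_subspace[OF J],
          where \<beta> = "\<lambda>a s. \<tau> (a \<otimes>\<^bsub>R\<^esub> s)" and \<mu> = "\<lambda>a. \<rho> (a \<otimes>\<^bsub>R\<^esub> x)"])
      show "\<tau> (a \<otimes>\<^bsub>R\<^esub> s) = \<zero>\<^bsub>K\<^esub>" if "a \<in> J" "s \<in> carrier R" for a s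
      proof -
        have "a \<otimes>\<^bsub>R\<^esub> s \<in> J" by (rule jacobson_mult_right[OF that])
        then show ?thesis using \<tau>J[of "a \<otimes>\<^bsub>R\<^esub> s"] that jacobson_closed
          by (metis R.l_one R.one_closed)
      qed
      show "\<rho> (a \<otimes>\<^bsub>R\<^esub> x) = \<zero>\<^bsub>K\<^esub>" if "a \<in> J" for a
        using that x K.functional_zero[OF f] by (simp add: soc_iff)
    qed (use functional_mult_left[OF \<tau>f] functional_mult_right[OF \<tau>f] functional_mult_right[OF f xc] \<tau>J in auto)
    then obtain s where s: "s \<in> carrier R" "\<And>a. a \<in> carrier R \<Longrightarrow> \<rho> (a \<otimes>\<^bsub>R\<^esub> x) = \<tau> (a \<otimes>\<^bsub>R\<^esub> s)" by blast
    have "x = s \<otimes>\<^bsub>R\<^esub> x0"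
      using s xc x0 by (intro nondegenerate_cancel[OF \<sigma> \<rho>]) (auto simp: R.m_assoc)
    then show ?thesis using s(1) by blast
  qed
  \<comment> \<open>The isomorphism is given in the direction from the socle to the quotient: the
    fibre of \<open>s \<mapsto> s x0\<close> over \<open>x\<close> is itself the required coset, so
    no representative has to be chosen.\<close>
  define \<theta> where "\<theta> x = {s \<in> carrier R. s \<otimes>\<^bsub>R\<^esub> x0 = x}" for x
  have \<theta>_coset: "\<theta> (s \<otimes>\<^bsub>R\<^esub> x0) = J +>\<^bsub>regular_module R\<^esub> s" if s: "s \<in> carrier R" for s
  proof (rule Set.set_eqI)
    fix u
    show "u \<in> \<theta> (s \<otimes>\<^bsub>R\<^esub> x0) \<longleftrightarrow> u \<in> J +>\<^bsub>regular_module R\<^esub> s"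
    proof (cases "u \<in> carrier R")
      case True
      have "(u \<ominus>\<^bsub>R\<^esub> s) \<otimes>\<^bsub>R\<^esub> x0 = u \<otimes>\<^bsub>R\<^esub> x0 \<ominus>\<^bsub>R\<^esub> s \<otimes>\<^bsub>R\<^esub> x0"
        using True s x0 by (simp add: a_minus_def R.l_distr R.l_minus)
      then have "u \<otimes>\<^bsub>R\<^esub> x0 = s \<otimes>\<^bsub>R\<^esub> x0 \<longleftrightarrow> (u \<ominus>\<^bsub>R\<^esub> s) \<otimes>\<^bsub>R\<^esub> x0 = \<zero>\<^bsub>R\<^esub>"
        using True s x0 by simp
      then show ?thesis
        using ann[of "u \<ominus>\<^bsub>R\<^esub> s"] True s by (simp add: \<theta>_def jacobson_coset_mem_iff)
    next
      case False
      then show ?thesis using jacobson_coset_closed[OF s] by (auto simp: \<theta>_def)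
    qed
  qed
  let ?Q = "quotient_module R (regular_module R) J" and ?S = "(regular_module R)\<lparr>carrier := soc\<rparr>"
  have "\<theta> \<in> module_hom R ?S ?Q"
    unfolding module_hom_def mem_Collect_eq
  proof (intro conjI allI impI funcsetI)
    fix x assume "x \<in> carrier ?S"
    then obtain s where "s \<in> carrier R" "x = s \<otimes>\<^bsub>R\<^esub> x0" using soc_image by auto
    then show "\<theta> x \<in> carrier ?Q" using \<theta>_coset by (auto simp: quotient_module_def jacobson_cosets)
  next
    fix x y assume "x \<in> carrier ?S \<and> y \<in> carrier ?S"
    then have xy: "x \<in> soc" "y \<in> soc" by simp_all
    obtain s where s: "s \<in> carrier R" "x = s \<otimes>\<^bsub>R\<^esub> x0" using soc_image[OF xy(1)] by blast
    obtain t where t: "t \<in> carrier R" "y = t \<otimes>\<^bsub>R\<^esub> x0" using soc_image[OF xy(2)] by blast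
    note st = s t
    have "u \<in> \<theta> (x \<oplus>\<^bsub>R\<^esub> y) \<longleftrightarrow> (\<exists>a\<in>\<theta> x. \<exists>b\<in>\<theta> y. u = a \<oplus>\<^bsub>R\<^esub> b)" for u
    proof
      assume u: "u \<in> \<theta> (x \<oplus>\<^bsub>R\<^esub> y)"
      then have uc: "u \<in> carrier R" "u \<otimes>\<^bsub>R\<^esub> x0 = s \<otimes>\<^bsub>R\<^esub> x0 \<oplus>\<^bsub>R\<^esub> t \<otimes>\<^bsub>R\<^esub> x0"
        using st by (simp_all add: \<theta>_def)
      have "(u \<ominus>\<^bsub>R\<^esub> s) \<otimes>\<^bsub>R\<^esub> x0 = u \<otimes>\<^bsub>R\<^esub> x0 \<ominus>\<^bsub>R\<^esub> s \<otimes>\<^bsub>R\<^esub> x0"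
        using uc(1) st x0 by (simp add: a_minus_def R.l_distr R.l_minus)
      also have "\<dots> = t \<otimes>\<^bsub>R\<^esub> x0"
        unfolding uc(2) using st x0
        by (simp add: a_minus_def R.a_comm[of "s \<otimes>\<^bsub>R\<^esub> x0"] R.a_assoc R.r_neg)
      finally have "u \<ominus>\<^bsub>R\<^esub> s \<in> \<theta> y" using uc(1) st by (simp add: \<theta>_def)
      moreover have "s \<in> \<theta> x" using st by (simp add: \<theta>_def)
      moreover have "u = s \<oplus>\<^bsub>R\<^esub> (u \<ominus>\<^bsub>R\<^esub> s)"
        using uc(1) st(1) by (simp add: a_minus_def R.a_lcomm[of s] R.r_neg)
      ultimately show "\<exists>a\<in>\<theta> x. \<exists>b\<in>\<theta> y. u = a \<oplus>\<^bsub>R\<^esub> b" by blast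
    qed (use x0 in \<open>auto simp: \<theta>_def R.l_distr\<close>)
    then show "\<theta> (x \<oplus>\<^bsub>?S\<^esub> y) = \<theta> x \<oplus>\<^bsub>?Q\<^esub> \<theta> y"
      by (auto simp: quotient_module_def set_add_def set_mult_def)
  next
    fix a x assume "a \<in> carrier R \<and> x \<in> carrier ?S"
    then have a: "a \<in> carrier R" and x: "x \<in> soc" by simp_all
    obtain s where s: "s \<in> carrier R" "x = s \<otimes>\<^bsub>R\<^esub> x0" using soc_image[OF x] by blast
    \<comment> \<open>Scalar multiplication in the quotient is a union over all representatives
      \<open>t\<close>, and each of them contributes the same coset.\<close>
    have "J +>\<^bsub>regular_module R\<^esub> (a \<otimes>\<^bsub>R\<^esub> t) = \<theta> (a \<otimes>\<^bsub>R\<^esub> x)" if "t \<in> \<theta> x" for t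
      using \<theta>_coset[of "a \<otimes>\<^bsub>R\<^esub> t"] that a s x0 by (auto simp: \<theta>_def R.m_assoc)
    moreover have "s \<in> \<theta> x" using s by (simp add: \<theta>_def)
    ultimately show "\<theta> (a \<odot>\<^bsub>?S\<^esub> x) = a \<odot>\<^bsub>?Q\<^esub> \<theta> x"
      by (auto simp: quotient_module_def)
  qed
  moreover have "\<theta> x \<in> quotient_grading (regular_module R) J \<R> g"
    if g: "g \<in> carrier G" and x: "x \<in> gr_shift G \<sigma> (\<lambda>g. soc \<inter> \<R> g) g" for g x
  proof -
    have x': "x \<in> soc" "x \<in> \<R> (g \<otimes>\<^bsub>G\<^esub> \<sigma>)" using x by (auto simp: gr_shift_def)
    obtain s where s: "s \<in> carrier R" "x = s \<otimes>\<^bsub>R\<^esub> x0" using soc_image[OF x'(1)] by blast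
    \<comment> \<open>The preimage \<open>s\<close> need not be homogeneous. Its component in degree
      \<open>g\<close> is still a preimage, because \<open>x\<close> has degree
      \<open>g \<otimes> \<sigma>\<close> and \<open>x0\<close> has degree
      \<open>\<sigma>\<close>.\<close>
    have "grd.comp s g \<otimes>\<^bsub>R\<^esub> x0 = grd.comp x (g \<otimes>\<^bsub>G\<^esub> \<sigma>)"
      using comp_mult_right[OF \<sigma> x0d s(1) g] s(2) by simp
    also have "\<dots> = x" using grd.component_homogeneous[OF x'(2)] g \<sigma> by simp
    finally have "\<theta> x = J +>\<^bsub>regular_module R\<^esub> grd.comp s g"
      using \<theta>_coset[of "grd.comp s g"] s g by (simp add: grd.component_closed)
    then show ?thesis using s g grd.component_mem by (auto simp: quotient_grading_def)
  qed
  moreover have "bij_betw \<theta> soc (a_rcosets\<^bsub>regular_module R\<^esub> J)"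
    unfolding bij_betw_def
  proof
    show "inj_on \<theta> soc"
    proof (rule inj_onI)
      fix x y assume xy: "x \<in> soc" "y \<in> soc" "\<theta> x = \<theta> y"
      obtain s where s: "s \<in> carrier R" "x = s \<otimes>\<^bsub>R\<^esub> x0" using soc_image[OF xy(1)] by blast
      then have "s \<in> \<theta> y" using xy(3) by (auto simp: \<theta>_def)
      then show "x = y" using s by (simp add: \<theta>_def)
    qed
    show "\<theta> ` soc = a_rcosets\<^bsub>regular_module R\<^esub> J"
      unfolding jacobson_cosets
    proof
      show "\<theta> ` soc \<subseteq> (\<lambda>s. J +>\<^bsub>regular_module R\<^esub> s) ` carrier R"
        using soc_image \<theta>_coset by blast
      show "(\<lambda>s. J +>\<^bsub>regular_module R\<^esub> s) ` carrier R \<subseteq> \<theta> ` soc"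
        using image_soc \<theta>_coset by (auto intro!: image_eqI[where x = "_ \<otimes>\<^bsub>R\<^esub> x0"])
    qed
  qed
  ultimately show ?thesis
    by (auto simp: gr_isomorphic_def gr_hom_def image_subset_iff quotient_module_def intro!: bexI[of _ \<theta>])
qed

lemma nondegenerate_of_socle_top_isomorphic:
  assumes \<sigma>: "\<sigma> \<in> carrier G" and iso: "socle_top_isomorphic \<sigma>"
  shows "\<exists>\<rho>. homogeneous_functional \<sigma> \<rho> \<and> nondegenerate \<rho>"
proof -
  note J = left_ideal_jacobson
  let ?Q = "quotient_module R (regular_module R) J" and ?S = "(regular_module R)\<lparr>carrier := soc\<rparr>"
  obtain \<theta> where \<theta>: "\<theta> \<in> module_hom R ?S ?Q"
    "\<And>g. g \<in> carrier G \<Longrightarrow> \<theta> ` gr_shift G \<sigma> (\<lambda>g. soc \<inter> \<R> g) g \<subseteq> quotient_grading (regular_module R) J \<R> g"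
    "bij_betw \<theta> soc (a_rcosets\<^bsub>regular_module R\<^esub> J)"
    using iso by (auto simp: gr_isomorphic_def gr_hom_def quotient_module_def)
  obtain F e where "idempotent_system G K R \<R> F e" using idempotent_system_exists by blast
  then interpret sys: idempotent_system G K R \<R> F e .
  obtain \<tau> where \<tau>: "homogeneous_functional \<one>\<^bsub>G\<^esub> \<tau>"
    and \<tau>J: "\<And>r. r \<in> carrier R \<Longrightarrow> (\<forall>a\<in>carrier R. \<tau> (a \<otimes>\<^bsub>R\<^esub> r) = \<zero>\<^bsub>K\<^esub>) \<longleftrightarrow> r \<in> J"
    using sys.semisimple_functional_exists by blast
  note \<tau>f = hf_functional[OF G.one_closed \<tau>]
  have \<tau>J0: "\<tau> j = \<zero>\<^bsub>K\<^esub>" if "j \<in> J" for j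
    using \<tau>J[of j] that jacobson_closed[OF that] by (metis R.l_one R.one_closed)
  note socI = left_ideal_soc
  note soc_closed = left_ideal_subset[OF socI, THEN subsetD]
  have \<theta>_coset: "\<theta> x = J +>\<^bsub>regular_module R\<^esub> s \<and> s \<in> carrier R" if xs: "x \<in> soc" "s \<in> \<theta> x" for x s
  proof -
    obtain t where t: "t \<in> carrier R" "\<theta> x = J +>\<^bsub>regular_module R\<^esub> t"
      using bspec[OF bij_betwE[OF \<theta>(3)] xs(1)] unfolding jacobson_cosets by blast
    have s: "s \<in> carrier R" using jacobson_coset_closed[OF t(1)] xs(2) t(2) by simp
    have "s \<ominus>\<^bsub>R\<^esub> t \<in> J" using jacobson_coset_mem_iff[OF s t(1)] xs(2) t(2) by simp
    then show ?thesis using jacobson_coset_eqI[OF s t(1)] t(2) s by simp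
  qed
  have coset_self: "s \<in> J +>\<^bsub>regular_module R\<^esub> s" if "s \<in> carrier R" for s
    using that left_ideal_zero[OF J] by (simp add: jacobson_coset_mem_iff a_minus_def R.r_neg)
  have \<theta>_ex: "\<exists>s. s \<in> \<theta> x" if "x \<in> soc" for x
    using bspec[OF bij_betwE[OF \<theta>(3)] that] coset_self unfolding jacobson_cosets by blast
  have \<theta>_add: "s \<oplus>\<^bsub>R\<^esub> t \<in> \<theta> (x \<oplus>\<^bsub>R\<^esub> y)" if "x \<in> soc" "y \<in> soc" "s \<in> \<theta> x" "t \<in> \<theta> y" for x y s t
    using module_hom_add[OF \<theta>(1), of x y] that
    by (auto simp: quotient_module_def set_add_def set_mult_def)
  have \<theta>_mult: "a \<otimes>\<^bsub>R\<^esub> s \<in> \<theta> (a \<otimes>\<^bsub>R\<^esub> x)" if "a \<in> carrier R" "x \<in> soc" "s \<in> \<theta> x" for a x s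
    using module_hom_smult[OF \<theta>(1), of a x] that coset_self[of "a \<otimes>\<^bsub>R\<^esub> s"] \<theta>_coset[OF that(2,3)]
    by (auto simp: quotient_module_def)
  \<comment> \<open>This is \<open>\<tau>\<close> composed with \<open>\<theta>\<close>. Since
    \<open>\<tau>\<close> kills \<open>J\<close>, the value does not depend on the chosen element of
    the coset, which is the content of \<open>\<mu>_eq\<close>.\<close>
  define \<mu> where "\<mu> x = \<tau> (SOME s. s \<in> \<theta> x)" for x
  have \<mu>_eq: "\<mu> x = \<tau> s" if x: "x \<in> soc" and s: "s \<in> \<theta> x" for x s
  proof -
    let ?t = "SOME s. s \<in> \<theta> x"
    have t: "?t \<in> \<theta> x" using s by (rule someI)
    have c: "?t \<in> carrier R" "s \<in> carrier R" using \<theta>_coset[OF x t] \<theta>_coset[OF x s] by auto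
    have "?t \<ominus>\<^bsub>R\<^esub> s \<in> J" using \<theta>_coset[OF x s] t jacobson_coset_mem_iff[OF c] by simp
    then have "\<tau> ?t \<ominus>\<^bsub>K\<^esub> \<tau> s = \<zero>\<^bsub>K\<^esub>" using \<tau>J0 K.functional_minus[OF \<tau>f c] by metis
    then show ?thesis using K.functional_closed[OF \<tau>f] c by (simp add: \<mu>_def)
  qed
  have \<mu>c: "\<mu> x \<in> carrier K" if "x \<in> soc" for x
    using \<theta>_ex[OF that] \<mu>_eq[OF that] \<theta>_coset[OF that] K.functional_closed[OF \<tau>f] by metis
  have \<mu>_add: "\<mu> (x \<oplus>\<^bsub>R\<^esub> y) = \<mu> x \<oplus>\<^bsub>K\<^esub> \<mu> y" if xy: "x \<in> soc" "y \<in> soc" for x y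
  proof -
    obtain s t where st: "s \<in> \<theta> x" "t \<in> \<theta> y" using \<theta>_ex xy by blast
    have "\<mu> (x \<oplus>\<^bsub>R\<^esub> y) = \<tau> (s \<oplus>\<^bsub>R\<^esub> t)"
      by (rule \<mu>_eq[OF left_ideal_add[OF socI xy] \<theta>_add[OF xy st]])
    then show ?thesis
      using \<mu>_eq xy st \<theta>_coset[OF xy(1) st(1)] \<theta>_coset[OF xy(2) st(2)] K.functional_add[OF \<tau>f] by simp
  qed
  have \<mu>_smult: "\<mu> (c \<odot>\<^bsub>R\<^esub> x) = c \<otimes>\<^bsub>K\<^esub> \<mu> x" if c: "c \<in> carrier K" and x: "x \<in> soc" for c x
  proof -
    obtain s where s: "s \<in> \<theta> x" using \<theta>_ex x by blast
    then have sc: "s \<in> carrier R" using \<theta>_coset[OF x] by blast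
    \<comment> \<open>The map \<open>\<theta>\<close> is given as \<open>R\<close>-linear, and
      \<open>K\<close>-linearity is obtained from the scalars
      \<open>c \<odot> \<one>\<close>.\<close>
    have "(c \<odot>\<^bsub>R\<^esub> \<one>\<^bsub>R\<^esub>) \<otimes>\<^bsub>R\<^esub> s \<in> \<theta> ((c \<odot>\<^bsub>R\<^esub> \<one>\<^bsub>R\<^esub>) \<otimes>\<^bsub>R\<^esub> x)" using c x s by (intro \<theta>_mult) auto
    then have "c \<odot>\<^bsub>R\<^esub> s \<in> \<theta> (c \<odot>\<^bsub>R\<^esub> x)" using c sc soc_closed[OF x] by (simp add: smult_mult_left)
    then have "\<mu> (c \<odot>\<^bsub>R\<^esub> x) = \<tau> (c \<odot>\<^bsub>R\<^esub> s)"
      using c x by (intro \<mu>_eq K.subspace_smult[OF left_ideal_subspace[OF socI]])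
    then show ?thesis using \<mu>_eq[OF x s] c sc K.functional_smult[OF \<tau>f] by simp
  qed
  have \<mu>_neg: "\<mu> (\<ominus>\<^bsub>R\<^esub> x) = \<ominus>\<^bsub>K\<^esub> \<mu> x" if x: "x \<in> soc" for x
    using \<mu>_smult[OF K.R.a_inv_closed[OF K.R.one_closed] x] \<mu>c[OF x] soc_closed[OF x]
    by (simp add: K.smult_minus_1 K.R.l_minus)
  \<comment> \<open>An element of degree \<open>h\<close> has degree
    \<open>h \<otimes> inv \<sigma>\<close> in the shifted socle, so \<open>\<theta> x\<close> has a
    representative of that degree, where \<open>\<tau>\<close> vanishes unless
    \<open>h = \<sigma>\<close>.\<close>
  have \<mu>_degree: "\<mu> x = \<zero>\<^bsub>K\<^esub>" if x: "x \<in> soc" "x \<in> \<R> h" and h: "h \<in> carrier G" "h \<noteq> \<sigma>" for x h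
  proof -
    let ?g = "h \<otimes>\<^bsub>G\<^esub> inv\<^bsub>G\<^esub> \<sigma>"
    have g: "?g \<in> carrier G" "?g \<otimes>\<^bsub>G\<^esub> \<sigma> = h" using h \<sigma> by (simp_all add: G.m_assoc)
    then have "?g \<noteq> \<one>\<^bsub>G\<^esub>" using h \<sigma> by auto
    have "x \<in> gr_shift G \<sigma> (\<lambda>g. soc \<inter> \<R> g) ?g" using x g by (simp add: gr_shift_def)
    then have "\<theta> x \<in> quotient_grading (regular_module R) J \<R> ?g" using \<theta>(2)[OF g(1)] by blast
    then obtain s where s: "s \<in> \<R> ?g" "\<theta> x = J +>\<^bsub>regular_module R\<^esub> s" by (auto simp: quotient_grading_def)
    then have "\<mu> x = \<tau> s"
      using coset_self[OF grd.summand_closed[OF g(1) s(1)]] by (intro \<mu>_eq[OF x(1)]) simp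
    then show ?thesis using hf_zero[OF G.one_closed \<tau> g(1) \<open>?g \<noteq> _\<close> s(1)] by simp
  qed
  \<comment> \<open>A functional that kills \<open>?Z\<close> is homogeneous of degree
    \<open>\<sigma>\<close>. The prescription is compatible with \<open>\<mu>\<close> because the
    socle contains the components of its elements.\<close>
  let ?Z = "{x \<in> carrier R. grd.comp x \<sigma> = \<zero>\<^bsub>R\<^esub>}"
  have Z: "subspace K ?Z R"
    by (rule K.subspaceI) (use \<sigma> in \<open>auto simp: grd.component_zero grd.component_add comp_smult\<close>)
  have \<mu>Z: "\<mu> x = \<zero>\<^bsub>K\<^esub>" if x: "x \<in> soc" "x \<in> ?Z" for x
  proof -
    let ?H = "{x \<in> soc. \<mu> x = \<zero>\<^bsub>K\<^esub>}"
    have \<mu>0: "\<mu> \<zero>\<^bsub>R\<^esub> = \<zero>\<^bsub>K\<^esub>"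
      using \<mu>_smult[OF K.R.zero_closed left_ideal_zero[OF socI]] \<mu>c[OF left_ideal_zero[OF socI]]
      by (simp add: K.lmult_0)
    have "x \<in> ?H"
    proof (rule grd.mem_by_components)
      show "additive_subgroup ?H R"
        using \<mu>0 soc_closed left_ideal_zero[OF socI] left_ideal_add[OF socI] left_ideal_neg[OF socI]
        by (auto simp: R.additive_subgroup_iff \<mu>_add \<mu>_neg)
      fix h assume h: "h \<in> carrier G"
      have "\<mu> (grd.comp x h) = \<zero>\<^bsub>K\<^esub>"
        using x h \<mu>0 \<mu>_degree[OF left_ideal_comp[OF socI x(1) h] grd.component_mem[OF soc_closed[OF x(1)] h] h]
        by (cases "h = \<sigma>") auto
      then show "grd.comp x h \<in> ?H" using left_ideal_comp[OF socI x(1) h] by simp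
    qed (use x in simp)
    then show ?thesis by simp
  qed
  obtain \<rho> where \<rho>: "functional K R \<rho>" "\<And>x. x \<in> soc \<Longrightarrow> \<rho> x = \<mu> x" "\<And>x. x \<in> ?Z \<Longrightarrow> \<rho> x = \<zero>\<^bsub>K\<^esub>"
    using K.functional_extension[OF left_ideal_subspace[OF socI] Z \<mu>c \<mu>_add \<mu>_smult \<mu>Z] by blast
  have "\<rho> x = \<zero>\<^bsub>K\<^esub>" if "h \<in> carrier G" "h \<noteq> \<sigma>" "x \<in> \<R> h" for h x
    using that grd.component_homogeneous[OF that(3,1) \<sigma>] grd.summand_closed[OF that(1,3)]
    by (intro \<rho>(3)) auto
  then have hf: "homogeneous_functional \<sigma> \<rho>" using \<rho>(1) by (auto simp: homogeneous_functional_def)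
  have "nondegenerate \<rho>"
  proof (rule ccontr)
    let ?N = "{r \<in> carrier R. \<forall>a\<in>carrier R. \<rho> (a \<otimes>\<^bsub>R\<^esub> r) = \<zero>\<^bsub>K\<^esub>}"
    assume "\<not> nondegenerate \<rho>"
    then have "?N \<noteq> {\<zero>\<^bsub>R\<^esub>}" by (auto simp: nondegenerate_def)
    then obtain I where I: "minimal_left I" "I \<subseteq> ?N"
      using minimal_left_exists[OF left_ideal_radical[OF \<sigma> hf]] by blast
    \<comment> \<open>The minimal ideal lies in the socle, where \<open>\<rho>\<close> is known: a
      representative \<open>s\<close> of \<open>\<theta> x\<close> satisfies
      \<open>\<tau> (a s) = \<rho> (a x) = 0\<close> for all \<open>a\<close>, so \<open>s\<close>
      is in \<open>J\<close>. Then \<open>\<theta> x = \<theta> \<zero>\<close>, and injectivity of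
      \<open>\<theta>\<close> gives \<open>x = \<zero>\<close>.\<close>
    have "x = \<zero>\<^bsub>R\<^esub>" if "x \<in> I" for x
    proof -
      have x: "x \<in> soc" "x \<in> ?N" using that I minimal_subset_soc by auto
      obtain s where s: "s \<in> \<theta> x" using \<theta>_ex x by blast
      have sc: "s \<in> carrier R" and \<theta>x: "\<theta> x = J +>\<^bsub>regular_module R\<^esub> s" using \<theta>_coset[OF x(1) s] by auto
      have "\<tau> (a \<otimes>\<^bsub>R\<^esub> s) = \<zero>\<^bsub>K\<^esub>" if a: "a \<in> carrier R" for a
      proof -
        have "\<tau> (a \<otimes>\<^bsub>R\<^esub> s) = \<mu> (a \<otimes>\<^bsub>R\<^esub> x)"
          using \<mu>_eq[OF left_ideal_mult[OF socI a x(1)] \<theta>_mult[OF a x(1) s]] by simp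
        also have "\<dots> = \<rho> (a \<otimes>\<^bsub>R\<^esub> x)" using \<rho>(2)[OF left_ideal_mult[OF socI a x(1)]] by simp
        finally show ?thesis using x(2) a by simp
      qed
      then have "s \<in> J" using \<tau>J[OF sc] by blast
      have z: "\<zero>\<^bsub>R\<^esub> \<in> soc" by (rule left_ideal_zero[OF socI])
      have "\<zero>\<^bsub>R\<^esub> \<otimes>\<^bsub>R\<^esub> s \<in> \<theta> (\<zero>\<^bsub>R\<^esub> \<otimes>\<^bsub>R\<^esub> x)" by (rule \<theta>_mult[OF R.zero_closed x(1) s])
      then have "\<zero>\<^bsub>R\<^esub> \<in> \<theta> \<zero>\<^bsub>R\<^esub>" using sc soc_closed[OF x(1)] by simp
      then have "\<theta> \<zero>\<^bsub>R\<^esub> = J +>\<^bsub>regular_module R\<^esub> \<zero>\<^bsub>R\<^esub>" using \<theta>_coset[OF z] by blast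
      also have "\<dots> = J +>\<^bsub>regular_module R\<^esub> s"
        using \<open>s \<in> J\<close> sc left_ideal_neg[OF J] by (intro jacobson_coset_eqI) (auto simp: a_minus_def)
      finally have "\<theta> x = \<theta> \<zero>\<^bsub>R\<^esub>" using \<theta>x by simp
      then show ?thesis using \<theta>(3) x(1) z by (auto simp: bij_betw_def dest: inj_onD)
    qed
    then have "I = {\<zero>\<^bsub>R\<^esub>}" using left_ideal_zero[OF minimal_left_ideal[OF I(1)]] by blast
    then show False using minimal_left_nonzero[OF I(1)] by simp
  qed
  then show ?thesis using hf by blast
qed

end

section \<open>Injectivity\<close>

text \<open>Restriction along \<open>c \<mapsto> c \<odot> \<one>\<close>, which opens the vector
  space lemmas to modules over \<open>R\<close>.\<close>

definition restrict_scalars ::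
    "('k, 'r, 'a) module_scheme \<Rightarrow> ('r, 'm, 'b) module_scheme \<Rightarrow> ('k, 'm) module" where
  "restrict_scalars R N =
     \<lparr>carrier = carrier N, monoid.mult = undefined, one = undefined, zero = zero N, add = add N,
      smult = (\<lambda>c y. (c \<odot>\<^bsub>R\<^esub> \<one>\<^bsub>R\<^esub>) \<odot>\<^bsub>N\<^esub> y)\<rparr>"

lemma restrict_scalars_simps [simp]:
  "carrier (restrict_scalars R N) = carrier N"
  "zero (restrict_scalars R N) = zero N"
  "add (restrict_scalars R N) = add N"
  "smult (restrict_scalars R N) = (\<lambda>c y. (c \<odot>\<^bsub>R\<^esub> \<one>\<^bsub>R\<^esub>) \<odot>\<^bsub>N\<^esub> y)"
  by (simp_all add: restrict_scalars_def)

lemma (in graded_module) module_decomposition: "direct_sum_decomposition M (carrier G) \<M>"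
  by unfold_locales (rule module_direct_sum)

context fd_graded_algebra
begin

lemma vectorspace_restrict_scalars:
  assumes "left_module R N"
  shows "vectorspace K (restrict_scalars R N)"
proof -
  interpret N: left_module R N by fact
  have "abelian_group (restrict_scalars R N)"
  proof (rule abelian_groupI)
    show "\<exists>y\<in>carrier (restrict_scalars R N).
        y \<oplus>\<^bsub>restrict_scalars R N\<^esub> x = \<zero>\<^bsub>restrict_scalars R N\<^esub>"
      if "x \<in> carrier (restrict_scalars R N)" for x
      using that N.M.l_neg by (intro bexI[of _ "\<ominus>\<^bsub>N\<^esub> x"]) auto
  qed (auto simp: N.M.a_assoc intro: N.M.a_comm)
  moreover have "((c \<otimes>\<^bsub>K\<^esub> d) \<odot>\<^bsub>R\<^esub> \<one>\<^bsub>R\<^esub>) = (c \<odot>\<^bsub>R\<^esub> \<one>\<^bsub>R\<^esub>) \<otimes>\<^bsub>R\<^esub> (d \<odot>\<^bsub>R\<^esub> \<one>\<^bsub>R\<^esub>)"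
    if "c \<in> carrier K" "d \<in> carrier K" for c d
    using that by (simp add: smult_mult_left K.smult_assoc1)
  ultimately show ?thesis
    by (intro vectorspace.intro module.intro module_axioms.intro)
       (auto simp: N.smult_closed N.smult_l_distr N.smult_r_distr N.smult_one K.smult_l_distr
         simp flip: N.smult_assoc1 intro: K.R.is_cring K.field_axioms)
qed

lemma scalar_homogeneous: "c \<in> carrier K \<Longrightarrow> c \<odot>\<^bsub>R\<^esub> \<one>\<^bsub>R\<^esub> \<in> \<R> \<one>\<^bsub>G\<^esub>"
  using K.subspace_smult[OF comp_subspace[OF G.one_closed]] one_homogeneous by simp

text \<open>Composition with \<open>\<rho>\<close> turns \<open>R\<close>-linear maps from
  \<open>N\<close> to \<open>R\<close> into functionals on \<open>N\<close>. The way back sends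
  \<open>\<nu>\<close> to the map taking \<open>y\<close> to the element that represents
  \<open>a \<mapsto> \<nu> (a y)\<close>. Thus only a functional has to be extended from the image
  of \<open>i\<close> to \<open>N\<close>.\<close>

lemma gr_injective_of_nondegenerate:
  assumes \<sigma>: "\<sigma> \<in> carrier G" and \<rho>: "homogeneous_functional \<sigma> \<rho>" "nondegenerate \<rho>"
  shows "gr_injective TYPE('m) G R \<R> (regular_module R) \<R>"
  unfolding gr_injective_def
proof (intro allI impI, elim conjE)
  fix M N :: "('r, 'm) module" and \<M> \<N> i f
  assume M: "graded_module G R \<R> M \<M>" and N: "graded_module G R \<R> N \<N>"
    and i: "i \<in> gr_hom G R M \<M> N \<N>" "inj_on i (carrier M)"
    and f: "f \<in> gr_hom G R M \<M> (regular_module R) \<R>"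
  interpret M: graded_module G R \<R> M \<M> by (rule M)
  interpret N: graded_module G R \<R> N \<N> by (rule N)
  interpret DM: direct_sum_decomposition M "carrier G" \<M> by (rule M.module_decomposition)
  interpret DN: direct_sum_decomposition N "carrier G" \<N> by (rule N.module_decomposition)
  interpret V: vectorspace K "restrict_scalars R N"
    by (rule vectorspace_restrict_scalars) (rule N.left_module_axioms)
  note \<rho>f = hf_functional[OF \<sigma> \<rho>(1)]
  have i_closed: "i x \<in> carrier N" and f_closed: "f x \<in> carrier R" if "x \<in> carrier M" for x
    using i f that by (auto simp: gr_hom_def module_hom_def)
  have i_add: "i (x \<oplus>\<^bsub>M\<^esub> y) = i x \<oplus>\<^bsub>N\<^esub> i y" and f_add: "f (x \<oplus>\<^bsub>M\<^esub> y) = f x \<oplus>\<^bsub>R\<^esub> f y"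
    if "x \<in> carrier M" "y \<in> carrier M" for x y
    using i f that by (auto simp: gr_hom_def module_hom_def)
  have i_smult: "i (a \<odot>\<^bsub>M\<^esub> x) = a \<odot>\<^bsub>N\<^esub> i x" and f_smult: "f (a \<odot>\<^bsub>M\<^esub> x) = a \<otimes>\<^bsub>R\<^esub> f x"
    if "a \<in> carrier R" "x \<in> carrier M" for a x
    using i f that by (auto simp: gr_hom_def module_hom_def)
  have i_degree: "i x \<in> \<N> g" and f_degree: "f x \<in> \<R> g" if "g \<in> carrier G" "x \<in> \<M> g" for x g
    using i(1) f that unfolding gr_hom_def by blast+
  have i_zero: "i \<zero>\<^bsub>M\<^esub> = \<zero>\<^bsub>N\<^esub>"
    using i_add[of "\<zero>\<^bsub>M\<^esub>" "\<zero>\<^bsub>M\<^esub>"] i_closed[of "\<zero>\<^bsub>M\<^esub>"] by simp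
  have f_zero: "f \<zero>\<^bsub>M\<^esub> = \<zero>\<^bsub>R\<^esub>"
    using f_add[of "\<zero>\<^bsub>M\<^esub>" "\<zero>\<^bsub>M\<^esub>"] f_closed[of "\<zero>\<^bsub>M\<^esub>"] by simp
  have i_comp: "DN.comp (i x) \<sigma> = i (DM.comp x \<sigma>)" if "x \<in> carrier M" for x
    using i_closed i_add i_degree \<sigma> that
    by (intro component_hom[OF DM.direct_sum_decomposition_axioms DN.direct_sum_decomposition_axioms,
          where T = i and \<pi> = "\<lambda>g. g"])
       auto
  have f_comp: "grd.comp (f x) \<sigma> = f (DM.comp x \<sigma>)" if "x \<in> carrier M" for x
    using f_closed f_add f_degree \<sigma> that
    by (intro component_hom[OF DM.direct_sum_decomposition_axioms grd.direct_sum_decomposition_axioms,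
          where T = f and \<pi> = "\<lambda>g. g"])
       auto
  have N_comp: "DN.comp (a \<odot>\<^bsub>N\<^esub> y) (h \<otimes>\<^bsub>G\<^esub> g) = a \<odot>\<^bsub>N\<^esub> DN.comp y g"
    if "h \<in> carrier G" "a \<in> \<R> h" "y \<in> carrier N" "g \<in> carrier G" for h a y g
    using that grd.summand_closed[OF that(1,2)]
    by (intro component_hom[OF DN.direct_sum_decomposition_axioms DN.direct_sum_decomposition_axioms])
       (auto simp: N.smult_closed N.smult_r_distr N.smult_comp inj_on_def)
  define \<mu> where "\<mu> y = \<rho> (f (inv_into (carrier M) i y))" for y
  have \<mu>: "\<mu> (i x) = \<rho> (f x)" if "x \<in> carrier M" for x
    using i(2) that by (simp add: \<mu>_def)
  have a_zero: "a \<odot>\<^bsub>N\<^esub> \<zero>\<^bsub>N\<^esub> = \<zero>\<^bsub>N\<^esub>" if "a \<in> carrier R" for a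
    using N.smult_r_distr[OF that, of "\<zero>\<^bsub>N\<^esub>" "\<zero>\<^bsub>N\<^esub>"] N.smult_closed[OF that, of "\<zero>\<^bsub>N\<^esub>"] by simp
  \<comment> \<open>Requiring the extension to vanish on \<open>?Z\<close> is what will make
    \<open>h\<close> preserve degrees.\<close>
  let ?A = "i ` carrier M" and ?Z = "{y \<in> carrier N. DN.comp y \<sigma> = \<zero>\<^bsub>N\<^esub>}"
  have A: "subspace K ?A (restrict_scalars R N)"
  proof (rule V.subspaceI)
    show "\<zero>\<^bsub>restrict_scalars R N\<^esub> \<in> ?A" using i_zero by (intro image_eqI[of _ _ "\<zero>\<^bsub>M\<^esub>"]) auto
    show "x \<oplus>\<^bsub>restrict_scalars R N\<^esub> y \<in> ?A" if "x \<in> ?A" "y \<in> ?A" for x y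
      using that i_add[symmetric] by auto
    show "c \<odot>\<^bsub>restrict_scalars R N\<^esub> x \<in> ?A" if "c \<in> carrier K" "x \<in> ?A" for c x
      using that i_smult[symmetric] M.smult_closed by auto
  qed (use i_closed in auto)
  have Z: "subspace K ?Z (restrict_scalars R N)"
  proof (rule V.subspaceI)
    show "c \<odot>\<^bsub>restrict_scalars R N\<^esub> x \<in> ?Z" if c: "c \<in> carrier K" and x: "x \<in> ?Z" for c x
      using N_comp[OF G.one_closed scalar_homogeneous[OF c], of x \<sigma>] x \<sigma> c a_zero
      by (simp add: N.smult_closed)
  qed (use \<sigma> in \<open>auto simp: DN.component_zero DN.component_add\<close>)
  \<comment> \<open>If \<open>i x\<close> has no component in degree \<open>\<sigma>\<close>, then
    neither has \<open>x\<close>, because \<open>i\<close> is graded and injective. Hence neither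
    has \<open>f x\<close>, and \<open>\<rho>\<close> vanishes on it.\<close>
  have AZ: "\<mu> y = \<zero>\<^bsub>K\<^esub>" if y: "y \<in> ?A" "y \<in> ?Z" for y
  proof -
    obtain x where x: "x \<in> carrier M" "y = i x" using y(1) by blast
    have "i (DM.comp x \<sigma>) = i \<zero>\<^bsub>M\<^esub>" using i_comp[OF x(1)] y(2) x(2) i_zero by simp
    then have "DM.comp x \<sigma> = \<zero>\<^bsub>M\<^esub>"
      using inj_onD[OF i(2)] DM.component_closed[OF x(1) \<sigma>] by simp
    then have "grd.comp (f x) \<sigma> = \<zero>\<^bsub>R\<^esub>" using f_comp[OF x(1)] f_zero by simp
    then show ?thesis
      using hf_component[OF \<sigma> \<rho>(1) f_closed[OF x(1)]] \<mu>[OF x(1)] x(2) K.functional_zero[OF \<rho>f] by simp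
  qed
  obtain \<nu> where \<nu>: "functional K (restrict_scalars R N) \<nu>"
    "\<And>y. y \<in> ?A \<Longrightarrow> \<nu> y = \<mu> y" "\<And>y. y \<in> ?Z \<Longrightarrow> \<nu> y = \<zero>\<^bsub>K\<^esub>"
  proof (rule V.functional_extension[OF A Z, of \<mu>])
    show "\<mu> y \<in> carrier K" if "y \<in> ?A" for y
      using that \<mu> f_closed K.functional_closed[OF \<rho>f] by auto
    show "\<mu> (x \<oplus>\<^bsub>restrict_scalars R N\<^esub> y) = \<mu> x \<oplus>\<^bsub>K\<^esub> \<mu> y" if x: "x \<in> ?A" and y: "y \<in> ?A" for x y
    proof -
      obtain x' where x': "x' \<in> carrier M" "x = i x'" using x by blast
      obtain y' where y': "y' \<in> carrier M" "y = i y'" using y by blast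
      show ?thesis
        using x' y' f_closed \<mu>[of "x' \<oplus>\<^bsub>M\<^esub> y'"] by (simp add: \<mu> f_add i_add K.functional_add[OF \<rho>f])
    qed
    show "\<mu> (c \<odot>\<^bsub>restrict_scalars R N\<^esub> x) = c \<otimes>\<^bsub>K\<^esub> \<mu> x" if c: "c \<in> carrier K" and x: "x \<in> ?A" for c x
    proof -
      obtain x' where x': "x' \<in> carrier M" "x = i x'" using x by blast
      then show ?thesis
        using f_closed c \<mu>[of "(c \<odot>\<^bsub>R\<^esub> \<one>\<^bsub>R\<^esub>) \<odot>\<^bsub>M\<^esub> x'"]
        by (simp add: \<mu> f_smult i_smult M.smult_closed smult_mult_left K.functional_smult[OF \<rho>f])
    qed
  qed (use AZ in auto)
  have \<nu>i: "\<nu> (i x) = \<rho> (f x)" if "x \<in> carrier M" for x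
    using \<nu>(2) \<mu> that by simp
  have \<nu>a: "functional K R (\<lambda>a. \<nu> (a \<odot>\<^bsub>N\<^esub> y))" if y: "y \<in> carrier N" for y
  proof (rule K.functionalI)
    show "\<nu> (a \<odot>\<^bsub>N\<^esub> y) \<in> carrier K" if "a \<in> carrier R" for a
      using V.functional_closed[OF \<nu>(1)] N.smult_closed that y by simp
    show "\<nu> ((a \<oplus>\<^bsub>R\<^esub> b) \<odot>\<^bsub>N\<^esub> y) = \<nu> (a \<odot>\<^bsub>N\<^esub> y) \<oplus>\<^bsub>K\<^esub> \<nu> (b \<odot>\<^bsub>N\<^esub> y)"
      if "a \<in> carrier R" "b \<in> carrier R" for a b
      using V.functional_add[OF \<nu>(1)] that y by (simp add: N.smult_l_distr N.smult_closed)
    show "\<nu> ((c \<odot>\<^bsub>R\<^esub> a) \<odot>\<^bsub>N\<^esub> y) = c \<otimes>\<^bsub>K\<^esub> \<nu> (a \<odot>\<^bsub>N\<^esub> y)" if c: "c \<in> carrier K" and a: "a \<in> carrier R" for c a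
    proof -
      have "(c \<odot>\<^bsub>R\<^esub> a) \<odot>\<^bsub>N\<^esub> y = (c \<odot>\<^bsub>R\<^esub> \<one>\<^bsub>R\<^esub>) \<odot>\<^bsub>N\<^esub> (a \<odot>\<^bsub>N\<^esub> y)"
        using c a y by (simp add: smult_mult_left flip: N.smult_assoc1)
      then show ?thesis
        using V.functional_smult[OF \<nu>(1) c, of "a \<odot>\<^bsub>N\<^esub> y"] a y by (simp add: N.smult_closed)
    qed
  qed
  \<comment> \<open>Nondegeneracy makes the representing element unique (\<open>h_eq\<close>), so
    linearity of \<open>h\<close> can be checked on the represented functionals.\<close>
  define h where "h y = (SOME r. r \<in> carrier R \<and> (\<forall>a\<in>carrier R. \<nu> (a \<odot>\<^bsub>N\<^esub> y) = \<rho> (a \<otimes>\<^bsub>R\<^esub> r)))" for y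
  have h: "h y \<in> carrier R" "a \<in> carrier R \<Longrightarrow> \<nu> (a \<odot>\<^bsub>N\<^esub> y) = \<rho> (a \<otimes>\<^bsub>R\<^esub> h y)"
    if y: "y \<in> carrier N" for y a
  proof -
    have "\<exists>r. r \<in> carrier R \<and> (\<forall>a\<in>carrier R. \<nu> (a \<odot>\<^bsub>N\<^esub> y) = \<rho> (a \<otimes>\<^bsub>R\<^esub> r))"
      by (rule nondegenerate_represents[OF \<sigma> \<rho> \<nu>a[OF y]]) blast
    from someI_ex[OF this] show "h y \<in> carrier R"
      "a \<in> carrier R \<Longrightarrow> \<nu> (a \<odot>\<^bsub>N\<^esub> y) = \<rho> (a \<otimes>\<^bsub>R\<^esub> h y)" unfolding h_def by auto
  qed
  have h_eq: "h y = r" if "y \<in> carrier N" "r \<in> carrier R"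
    and eq: "\<And>a. a \<in> carrier R \<Longrightarrow> \<nu> (a \<odot>\<^bsub>N\<^esub> y) = \<rho> (a \<otimes>\<^bsub>R\<^esub> r)" for y r
  proof (rule nondegenerate_cancel[OF \<sigma> \<rho> h(1)[OF that(1)] that(2)])
    show "\<rho> (a \<otimes>\<^bsub>R\<^esub> h y) = \<rho> (a \<otimes>\<^bsub>R\<^esub> r)" if "a \<in> carrier R" for a
      using h(2)[OF \<open>y \<in> carrier N\<close> that] eq[OF that] by (rule trans[OF sym])
  qed
  have "h \<in> module_hom R N (regular_module R)"
    unfolding module_hom_def mem_Collect_eq
  proof (intro conjI allI impI funcsetI)
    fix y z assume "y \<in> carrier N \<and> z \<in> carrier N"
    then have yz: "y \<in> carrier N" "z \<in> carrier N" by simp_all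
    have "h (y \<oplus>\<^bsub>N\<^esub> z) = h y \<oplus>\<^bsub>R\<^esub> h z"
    proof (rule h_eq)
      fix a assume a: "a \<in> carrier R"
      have "\<nu> (a \<odot>\<^bsub>N\<^esub> (y \<oplus>\<^bsub>N\<^esub> z)) = \<nu> (a \<odot>\<^bsub>N\<^esub> y) \<oplus>\<^bsub>K\<^esub> \<nu> (a \<odot>\<^bsub>N\<^esub> z)"
        using V.functional_add[OF \<nu>(1)] a yz by (simp add: N.smult_r_distr N.smult_closed)
      also have "\<dots> = \<rho> (a \<otimes>\<^bsub>R\<^esub> (h y \<oplus>\<^bsub>R\<^esub> h z))"
        using h yz a by (simp add: R.r_distr K.functional_add[OF \<rho>f])
      finally show "\<nu> (a \<odot>\<^bsub>N\<^esub> (y \<oplus>\<^bsub>N\<^esub> z)) = \<rho> (a \<otimes>\<^bsub>R\<^esub> (h y \<oplus>\<^bsub>R\<^esub> h z))" .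
    qed (use yz h in auto)
    then show "h (y \<oplus>\<^bsub>N\<^esub> z) = h y \<oplus>\<^bsub>regular_module R\<^esub> h z" by simp
  next
    fix b y assume "b \<in> carrier R \<and> y \<in> carrier N"
    then have bN: "b \<in> carrier R" "y \<in> carrier N" by simp_all
    have "h (b \<odot>\<^bsub>N\<^esub> y) = b \<otimes>\<^bsub>R\<^esub> h y"
    proof (rule h_eq)
      fix a assume a: "a \<in> carrier R"
      show "\<nu> (a \<odot>\<^bsub>N\<^esub> (b \<odot>\<^bsub>N\<^esub> y)) = \<rho> (a \<otimes>\<^bsub>R\<^esub> (b \<otimes>\<^bsub>R\<^esub> h y))"
        using h(2)[of y "a \<otimes>\<^bsub>R\<^esub> b"] h(1) a bN by (simp add: N.smult_assoc1 R.m_assoc)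
    qed (use bN h N.smult_closed in auto)
    then show "h (b \<odot>\<^bsub>N\<^esub> y) = b \<odot>\<^bsub>regular_module R\<^esub> h y" by simp
  qed (use h in auto)
  moreover have "h y \<in> \<R> g" if g: "g \<in> carrier G" and y: "y \<in> \<N> g" for g y
  proof -
    \<comment> \<open>For \<open>y\<close> of degree \<open>g\<close>, the functional
      \<open>a \<mapsto> \<nu> (a y)\<close> is concentrated in degree \<open>?t\<close>, so its
      representing element has degree \<open>inv ?t \<otimes> \<sigma> = g\<close>.\<close>
    let ?t = "\<sigma> \<otimes>\<^bsub>G\<^esub> inv\<^bsub>G\<^esub> g"
    have t: "?t \<in> carrier G" using \<sigma> g by simp
    have yc: "y \<in> carrier N" by (rule DN.summand_closed[OF g y])
    have "h y \<in> \<R> (inv\<^bsub>G\<^esub> ?t \<otimes>\<^bsub>G\<^esub> \<sigma>)"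
    proof (rule representing_element_degree[OF \<sigma> \<rho> t _ h[OF yc]])
      fix k a assume k: "k \<in> carrier G" "k \<noteq> ?t" and a: "a \<in> \<R> k"
      have "k \<otimes>\<^bsub>G\<^esub> g \<noteq> \<sigma>" using k g \<sigma> by (auto simp: G.m_assoc)
      moreover have ay: "a \<odot>\<^bsub>N\<^esub> y \<in> \<N> (k \<otimes>\<^bsub>G\<^esub> g)" by (rule N.smult_comp[OF k(1) g a y])
      ultimately have "DN.comp (a \<odot>\<^bsub>N\<^esub> y) \<sigma> = \<zero>\<^bsub>N\<^esub>"
        using DN.component_homogeneous[OF ay _ \<sigma>] k g by auto
      then show "\<nu> (a \<odot>\<^bsub>N\<^esub> y) = \<zero>\<^bsub>K\<^esub>"
        using DN.summand_closed[OF _ ay] k g by (intro \<nu>(3)) auto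
    qed
    moreover have "inv\<^bsub>G\<^esub> ?t \<otimes>\<^bsub>G\<^esub> \<sigma> = g" using \<sigma> g by (simp add: G.inv_mult_group G.m_assoc)
    ultimately show ?thesis by simp
  qed
  \<comment> \<open>Both sides represent the same functional: \<open>\<nu> (a (i x)) = \<nu> (i (a
    x)) = \<rho> (f (a x)) = \<rho> (a (f x))\<close>.\<close>
  moreover have "h (i x) = f x" if x: "x \<in> carrier M" for x
  proof (rule h_eq)
    fix a assume a: "a \<in> carrier R"
    show "\<nu> (a \<odot>\<^bsub>N\<^esub> i x) = \<rho> (a \<otimes>\<^bsub>R\<^esub> f x)"
      using \<nu>i[of "a \<odot>\<^bsub>M\<^esub> x"] a x by (simp add: i_smult f_smult M.smult_closed)
  qed (use x i_closed f_closed in auto)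
  ultimately show "\<exists>h\<in>gr_hom G R N \<N> (regular_module R) \<R>. \<forall>x\<in>carrier M. h (i x) = f x"
    by (intro bexI[of _ h]) (auto simp: gr_hom_def)
qed

text \<open>The chain conditions come from finite dimension. A nondegenerate \<open>\<rho>\<close>
  yields injectivity and the isomorphism of socle and top, and that isomorphism yields such a
  \<open>\<rho>\<close>. The universe \<open>'m\<close> is left arbitrary here and becomes
  \<open>'r + 'u\<close> in the theorem.\<close>

lemma frobenius_algebra_iff_frobenius_ring:
  assumes "\<sigma> \<in> carrier G"
  shows "graded_frobenius_algebra G K R \<R> \<sigma> \<longleftrightarrow> graded_frobenius_ring TYPE('m) G R \<R> \<sigma>"
  unfolding frobenius_algebra_iff[OF assms] graded_frobenius_ring_def graded_quasi_frobenius_def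
  using graded_artinian acc_left_ideals socle_top_isomorphic_of_nondegenerate[OF assms]
    gr_injective_of_nondegenerate[OF assms] nondegenerate_of_socle_top_isomorphic[OF assms]
  by blast

end

theorem proposition7p4:
  fixes G :: "('g, 'c) monoid_scheme"
    and K :: "('k, 'd) ring_scheme"
    and R :: "('k, 'r, 'a) module_scheme"
    and \<R> :: "'g \<Rightarrow> 'r set"
    and \<sigma> :: 'g
  assumes "group G" and "field K"
    and "graded_algebra G K R \<R>"
    and "vectorspace.fin_dim K R"
    and "\<sigma> \<in> carrier G"
  shows "graded_frobenius_algebra G K R \<R> \<sigma> \<longleftrightarrow>
         graded_frobenius_ring TYPE('r + 'u) G R \<R> \<sigma>"
proof -
  interpret fd_graded_algebra G K R \<R>
    using assms by (simp add: fd_graded_algebra_def fd_graded_algebra_axioms_def)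
  show ?thesis using assms(5) by (rule frobenius_algebra_iff_frobenius_ring)
qed

end
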